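(* Let $V$ be a simple weight $AW$-module such that $\dim V_{(\lambda,\mu)}<\infty$ for some $(\lambda,\mu)\in\mathrm{Supp}(V)$. Then $V\cong F(P,M)$ for some simple weight $\mathcal K_{m,n}$-module $P$ and some simple weight $\mathfrak{gl}(m,n)$-module $M$.
   Context: All over $\mathbb C$; modules are $\mathbb Z_2$-graded, simple means no nontrivial graded submodules. Fix $(m,n)\in\mathbb Z_+^2\setminus\{(0,0)\}$. $A=\mathbb C[t_1,\dots,t_m]\otimes\Lambda(\xi_1,\dots,\xi_n)$ (even $t_i$, odd $\xi_j$), monomials $t^\alpha\xi_I$ ($\xi_I$ = product of $\xi_l$, $l\in I$ in increasing order). $W$ = Lie superalgebra of superderivations of $A$, $\tilde W=W\ltimes A$ with $[x,a]=x(a)$. $H=\mathrm{span}\{d_i=t_i\partial_{t_i},\delta_j=\xi_j\partial_{\xi_j}\}$. A weight module is one with $M=\bigoplus_{(\lambda,\mu)\in\mathbb C^{m+n}}M_{(\lambda,\mu)}$, $M_{(\lambda,\mu)}=\{v:d_iv=\lambda_iv,\delta_jv=\mu_jv\}$, and $\mathrm{Supp}(M)=\{(\lambda,\mu):M_{(\lambda,\mu)}\ne0\}$. An $AW$-module is a $\tilde W$-module on which $A$ acts associatively with $1$ acting as identity. $\mathcal K_{m,n}$ is the Weyl superalgebra generated by $t_i,\xi_j,\partial_{t_i},\partial_{\xi_j}$ (weight modules: $t_i\partial_{t_i},\xi_j\partial_{\xi_j}$ act diagonalizably). $\mathfrak{gl}(m,n)$ has matrix units $E_{a,b}$ ($E_{a,b}$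 odd iff exactly one of $a,b$ exceeds $m$); weight modules: all $E_{a,a}$ act diagonalizably. For a $\mathcal K_{m,n}$-module $P$ and a $\mathfrak{gl}(m,n)$-module $M$, $F(P,M)=P\otimes M$ is the $AW$-module on which, for $\alpha\in\mathbb Z_+^m$, $I\subseteq\{1,\dots,n\}$ ($|I|$ its cardinality), $i\le m$, $j\le n$: $t^\alpha\xi_I$ acts as $t^\alpha\xi_I\otimes1$; $t^\alpha\xi_I\partial_{t_i}$ acts as $t^\alpha\xi_I\partial_{t_i}\otimes1+\sum_{k=1}^m\alpha_kt^{\alpha-e_k}\xi_I\otimes E_{k,i}+(-1)^{|I|-1}\sum_{k=1}^n\partial_{\xi_k}(t^\alpha\xi_I)\otimes E_{m+k,i}$; $t^\alpha\xi_I\partial_{\xi_j}$ acts as $t^\alpha\xi_I\partial_{\xi_j}\otimes1+\sum_{k=1}^m\alpha_kt^{\alpha-e_k}\xi_I\otimes E_{k,m+j}+(-1)^{|I|-1}\sum_{k=1}^n\partial_{\xi_k}(t^\alpha\xi_I)\otimes E_{m+k,m+j}$; where $(x\otimes y)(u\otimes v)=(-1)^{|y||u|}xu\otimes yv$. *)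

theory Defs
  imports Complex_Main
begin

text \<open>
  Indices are 0-based.  Even variables t_0..t_(m-1), odd variables xi_0..xi_(n-1).
  A monomial t^alpha xi_I is a pair (alpha, I) with alpha :: nat => nat (alpha k = 0 for k >= m)
  and I a subset of {..<n}; xi_I is the product of the xi_l, l in I, in increasing order.
  Derivation index a < m+n: a < m means d/dt_a, a >= m means d/dxi_(a-m).
  The same index set {..<m+n} indexes the matrix units E_(a,b) of gl(m,n)
  (E_(a,b) odd iff exactly one of a,b is >= m).
  Parities are booleans (True = odd).  All vector spaces are complex vector spaces
  given by an explicit scalar multiplication sc.
\<close>

definition sgn2 :: "bool \<Rightarrow> bool \<Rightarrow> complex" where
  "sgn2 p q = (if p \<and> q then -1 else 1)"

definition valid_mono :: "nat \<Rightarrow> nat \<Rightarrow> (nat \<Rightarrow> nat) \<Rightarrow> nat set \<Rightarrow> bool" where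
  "valid_mono m n \<alpha> I \<longleftrightarrow> (\<forall>k. m \<le> k \<longrightarrow> \<alpha> k = 0) \<and> I \<subseteq> {..<n}"

text \<open>parity of t^alpha xi_I and of t^alpha xi_I d_a, and of E_(a,b)\<close>
definition pA :: "nat set \<Rightarrow> bool" where
  "pA I = odd (card I)"

definition pD :: "nat \<Rightarrow> nat set \<Rightarrow> nat \<Rightarrow> bool" where
  "pD m I a = (odd (card I) \<noteq> (m \<le> a))"

definition pE :: "nat \<Rightarrow> nat \<Rightarrow> nat \<Rightarrow> bool" where
  "pE m a b = ((m \<le> a) \<noteq> (m \<le> b))"

text \<open>(t^alpha xi_I)(t^beta xi_J) = mul_coeff I J * t^(alpha+beta) xi_(I \<union> J)\<close>
definition inv_count :: "nat set \<Rightarrow> nat set \<Rightarrow> nat" where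
  "inv_count I J = card {(i, j). i \<in> I \<and> j \<in> J \<and> j < i}"

definition mul_coeff :: "nat set \<Rightarrow> nat set \<Rightarrow> complex" where
  "mul_coeff I J = (if I \<inter> J = {} then (-1) ^ inv_count I J else 0)"

text \<open>d_a (t^beta xi_J) = der_coeff m a beta J * t^(der_exp m a beta) xi_(der_odd m a J)
  (odd derivatives act as left derivations)\<close>
definition der_coeff :: "nat \<Rightarrow> nat \<Rightarrow> (nat \<Rightarrow> nat) \<Rightarrow> nat set \<Rightarrow> complex" where
  "der_coeff m a \<beta> J =
     (if a < m then of_nat (\<beta> a)
      else if a - m \<in> J then (-1) ^ card {l \<in> J. l < a - m} else 0)"

definition der_exp :: "nat \<Rightarrow> nat \<Rightarrow> (nat \<Rightarrow> nat) \<Rightarrow> (nat \<Rightarrow> nat)" where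
  "der_exp m a \<beta> = (if a < m then \<beta>(a := \<beta> a - 1) else \<beta>)"

definition der_odd :: "nat \<Rightarrow> nat \<Rightarrow> nat set \<Rightarrow> nat set" where
  "der_odd m a J = (if a < m then J else J - {a - m})"

text \<open>(t^alpha xi_I d_a)(t^beta xi_J) = app_coeff ... * t^(app_exp ...) xi_(app_odd ...)\<close>
definition app_coeff :: "nat \<Rightarrow> nat set \<Rightarrow> nat \<Rightarrow> (nat \<Rightarrow> nat) \<Rightarrow> nat set \<Rightarrow> complex" where
  "app_coeff m I a \<beta> J = der_coeff m a \<beta> J * mul_coeff I (der_odd m a J)"

definition app_exp :: "nat \<Rightarrow> (nat \<Rightarrow> nat) \<Rightarrow> nat \<Rightarrow> (nat \<Rightarrow> nat) \<Rightarrow> (nat \<Rightarrow> nat)" where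
  "app_exp m \<alpha> a \<beta> = (\<lambda>k. \<alpha> k + der_exp m a \<beta> k)"

definition app_odd :: "nat \<Rightarrow> nat set \<Rightarrow> nat \<Rightarrow> nat set \<Rightarrow> nat set" where
  "app_odd m I a J = I \<union> der_odd m a J"

definition lin_on :: "(complex \<Rightarrow> 'v::ab_group_add \<Rightarrow> 'v) \<Rightarrow> 'v set \<Rightarrow> ('v \<Rightarrow> 'v) \<Rightarrow> bool" where
  "lin_on sc S f \<longleftrightarrow> (\<forall>x\<in>S. \<forall>y\<in>S. f (x + y) = f x + f y) \<and> (\<forall>c. \<forall>x\<in>S. f (sc c x) = sc c (f x))"

definition graded_space :: "(complex \<Rightarrow> 'v::ab_group_add \<Rightarrow> 'v) \<Rightarrow> 'v set \<Rightarrow> (bool \<Rightarrow> 'v set) \<Rightarrow> bool" where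
  "graded_space sc S G \<longleftrightarrow> module.subspace sc S \<and>
     (\<forall>p. module.subspace sc (G p) \<and> G p \<subseteq> S) \<and> G False \<inter> G True = {0} \<and>
     (\<forall>v\<in>S. \<exists>v0\<in>G False. \<exists>v1\<in>G True. v = v0 + v1)"

definition hom_op :: "(complex \<Rightarrow> 'v::ab_group_add \<Rightarrow> 'v) \<Rightarrow> 'v set \<Rightarrow> (bool \<Rightarrow> 'v set) \<Rightarrow> bool \<Rightarrow> ('v \<Rightarrow> 'v) \<Rightarrow> bool" where
  "hom_op sc S G p f \<longleftrightarrow> lin_on sc S f \<and> f ` S \<subseteq> S \<and> (\<forall>q. f ` G q \<subseteq> G (q \<noteq> p))"

definition simple_graded :: "(complex \<Rightarrow> 'v::ab_group_add \<Rightarrow> 'v) \<Rightarrow> 'v set \<Rightarrow> (bool \<Rightarrow> 'v set) \<Rightarrow> ('v \<Rightarrow> 'v) set \<Rightarrow> bool" where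
  "simple_graded sc S G ops \<longleftrightarrow> (\<exists>v\<in>S. v \<noteq> 0) \<and>
     (\<forall>U. module.subspace sc U \<and> U \<subseteq> S \<and>
          (\<forall>v\<in>U. \<exists>v0\<in>U \<inter> G False. \<exists>v1\<in>U \<inter> G True. v = v0 + v1) \<and>
          (\<forall>f\<in>ops. f ` U \<subseteq> U)
        \<longrightarrow> U = {0} \<or> U = S)"

definition wspace :: "(complex \<Rightarrow> 'v::ab_group_add \<Rightarrow> 'v) \<Rightarrow> 'v set \<Rightarrow> nat \<Rightarrow> (nat \<Rightarrow> 'v \<Rightarrow> 'v) \<Rightarrow> (nat \<Rightarrow> complex) \<Rightarrow> 'v set" where
  "wspace sc S k h wt = {v \<in> S. \<forall>i<k. h i v = sc (wt i) v}"

text \<open>weight module: S is the (automatically direct) sum of its weight spaces\<close>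
definition is_weight :: "(complex \<Rightarrow> 'v::ab_group_add \<Rightarrow> 'v) \<Rightarrow> 'v set \<Rightarrow> nat \<Rightarrow> (nat \<Rightarrow> 'v \<Rightarrow> 'v) \<Rightarrow> bool" where
  "is_weight sc S k h \<longleftrightarrow> S \<subseteq> module.span sc (\<Union>wt. wspace sc S k h wt)"

definition fin_dim :: "(complex \<Rightarrow> 'v::ab_group_add \<Rightarrow> 'v) \<Rightarrow> 'v set \<Rightarrow> bool" where
  "fin_dim sc S \<longleftrightarrow> (\<exists>B. finite B \<and> S \<subseteq> module.span sc B)"

text \<open>V (the whole type 'v) with grading VG; rA alpha I is the action of t^alpha xi_I,
  rW alpha I a the action of t^alpha xi_I d_a.\<close>
definition AW_module :: "nat \<Rightarrow> nat \<Rightarrow> (complex \<Rightarrow> 'v::ab_group_add \<Rightarrow> 'v) \<Rightarrow> (bool \<Rightarrow> 'v set)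
    \<Rightarrow> ((nat \<Rightarrow> nat) \<Rightarrow> nat set \<Rightarrow> 'v \<Rightarrow> 'v) \<Rightarrow> ((nat \<Rightarrow> nat) \<Rightarrow> nat set \<Rightarrow> nat \<Rightarrow> 'v \<Rightarrow> 'v) \<Rightarrow> bool" where
  "AW_module m n sc VG rA rW \<longleftrightarrow>
     vector_space sc \<and> graded_space sc UNIV VG \<and>
     (\<forall>\<alpha> I. valid_mono m n \<alpha> I \<longrightarrow> hom_op sc UNIV VG (pA I) (rA \<alpha> I)) \<and>
     (\<forall>\<alpha> I a. valid_mono m n \<alpha> I \<and> a < m + n \<longrightarrow> hom_op sc UNIV VG (pD m I a) (rW \<alpha> I a)) \<and>
     rA (\<lambda>_. 0) {} = id \<and>
     (\<forall>\<alpha> I \<beta> J v. valid_mono m n \<alpha> I \<and> valid_mono m n \<beta> J \<longrightarrow>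
        rA \<alpha> I (rA \<beta> J v) = sc (mul_coeff I J) (rA (\<lambda>k. \<alpha> k + \<beta> k) (I \<union> J) v)) \<and>
     (\<forall>\<alpha> I a \<beta> J v. valid_mono m n \<alpha> I \<and> a < m + n \<and> valid_mono m n \<beta> J \<longrightarrow>
        rW \<alpha> I a (rA \<beta> J v) - sc (sgn2 (pD m I a) (pA J)) (rA \<beta> J (rW \<alpha> I a v))
        = sc (app_coeff m I a \<beta> J) (rA (app_exp m \<alpha> a \<beta>) (app_odd m I a J) v)) \<and>
     (\<forall>\<alpha> I a \<beta> J b v. valid_mono m n \<alpha> I \<and> a < m + n \<and> valid_mono m n \<beta> J \<and> b < m + n \<longrightarrow>
        rW \<alpha> I a (rW \<beta> J b v) - sc (sgn2 (pD m I a) (pD m J b)) (rW \<beta> J b (rW \<alpha> I a v))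
        = sc (app_coeff m I a \<beta> J) (rW (app_exp m \<alpha> a \<beta>) (app_odd m I a J) b v)
          - sc (sgn2 (pD m I a) (pD m J b) * app_coeff m J b \<alpha> I)
               (rW (app_exp m \<beta> b \<alpha>) (app_odd m J b I) a v))"

definition AW_ops :: "nat \<Rightarrow> nat \<Rightarrow> ((nat \<Rightarrow> nat) \<Rightarrow> nat set \<Rightarrow> 'v \<Rightarrow> 'v) \<Rightarrow> ((nat \<Rightarrow> nat) \<Rightarrow> nat set \<Rightarrow> nat \<Rightarrow> 'v \<Rightarrow> 'v) \<Rightarrow> ('v \<Rightarrow> 'v) set" where
  "AW_ops m n rA rW = {rA \<alpha> I | \<alpha> I. valid_mono m n \<alpha> I} \<union> {rW \<alpha> I a | \<alpha> I a. valid_mono m n \<alpha> I \<and> a < m + n}"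

text \<open>the Cartan elements d_i = t_i d_(t_i) (i < m) and delta_j = xi_j d_(xi_j), as h (m+j)\<close>
definition AW_cartan :: "nat \<Rightarrow> ((nat \<Rightarrow> nat) \<Rightarrow> nat set \<Rightarrow> nat \<Rightarrow> 'v \<Rightarrow> 'v) \<Rightarrow> nat \<Rightarrow> 'v \<Rightarrow> 'v" where
  "AW_cartan m rW i = (if i < m then rW ((\<lambda>_. 0)(i := 1)) {} i else rW (\<lambda>_. 0) {i - m} i)"

text \<open>x a = multiplication by t_a (a<m) or xi_(a-m); d a = d/dt_a or d/dxi_(a-m); on carrier Pc\<close>
definition K_module :: "nat \<Rightarrow> nat \<Rightarrow> (complex \<Rightarrow> 'v::ab_group_add \<Rightarrow> 'v) \<Rightarrow> 'v set \<Rightarrow> (bool \<Rightarrow> 'v set)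
    \<Rightarrow> (nat \<Rightarrow> 'v \<Rightarrow> 'v) \<Rightarrow> (nat \<Rightarrow> 'v \<Rightarrow> 'v) \<Rightarrow> bool" where
  "K_module m n sc Pc PG x d \<longleftrightarrow>
     graded_space sc Pc PG \<and>
     (\<forall>a < m + n. hom_op sc Pc PG (m \<le> a) (x a) \<and> hom_op sc Pc PG (m \<le> a) (d a)) \<and>
     (\<forall>a < m + n. \<forall>b < m + n. \<forall>v\<in>Pc.
        x a (x b v) - sc (sgn2 (m \<le> a) (m \<le> b)) (x b (x a v)) = 0 \<and>
        d a (d b v) - sc (sgn2 (m \<le> a) (m \<le> b)) (d b (d a v)) = 0 \<and>
        d a (x b v) - sc (sgn2 (m \<le> a) (m \<le> b)) (x b (d a v)) = (if a = b then v else 0))"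

definition K_ops :: "nat \<Rightarrow> nat \<Rightarrow> (nat \<Rightarrow> 'v \<Rightarrow> 'v) \<Rightarrow> (nat \<Rightarrow> 'v \<Rightarrow> 'v) \<Rightarrow> ('v \<Rightarrow> 'v) set" where
  "K_ops m n x d = x ` {..<m + n} \<union> d ` {..<m + n}"

definition K_cartan :: "(nat \<Rightarrow> 'v \<Rightarrow> 'v) \<Rightarrow> (nat \<Rightarrow> 'v \<Rightarrow> 'v) \<Rightarrow> nat \<Rightarrow> 'v \<Rightarrow> 'v" where
  "K_cartan x d i = x i \<circ> d i"

definition gl_module :: "nat \<Rightarrow> nat \<Rightarrow> (complex \<Rightarrow> 'v::ab_group_add \<Rightarrow> 'v) \<Rightarrow> 'v set \<Rightarrow> (bool \<Rightarrow> 'v set)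
    \<Rightarrow> (nat \<Rightarrow> nat \<Rightarrow> 'v \<Rightarrow> 'v) \<Rightarrow> bool" where
  "gl_module m n sc Mc MG E \<longleftrightarrow>
     graded_space sc Mc MG \<and>
     (\<forall>a < m + n. \<forall>b < m + n. hom_op sc Mc MG (pE m a b) (E a b)) \<and>
     (\<forall>a < m + n. \<forall>b < m + n. \<forall>c < m + n. \<forall>e < m + n. \<forall>v\<in>Mc.
        E a b (E c e v) - sc (sgn2 (pE m a b) (pE m c e)) (E c e (E a b v))
        = (if b = c then E a e v else 0)
          - (if e = a then sc (sgn2 (pE m a b) (pE m c e)) (E c b v) else 0))"

definition gl_ops :: "nat \<Rightarrow> nat \<Rightarrow> (nat \<Rightarrow> nat \<Rightarrow> 'v \<Rightarrow> 'v) \<Rightarrow> ('v \<Rightarrow> 'v) set" where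
  "gl_ops m n E = {E a b | a b. a < m + n \<and> b < m + n}"

definition monoP :: "nat \<Rightarrow> (nat \<Rightarrow> 'v \<Rightarrow> 'v) \<Rightarrow> (nat \<Rightarrow> nat) \<Rightarrow> nat set \<Rightarrow> 'v \<Rightarrow> 'v" where
  "monoP m x \<alpha> I = foldr (\<lambda>k f. (x k ^^ \<alpha> k) \<circ> f) [0..<m]
                      (foldr (\<lambda>i f. x (m + i) \<circ> f) (sorted_list_of_set I) id)"

text \<open>V is a tensor product of Pc and Mc via the bilinear map beta (beta u v = image of u \<otimes> v)\<close>
definition is_tensor :: "(complex \<Rightarrow> 'v::ab_group_add \<Rightarrow> 'v) \<Rightarrow> 'v set \<Rightarrow> 'v set \<Rightarrow> ('v \<Rightarrow> 'v \<Rightarrow> 'v) \<Rightarrow> bool" where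
  "is_tensor sc Pc Mc \<beta> \<longleftrightarrow>
     (\<forall>u\<in>Pc. lin_on sc Mc (\<beta> u)) \<and> (\<forall>v\<in>Mc. lin_on sc Pc (\<lambda>u. \<beta> u v)) \<and>
     module.span sc ((\<lambda>(u, v). \<beta> u v) ` (Pc \<times> Mc)) = UNIV \<and>
     (\<forall>U g. finite U \<and> U \<subseteq> Pc \<and> \<not> module.dependent sc U \<and> g ` U \<subseteq> Mc \<and>
            (\<Sum>u\<in>U. \<beta> u (g u)) = 0 \<longrightarrow> (\<forall>u\<in>U. g u = 0))"

text \<open>beta induces an even isomorphism of AW-modules F(P,M) = P \<otimes> M \<cong> V\<close>
definition F_iso :: "nat \<Rightarrow> nat \<Rightarrow> (complex \<Rightarrow> 'v::ab_group_add \<Rightarrow> 'v) \<Rightarrow> (bool \<Rightarrow> 'v set)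
    \<Rightarrow> ((nat \<Rightarrow> nat) \<Rightarrow> nat set \<Rightarrow> 'v \<Rightarrow> 'v) \<Rightarrow> ((nat \<Rightarrow> nat) \<Rightarrow> nat set \<Rightarrow> nat \<Rightarrow> 'v \<Rightarrow> 'v)
    \<Rightarrow> 'v set \<Rightarrow> (bool \<Rightarrow> 'v set) \<Rightarrow> (nat \<Rightarrow> 'v \<Rightarrow> 'v) \<Rightarrow> (nat \<Rightarrow> 'v \<Rightarrow> 'v)
    \<Rightarrow> 'v set \<Rightarrow> (bool \<Rightarrow> 'v set) \<Rightarrow> (nat \<Rightarrow> nat \<Rightarrow> 'v \<Rightarrow> 'v) \<Rightarrow> ('v \<Rightarrow> 'v \<Rightarrow> 'v) \<Rightarrow> bool" where
  "F_iso m n sc VG rA rW Pc PG x d Mc MG E \<beta> \<longleftrightarrow>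
     is_tensor sc Pc Mc \<beta> \<and>
     (\<forall>p q. \<forall>u\<in>PG p. \<forall>v\<in>MG q. \<beta> u v \<in> VG (p \<noteq> q)) \<and>
     (\<forall>\<alpha> I. valid_mono m n \<alpha> I \<longrightarrow> (\<forall>u\<in>Pc. \<forall>v\<in>Mc.
        rA \<alpha> I (\<beta> u v) = \<beta> (monoP m x \<alpha> I u) v)) \<and>
     (\<forall>\<alpha> I a p. valid_mono m n \<alpha> I \<and> a < m + n \<longrightarrow> (\<forall>u\<in>PG p. \<forall>v\<in>Mc.
        rW \<alpha> I a (\<beta> u v) =
          \<beta> (monoP m x \<alpha> I (d a u)) v
          + (\<Sum>k<m. sc (of_nat (\<alpha> k) * sgn2 (pE m k a) p)
                       (\<beta> (monoP m x (\<alpha>(k := \<alpha> k - 1)) I u) (E k a v)))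
          + (\<Sum>k<n. sc ((-1) ^ (card I + 1) * der_coeff m (m + k) \<alpha> I * sgn2 (pE m (m + k) a) p)
                       (\<beta> (monoP m x \<alpha> (der_odd m (m + k) I) u) (E (m + k) a v)))))"

end

theory Submission
  imports Defs "HOL-Computational_Algebra.Fundamental_Theorem_Algebra"
begin

text \<open>
  The operators \<open>L(f, a) = f\<partial>\<^sub>a - f \<circ> \<partial>\<^sub>a\<close> supercommute with the variables, and the Euler type
  operator \<open>Eu\<close> (the sum of the \<open>x\<^sub>a\<partial>\<^sub>a - x\<^sub>a \<circ> \<partial>\<^sub>a\<close>) commutes with all \<open>x\<^sub>a\<close> and \<open>\<partial>\<^sub>a\<close>.
  The finite-dimensional weight space contains a common eigenvector of all \<open>x\<^sub>a \<circ> \<partial>\<^sub>a\<close>, hence an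
  eigenvector of \<open>Eu\<close>. For \<open>deg f > 0\<close>, \<open>L(f, a)\<close> raises eigenvalues of \<open>Eu\<close> by \<open>0, \<dots>, deg f - 1\<close>,
  so eigenvalues can never be lowered and simplicity forces \<open>Eu\<close> to be a scalar.
  Then \<open>[Eu, L(f, a)] = 0\<close> is a recursion expressing
  \<open>L(f, a)\<close> through \<open>E\<^sub>k\<^sub>a = L(x\<^sub>k, a)\<close>, which is the formula defining \<open>F(P, M)\<close>: the operators \<open>E\<^sub>k\<^sub>a\<close>
  give an action of \<open>gl(m,n)\<close> supercommuting with the Weyl superalgebra, and no higher jets act.

  It remains to split a simple module over two commuting algebras. Applying powers of the \<open>x\<^sub>a\<close> or
  \<open>\<partial>\<^sub>a\<close> to the common eigenvector produces \<open>v\<^sub>0\<close> generating a simple weight module \<open>P\<close> over the Weyl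
  superalgebra; its weight spaces are one-dimensional. With \<open>M = Hom(P, V)\<close>, evaluation
  \<open>P \<otimes> M \<rightarrow> V\<close> is surjective by simplicity of \<open>V\<close> and injective by comparing weights.
\<close>

section \<open>Linear algebra\<close>

text \<open>The operator \<open>Eu\<close> is read off from the answer: on \<open>F(P, M)\<close>
  the difference of \<open>x\<^sub>a\<partial>\<^sub>a\<close> and
  \<open>x\<^sub>a \<circ> \<partial>\<^sub>a\<close> acts as
  \<open>1 \<otimes> E\<^sub>a\<^sub>a\<close>, so \<open>Eu\<close> has to be the identity matrix
  of gl(m,n), which is central. Schur's lemma does not give the scalar at the outset, because
  \<open>Eu\<close> is not yet known to commute with the action of vector fields of higher degree;
  the one-sided shift of eigenvalues takes its place. Finite dimension enters through the single
  eigenvector that starts this argument. A priori a common eigenvector could generate a Weyl module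
  that is not simple, as \<open>t^(-1)\<close> does in C[t, 1/t], where C[t] is a proper submodule.
  Hence the passage to a vector that is extremal in every direction. No space outside V is
  constructed. A homomorphism from P is determined by the image of its generator, so Hom(P, V)
  becomes a subspace of V, and the tensor product is recognised through a bilinear map with values
  in V.\<close>

locale cspace = vector_space sc for sc :: "complex \<Rightarrow> 'v::ab_group_add \<Rightarrow> 'v"
begin

abbreviation lin :: "('v \<Rightarrow> 'v) \<Rightarrow> bool" where
  "lin f \<equiv> lin_on sc UNIV f"

lemma linI: "(\<And>u v. f (u + v) = f u + f v) \<Longrightarrow> (\<And>c v. f (sc c v) = sc c (f v)) \<Longrightarrow> lin f"
  by (simp add: lin_on_def)

lemma lin_add: "lin f \<Longrightarrow> f (u + v) = f u + f v"
  by (simp add: lin_on_def)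

lemma lin_scale: "lin f \<Longrightarrow> f (sc c v) = sc c (f v)"
  by (simp add: lin_on_def)

lemma lin_zero: "lin f \<Longrightarrow> f 0 = 0"
  using lin_scale[of f 0 0] by simp

lemma lin_minus: "lin f \<Longrightarrow> f (- v) = - f v"
  using lin_scale[of f "-1" v] by simp

lemma lin_diff: "lin f \<Longrightarrow> f (u - v) = f u - f v"
  using lin_add[of f u "- v"] by (simp add: lin_minus)

lemma lin_sum: "lin f \<Longrightarrow> f (\<Sum>i\<in>I. g i) = (\<Sum>i\<in>I. f (g i))"
  by (induction I rule: infinite_finite_induct) (simp_all add: lin_zero lin_add)

lemmas lin_simps = lin_add lin_scale lin_zero lin_minus lin_diff

lemma lin_comp: "lin f \<Longrightarrow> lin g \<Longrightarrow> lin (\<lambda>v. f (g v))"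
  by (simp add: lin_on_def)

lemma lin_funpow: "lin f \<Longrightarrow> lin (f ^^ i)"
  by (induction i) (simp_all add: lin_on_def)

lemma lin_span_image:
  assumes "lin f" "v \<in> span B" "\<And>b. b \<in> B \<Longrightarrow> f b \<in> U" "subspace U"
  shows "f v \<in> U"
  using assms(2)
proof (induction rule: span_induct)
  show "subspace {v. f v \<in> U}"
    using assms(1,4) by (auto simp: subspace_def lin_simps)
qed (use assms(3) in auto)

section \<open>Common eigenvectors of commuting operators\<close>

definition poly_op :: "('v \<Rightarrow> 'v) \<Rightarrow> complex poly \<Rightarrow> 'v \<Rightarrow> 'v" where
  "poly_op f p v = (\<Sum>i\<le>degree p. sc (coeff p i) ((f ^^ i) v))"

lemma poly_op_eq_sum:
  assumes "degree p < K"
  shows "poly_op f p v = (\<Sum>i<K. sc (coeff p i) ((f ^^ i) v))"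
  unfolding poly_op_def
  by (rule sum.mono_neutral_left) (use assms in \<open>auto simp: coeff_eq_0\<close>)

lemma poly_op_linear_factor:
  assumes "lin f"
  shows "poly_op f ([:-z, 1:] * q) v = f (poly_op f q v) - sc z (poly_op f q v)"
proof -
  define K where "K = Suc (degree q)"
  have "degree ([:-z, 1:] * q) < Suc K"
    using degree_mult_le[of "[:-z, 1:]" q] by (simp add: K_def)
  then have "poly_op f ([:-z, 1:] * q) v = (\<Sum>i<Suc K. sc (coeff ([:-z, 1:] * q) i) ((f ^^ i) v))"
    by (rule poly_op_eq_sum)
  also have "\<dots> = (\<Sum>i<Suc K. sc (coeff (pCons 0 q) i) ((f ^^ i) v))
      - (\<Sum>i<Suc K. sc z (sc (coeff q i) ((f ^^ i) v)))"
    by (simp add: sum_subtractf[symmetric] scale_left_diff_distrib algebra_simps del: sum.lessThan_Suc)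
  also have "(\<Sum>i<Suc K. sc (coeff (pCons 0 q) i) ((f ^^ i) v)) = f (\<Sum>i<K. sc (coeff q i) ((f ^^ i) v))"
    by (simp add: sum.lessThan_Suc_shift lin_sum[OF assms] lin_scale[OF assms] del: sum.lessThan_Suc)
  also have "(\<Sum>i<K. sc (coeff q i) ((f ^^ i) v)) = poly_op f q v"
    by (rule poly_op_eq_sum[symmetric]) (simp add: K_def)
  also have "(\<Sum>i<Suc K. sc z (sc (coeff q i) ((f ^^ i) v))) = sc z (poly_op f q v)"
    by (subst poly_op_eq_sum[of q "Suc K"]) (simp_all add: K_def scale_sum_right scale_right_distrib)
  finally show ?thesis .
qed

text \<open>Among \<open>card B + 1\<close> iterates in the span of \<open>B\<close> there is a
  linear relation; its coefficients are those of \<open>p\<close>.\<close>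

lemma poly_op_annihilates:
  assumes "finite B" "\<And>i. (f ^^ i) v \<in> span B"
  shows "\<exists>p. p \<noteq> 0 \<and> poly_op f p v = 0"
proof (cases "inj_on (\<lambda>i. (f ^^ i) v) {..card B}")
  case False
  then obtain i j where ij: "i \<noteq> j" "(f ^^ i) v = (f ^^ j) v"
    by (auto simp: inj_on_def)
  \<comment> \<open>Dependence concerns the set of iterates and not the family, so a repetition is
    treated apart; it is itself the relation sought.\<close>
  define p where "p = (monom 1 i - monom 1 j :: complex poly)"
  define K where "K = Suc (max (degree p) (max i j))"
  have "coeff p i = 1" using ij by (simp add: p_def)
  then have "p \<noteq> 0" by auto
  moreover have "poly_op f p v = (\<Sum>k<K. sc (coeff p k) ((f ^^ k) v))"
    by (rule poly_op_eq_sum) (simp add: K_def)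
  moreover have "\<dots> = (\<Sum>k<K. if k = i then (f ^^ i) v else 0) - (\<Sum>k<K. if k = j then (f ^^ j) v else 0)"
    unfolding sum_subtractf[symmetric] by (rule sum.cong) (use ij in \<open>auto simp: p_def\<close>)
  moreover have "i < K" "j < K" by (simp_all add: K_def less_Suc_eq_le)
  then have "(\<Sum>k<K. if k = i then (f ^^ i) v else 0) - (\<Sum>k<K. if k = j then (f ^^ j) v else 0) = 0"
    unfolding ij(2) by (subst (1 2) sum.delta) auto
  ultimately show ?thesis by auto
next
  case True
  let ?g = "\<lambda>i. (f ^^ i) v"
  have "dependent (?g ` {..card B})"
  proof (rule ccontr)
    assume "\<not> dependent (?g ` {..card B})"
    from independent_span_bound[OF assms(1) this] assms(2) have "card (?g ` {..card B}) \<le> card B"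
      by auto
    then show False using True by (simp add: card_image)
  qed
  then obtain u i where u: "i \<le> card B" "u (?g i) \<noteq> 0" "(\<Sum>w\<in>?g ` {..card B}. sc (u w) w) = 0"
    by (auto simp: dependent_finite)
  define p where "p = (\<Sum>k\<le>card B. monom (u (?g k)) k)"
  have cp: "coeff p k = (if k \<le> card B then u (?g k) else 0)" for k
    by (simp add: p_def coeff_sum)
  have "p \<noteq> 0" using u(1,2) cp by (metis coeff_0)
  moreover have "degree p < Suc (card B)"
    using cp by (simp add: degree_le less_Suc_eq_le)
  then have "poly_op f p v = (\<Sum>k<Suc (card B). sc (coeff p k) (?g k))"
    by (rule poly_op_eq_sum)
  then have "poly_op f p v = (\<Sum>k\<le>card B. sc (u (?g k)) (?g k))"
    by (simp add: cp lessThan_Suc_atMost)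
  then have "poly_op f p v = 0"
    using u(3) True by (simp add: sum.reindex)
  ultimately show ?thesis by auto
qed

text \<open>Split a linear factor off an annihilating polynomial of least degree. By minimality the
  cofactor does not annihilate \<open>v\<close>, and its value at \<open>v\<close> is the
  eigenvector.\<close>

lemma eigenvector_exists:
  assumes "lin f" "subspace S" "fin_dim sc S" "S \<noteq> {0}" "f ` S \<subseteq> S"
  shows "\<exists>v\<in>S. v \<noteq> 0 \<and> (\<exists>z. f v = sc z v)"
proof -
  obtain v where v: "v \<in> S" "v \<noteq> 0"
    using assms(2,4) subspace_0 by auto
  obtain B where B: "finite B" "S \<subseteq> span B"
    using assms(3) by (auto simp: fin_dim_def)
  have pow: "(f ^^ i) v \<in> S" for i
    using v assms(5) by (induction i) auto
  define Q where "Q p \<longleftrightarrow> p \<noteq> 0 \<and> poly_op f p v = 0" for p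
  obtain p0 where "Q p0"
    using poly_op_annihilates[OF B(1)] pow B(2) unfolding Q_def by blast
  then obtain p where p: "Q p" "\<And>q. degree q < degree p \<Longrightarrow> \<not> Q q"
    by (metis (full_types) ex_has_least_nat[of Q p0 degree] not_less)
  have "degree p \<noteq> 0"
  proof
    assume "degree p = 0"
    then obtain a where "p = [:a:]" by (rule degree_eq_zeroE)
    with p(1) v show False by (simp add: Q_def poly_op_def)
  qed
  then have "\<not> constant (poly p)" by (simp add: constant_degree)
  then obtain z where "poly p z = 0"
    using fundamental_theorem_of_algebra by blast
  then obtain q where q: "p = [:-z, 1:] * q"
    by (auto simp: poly_eq_0_iff_dvd)
  have "q \<noteq> 0" using p(1) q by (auto simp: Q_def)
  then have "degree p = Suc (degree q)"
    unfolding q by (subst degree_mult_eq) auto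
  with p(2) \<open>q \<noteq> 0\<close> have nz: "poly_op f q v \<noteq> 0" by (auto simp: Q_def)
  have "f (poly_op f q v) = sc z (poly_op f q v)"
    using p(1) poly_op_linear_factor[OF assms(1)] unfolding Q_def q by simp
  moreover have "poly_op f q v \<in> S"
    unfolding poly_op_def by (intro subspace_sum subspace_scale assms(2) pow)
  ultimately show ?thesis using nz by auto
qed

text \<open>Induction on the number of operators: a joint eigenspace of the earlier ones is
  preserved by the next, because they commute.\<close>

lemma common_eigenvector_exists:
  fixes k :: nat
  assumes "\<And>i. i < k \<Longrightarrow> lin (f i)" "subspace S" "fin_dim sc S" "S \<noteq> {0}"
    and "\<And>i. i < k \<Longrightarrow> f i ` S \<subseteq> S"
    and "\<And>i j v. i < k \<Longrightarrow> j < k \<Longrightarrow> f i (f j v) = f j (f i v)"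
  shows "\<exists>v\<in>S. v \<noteq> 0 \<and> (\<forall>i<k. \<exists>z. f i v = sc z v)"
  using assms(1,5,6)
proof (induction k)
  case 0
  then show ?case using assms(2,4) subspace_0 by auto
next
  case (Suc k)
  then obtain v where v: "v \<in> S" "v \<noteq> 0" "\<forall>i<k. \<exists>z. f i v = sc z v"
    by (metis less_SucI)
  then obtain z where z: "\<And>i. i < k \<Longrightarrow> f i v = sc (z i) v" by metis
  define S' where "S' = {w \<in> S. \<forall>i<k. f i w = sc (z i) w}"
  have "subspace S'"
    using assms(2) Suc.prems(1) unfolding S'_def subspace_def
    by (auto simp: lin_simps scale_right_distrib scale_left_commute)
  moreover have "fin_dim sc S'"
    using assms(3) unfolding fin_dim_def S'_def by auto
  moreover have "S' \<noteq> {0}" using v z by (auto simp: S'_def)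
  moreover have "f k ` S' \<subseteq> S'"
  proof
    fix w' assume "w' \<in> f k ` S'"
    then obtain w where w: "w \<in> S" "\<And>i. i < k \<Longrightarrow> f i w = sc (z i) w" "w' = f k w"
      by (auto simp: S'_def)
    have "f i w' = sc (z i) w'" if "i < k" for i
      using Suc.prems(3)[of i k w] that w Suc.prems(1)[of k] by (simp add: lin_scale)
    moreover have "w' \<in> S" using Suc.prems(2)[of k] w by auto
    ultimately show "w' \<in> S'" by (simp add: S'_def)
  qed
  ultimately obtain w where "w \<in> S'" "w \<noteq> 0" "\<exists>z. f k w = sc z w"
    using eigenvector_exists[of "f k" S'] Suc.prems(1) by auto
  then show ?case
    by (auto simp: S'_def less_Suc_eq)
qed

section \<open>Weight decompositions\<close>

text \<open>Subtracting the eigenvalue of a component \<open>j'\<close> from a separating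
  \<open>h i\<close> kills that component and multiplies the component \<open>j\<close> by a nonzero
  number, so induction on the number of components applies. With \<open>U = {0}\<close> this is the
  independence of weight vectors.\<close>

lemma weight_components_mem:
  fixes k :: nat
  assumes "subspace U" "\<And>i u. i < k \<Longrightarrow> u \<in> U \<Longrightarrow> h i u \<in> U"
    and "\<And>i. i < k \<Longrightarrow> lin (h i)"
    and "finite J" "\<And>i j. i < k \<Longrightarrow> j \<in> J \<Longrightarrow> h i (u j) = sc (wt j i) (u j)"
    and "\<And>j j'. j \<in> J \<Longrightarrow> j' \<in> J \<Longrightarrow> j \<noteq> j' \<Longrightarrow> \<exists>i<k. wt j i \<noteq> wt j' i"
    and "(\<Sum>j\<in>J. u j) \<in> U" "j \<in> J"
  shows "u j \<in> U"
  using assms(4-)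
proof (induction "card J" arbitrary: J u j rule: less_induct)
  case less
  show ?case
  proof (cases "J = {j}")
    case True
    then show ?thesis using less.prems by simp
  next
    case False
    then obtain j' where j': "j' \<in> J" "j' \<noteq> j" using less.prems(5) by blast
    then obtain i where i: "i < k" "wt j' i \<noteq> wt j i"
      using less.prems(3)[OF j'(1) less.prems(5)] by blast
    define u' where "u' l = sc (wt l i - wt j' i) (u l)" for l
    have "(\<Sum>l\<in>J. u' l) = h i (\<Sum>l\<in>J. u l) - sc (wt j' i) (\<Sum>l\<in>J. u l)"
      using i less.prems(2) assms(3)
      by (simp add: u'_def lin_sum scale_sum_right sum_subtractf[symmetric] scale_left_diff_distrib)
    also have "\<dots> \<in> U"
      by (intro subspace_diff subspace_scale assms(1,2) less.prems(4) i)
    finally have "(\<Sum>l\<in>J. u' l) \<in> U" .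
    moreover have "(\<Sum>l\<in>J. u' l) = (\<Sum>l\<in>J - {j'}. u' l)"
      using less.prems(1) j' by (simp add: sum.remove u'_def)
    moreover have "h i' (u' l) = sc (wt l i') (u' l)" if "i' < k" "l \<in> J" for i' l
      using that less.prems(2) assms(3) by (simp add: u'_def lin_scale scale_left_commute)
    moreover have "card (J - {j'}) < card J"
      by (meson card_Diff1_less j'(1) less.prems(1))
    ultimately have u': "u' l \<in> U" if "l \<in> J - {j'}" for l
      using less.hyps[of "J - {j'}" u' l] less.prems(1,3) that by simp
    then have "u' j \<in> U" using j' less.prems(5) by auto
    then have "sc (inverse (wt j i - wt j' i)) (u' j) \<in> U"
      using subspace_scale[OF assms(1)] by blast
    then show ?thesis using i by (simp add: u'_def)
  qed
qed

lemma span_UN_subspaces: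
  assumes "\<And>j. subspace (S j)" "v \<in> span (\<Union>j\<in>I. S j)"
  obtains J u where "finite J" "J \<subseteq> I" "\<And>j. u j \<in> S j" "v = (\<Sum>j\<in>J. u j)"
proof -
  \<comment> \<open>Components outside \<open>J\<close> are required to vanish so that two
    decompositions can be added over the union of their index sets.\<close>
  define Q where "Q J u v \<longleftrightarrow> finite J \<and> J \<subseteq> I \<and> (\<forall>j. u j \<in> S j) \<and> (\<forall>j. j \<notin> J \<longrightarrow> u j = 0) \<and>
      v = (\<Sum>j\<in>J. u j)" for J u v
  have Q_sum: "v = (\<Sum>j\<in>J'. u j)" if "Q J u v" "J \<subseteq> J'" "finite J'" for J J' u v
    using that unfolding Q_def by (auto intro: sum.mono_neutral_left)
  have "\<exists>J u. Q J u v"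
    using assms(2)
  proof (induction rule: span_induct)
    show "subspace {v. \<exists>J u. Q J u v}"
      unfolding subspace_def
    proof (intro conjI ballI allI)
      have "Q {} (\<lambda>_. 0) 0"
        using assms(1)[THEN subspace_0] by (simp add: Q_def)
      then show "0 \<in> {v. \<exists>J u. Q J u v}" by blast
    next
      fix a b assume "a \<in> {v. \<exists>J u. Q J u v}" "b \<in> {v. \<exists>J u. Q J u v}"
      then obtain J u J' u' where *: "Q J u a" "Q J' u' b" by blast
      then have fin: "finite (J \<union> J')" by (auto simp: Q_def)
      have "Q (J \<union> J') (\<lambda>j. u j + u' j) (a + b)"
        using * fin Q_sum[OF *(1), of "J \<union> J'"] Q_sum[OF *(2), of "J \<union> J'"] assms(1)[THEN subspace_add]
        unfolding Q_def by (auto simp: sum.distrib)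
      then show "a + b \<in> {v. \<exists>J u. Q J u v}" by blast
    next
      fix c a assume "a \<in> {v. \<exists>J u. Q J u v}"
      then obtain J u where *: "Q J u a" by blast
      then have "Q J (\<lambda>j. sc c (u j)) (sc c a)"
        using assms(1)[THEN subspace_scale] unfolding Q_def by (auto simp: scale_sum_right)
      then show "sc c a \<in> {v. \<exists>J u. Q J u v}" by blast
    qed
  next
    fix a assume "a \<in> (\<Union>j\<in>I. S j)"
    then obtain j where j: "j \<in> I" "a \<in> S j" by blast
    then have "Q {j} (\<lambda>l. if l = j then a else 0) a"
      using assms(1)[THEN subspace_0] by (auto simp: Q_def)
    then show "\<exists>J u. Q J u a" by blast
  qed
  then show ?thesis using that unfolding Q_def by blast
qed

lemma span_weight_decomposition:
  assumes "subspace S" "\<And>i. i < k \<Longrightarrow> lin (h i)"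
    and "v \<in> span (\<Union>wt. wspace sc S k h wt)"
  obtains J u where "finite J" "\<And>wt. u wt \<in> wspace sc S k h wt"
    "\<And>wt wt'. wt \<in> J \<Longrightarrow> wt' \<in> J \<Longrightarrow> wt \<noteq> wt' \<Longrightarrow> \<exists>i<k. wt i \<noteq> wt' i"
    "v = (\<Sum>wt\<in>J. u wt)"
proof -
  have sub: "subspace (wspace sc S k h wt)" for wt
    using assms(1,2) unfolding wspace_def subspace_def
    by (auto simp: lin_simps scale_right_distrib scale_left_commute)
  \<comment> \<open>Weights that agree below \<open>k\<close> have the same weight space.
    Normalising them to 0 from \<open>k\<close> on makes distinct indices differ at some
    \<open>i < k\<close>.\<close>
  define I where "I = {wt :: nat \<Rightarrow> complex. \<forall>i\<ge>k. wt i = 0}"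
  have "wspace sc S k h wt \<subseteq> (\<Union>wt\<in>I. wspace sc S k h wt)" for wt
  proof
    fix a assume "a \<in> wspace sc S k h wt"
    then have "a \<in> wspace sc S k h (\<lambda>i. if i < k then wt i else 0)" by (auto simp: wspace_def)
    moreover have "(\<lambda>i. if i < k then wt i else 0) \<in> I" by (simp add: I_def)
    ultimately show "a \<in> (\<Union>wt\<in>I. wspace sc S k h wt)" by (rule UN_I[rotated])
  qed
  then have "(\<Union>wt. wspace sc S k h wt) \<subseteq> (\<Union>wt\<in>I. wspace sc S k h wt)"
    by (rule UN_least)
  then have "v \<in> span (\<Union>wt\<in>I. wspace sc S k h wt)"
    by (rule span_mono[THEN subsetD]) (rule assms(3))
  from span_UN_subspaces[OF sub this] obtain J u where
    J: "finite J" "J \<subseteq> I" "\<And>wt. u wt \<in> wspace sc S k h wt" "v = (\<Sum>wt\<in>J. u wt)" by blast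
  show ?thesis
  proof (rule that[OF J(1,3) _ J(4)])
    fix wt wt' assume *: "wt \<in> J" "wt' \<in> J" "wt \<noteq> wt'"
    then obtain i where i: "wt i \<noteq> wt' i" by auto
    moreover have "i < k"
    proof (rule ccontr)
      assume "\<not> i < k"
      moreover have "wt \<in> I" "wt' \<in> I" using * J(2) by auto
      ultimately show False using i by (simp add: I_def)
    qed
    ultimately show "\<exists>i<k. wt i \<noteq> wt' i" by blast
  qed
qed

text \<open>The coordinate along \<open>w\<close> in a basis that extends it. In
  \<open>bt_injective\<close> such a functional turns a relation with vector coefficients into one
  with scalar coefficients.\<close>

lemma exists_linear_functional:
  assumes "w \<noteq> 0"
  obtains \<phi> :: "'v \<Rightarrow> complex" where "\<And>u v. \<phi> (u + v) = \<phi> u + \<phi> v" "\<And>c v. \<phi> (sc c v) = c * \<phi> v" "\<phi> w \<noteq> 0"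
proof -
  define B where "B = extend_basis {w}"
  have B: "independent B" "span B = UNIV" "w \<in> B"
    using assms independent_insert[of w "{}"] independent_extend_basis[of "{w}"] span_extend_basis[of "{w}"] extend_basis_superset[of "{w}"]
    by (auto simp: B_def)
  show ?thesis
    by (rule that[of "\<lambda>v. representation B v w"])
      (use B in \<open>simp_all add: representation_add representation_scale representation_basis\<close>)
qed

lemma is_weight_stable_subspace:
  assumes "is_weight sc UNIV k h" "\<And>i. i < k \<Longrightarrow> lin (h i)"
    and "subspace U" "\<And>i u. i < k \<Longrightarrow> u \<in> U \<Longrightarrow> h i u \<in> U"
  shows "is_weight sc U k h"
  unfolding is_weight_def
proof
  fix v assume "v \<in> U"
  have "v \<in> span (\<Union>wt. wspace sc UNIV k h wt)"
    using assms(1) by (auto simp: is_weight_def)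
  from span_weight_decomposition[OF subspace_UNIV assms(2) this]
  obtain J u where J: "finite J" "\<And>wt. u wt \<in> wspace sc UNIV k h wt"
    "\<And>wt wt'. wt \<in> J \<Longrightarrow> wt' \<in> J \<Longrightarrow> wt \<noteq> wt' \<Longrightarrow> \<exists>i<k. wt i \<noteq> wt' i"
    "v = (\<Sum>wt\<in>J. u wt)" by blast
  have "u wt \<in> U" if "wt \<in> J" for wt
    using weight_components_mem[of U k h J u "\<lambda>wt. wt"] assms J that \<open>v \<in> U\<close>
    by (auto simp: wspace_def)
  then have "u wt \<in> span (\<Union>wt. wspace sc U k h wt)" if "wt \<in> J" for wt
    using J(2)[of wt] that by (intro span_base) (auto simp: wspace_def)
  then show "v \<in> span (\<Union>wt. wspace sc U k h wt)"
    unfolding J(4) by (rule span_sum)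
qed

lemma simple_gradedD:
  assumes "simple_graded sc S G ops" "subspace U" "U \<subseteq> S"
    and "\<And>v. v \<in> U \<Longrightarrow> \<exists>v0\<in>U \<inter> G False. \<exists>v1\<in>U \<inter> G True. v = v0 + v1"
    and "\<And>f. f \<in> ops \<Longrightarrow> f ` U \<subseteq> U"
  shows "U = {0} \<or> U = S"
proof -
  have "subspace U \<and> U \<subseteq> S \<and> (\<forall>v\<in>U. \<exists>v0\<in>U \<inter> G False. \<exists>v1\<in>U \<inter> G True. v = v0 + v1) \<and>
      (\<forall>f\<in>ops. f ` U \<subseteq> U)"
    using assms(2-5) by blast
  with assms(1) show ?thesis unfolding simple_graded_def by blast
qed

lemma homogeneous_decomposition:
  assumes "graded_space sc UNIV VG"
  obtains v0 v1 where "v0 \<in> VG False" "v1 \<in> VG True" "v = v0 + v1"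
  using assms unfolding graded_space_def by blast

lemma homogeneous_sum_eq_0:
  assumes "graded_space sc UNIV VG" "a \<in> VG p" "b \<in> VG (\<not> p)" "a + b = 0"
  shows "a = 0" "b = 0"
proof -
  have sub: "subspace (VG q)" for q using assms(1) by (simp add: graded_space_def)
  have "a = - b" using assms(4) by (simp add: eq_neg_iff_add_eq_0)
  then have "a \<in> VG (\<not> p)" using sub[THEN subspace_neg] assms(3) by auto
  then have "a \<in> VG False \<inter> VG True" using assms(2) by (cases p) auto
  then show "a = 0" using assms(1) by (auto simp: graded_space_def)
  then show "b = 0" using assms(4) by simp
qed

end

section \<open>Weight modules over the Weyl superalgebra\<close>

lemma sgn2_square: "sgn2 p q * sgn2 p q = 1"
  by (simp add: sgn2_def)

lemma sgn2_commute: "sgn2 p q = sgn2 q p"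
  by (auto simp: sgn2_def)

lemma sgn2_xor: "sgn2 p (q \<noteq> r) = sgn2 p q * sgn2 p r"
  by (auto simp: sgn2_def)

lemma sgn2_False [simp]: "sgn2 False q = 1" "sgn2 q False = 1"
  by (auto simp: sgn2_def)

locale weyl_module = cspace sc for sc :: "complex \<Rightarrow> 'v::ab_group_add \<Rightarrow> 'v" +
  fixes m n :: nat and VG :: "bool \<Rightarrow> 'v set" and x d :: "nat \<Rightarrow> 'v \<Rightarrow> 'v"
  assumes graded: "graded_space sc UNIV VG"
    and x_hom: "a < m + n \<Longrightarrow> hom_op sc UNIV VG (m \<le> a) (x a)"
    and d_hom: "a < m + n \<Longrightarrow> hom_op sc UNIV VG (m \<le> a) (d a)"
    and x_x: "a < m + n \<Longrightarrow> b < m + n \<Longrightarrow> x a (x b v) = sc (sgn2 (m \<le> a) (m \<le> b)) (x b (x a v))"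
    and d_d: "a < m + n \<Longrightarrow> b < m + n \<Longrightarrow> d a (d b v) = sc (sgn2 (m \<le> a) (m \<le> b)) (d b (d a v))"
    and d_x: "a < m + n \<Longrightarrow> b < m + n \<Longrightarrow>
      d a (x b v) = sc (sgn2 (m \<le> a) (m \<le> b)) (x b (d a v)) + (if a = b then v else 0)"
begin

lemma VG_subspace: "subspace (VG p)"
  using graded by (simp add: graded_space_def)

lemma lin_x: "a < m + n \<Longrightarrow> lin (x a)" and lin_d: "a < m + n \<Longrightarrow> lin (d a)"
  using x_hom d_hom by (auto simp: hom_op_def)

lemma x_VG: "a < m + n \<Longrightarrow> v \<in> VG q \<Longrightarrow> x a v \<in> VG (q \<noteq> (m \<le> a))"
  and d_VG: "a < m + n \<Longrightarrow> v \<in> VG q \<Longrightarrow> d a v \<in> VG (q \<noteq> (m \<le> a))"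
  using x_hom d_hom by (auto simp: hom_op_def image_subset_iff)

lemma odd_square_zero:
  assumes "a < m + n" "m \<le> a"
  shows "x a (x a v) = 0" "d a (d a v) = 0"
proof -
  have "u = 0" if "u = - u" for u :: 'v
  proof -
    have "sc 2 u = sc 1 u + sc 1 u" by (simp only: scale_left_distrib[symmetric]) simp
    also have "\<dots> = 0" using that by (metis add.right_inverse scale_one)
    finally show ?thesis by simp
  qed
  then show "x a (x a v) = 0" "d a (d a v) = 0"
    using x_x[of a a v] d_d[of a a v] assms by (auto simp: sgn2_def)
qed

abbreviation N :: "nat \<Rightarrow> 'v \<Rightarrow> 'v" where "N a v \<equiv> x a (d a v)"

lemma lin_N: "a < m + n \<Longrightarrow> lin (N a)"
  by (rule lin_comp[OF lin_x lin_d])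

lemma N_VG: "a < m + n \<Longrightarrow> v \<in> VG q \<Longrightarrow> N a v \<in> VG q"
  using x_VG[of a "d a v" "q \<noteq> (m \<le> a)"] d_VG[of a v q] by (cases q; cases "m \<le> a") auto

text \<open>The sign from moving \<open>d a\<close> past \<open>x b\<close> is repeated when
  \<open>x a\<close> is moved past \<open>x b\<close>, since \<open>N a\<close> is even. Only the
  diagonal term of the canonical relation survives.\<close>

lemma N_x:
  assumes "a < m + n" "b < m + n"
  shows "N a (x b v) = x b (N a v) + (if a = b then x b v else 0)"
proof -
  have "N a (x b v) = sc (sgn2 (m \<le> a) (m \<le> b)) (x a (x b (d a v))) + (if a = b then x a v else 0)"
    using assms by (simp add: d_x lin_simps[OF lin_x])
  also have "sc (sgn2 (m \<le> a) (m \<le> b)) (x a (x b (d a v))) = x b (N a v)"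
    using assms by (subst x_x) (simp_all add: sgn2_square)
  finally show ?thesis by simp
qed

lemma N_d:
  assumes "a < m + n" "b < m + n"
  shows "N a (d b v) = d b (N a v) - (if a = b then d b v else 0)"
proof -
  have "d b (N a v) = sc (sgn2 (m \<le> b) (m \<le> a)) (x a (d b (d a v))) + (if a = b then d a v else 0)"
    using assms by (simp add: d_x)
  also have "sc (sgn2 (m \<le> b) (m \<le> a)) (x a (d b (d a v))) = N a (d b v)"
    using assms by (subst d_d) (simp_all add: sgn2_square lin_simps[OF lin_x] sgn2_commute)
  finally show ?thesis by auto
qed

section \<open>Homogeneous operators from the Weyl superalgebra\<close>

text \<open>The image of the Weyl superalgebra in the operators on V, so that the abstract algebra
  with its relations need not be built. The parity belongs to the construction and not to the
  function: the zero operator has both parities.\<close>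

inductive kop :: "bool \<Rightarrow> ('v \<Rightarrow> 'v) \<Rightarrow> bool" where
  kop_id: "kop False (\<lambda>v. v)"
| kop_x: "a < m + n \<Longrightarrow> kop p f \<Longrightarrow> kop ((m \<le> a) \<noteq> p) (\<lambda>v. x a (f v))"
| kop_d: "a < m + n \<Longrightarrow> kop p f \<Longrightarrow> kop ((m \<le> a) \<noteq> p) (\<lambda>v. d a (f v))"
| kop_add: "kop p f \<Longrightarrow> kop p g \<Longrightarrow> kop p (\<lambda>v. f v + g v)"
| kop_scale: "kop p f \<Longrightarrow> kop p (\<lambda>v. sc c (f v))"
| kop_zero: "kop p (\<lambda>v. 0)"

lemma kop_diff: "kop p f \<Longrightarrow> kop p g \<Longrightarrow> kop p (\<lambda>v. f v - g v)"
  using kop_add[OF _ kop_scale[of p g "-1"], of f] by simp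

lemma kop_comp: "kop p f \<Longrightarrow> kop q g \<Longrightarrow> kop (p \<noteq> q) (\<lambda>v. f (g v))"
proof (induction rule: kop.induct)
  case kop_id
  then show ?case by simp
next
  case (kop_x a p f)
  have "(((m \<le> a) \<noteq> p) \<noteq> q) = ((m \<le> a) \<noteq> (p \<noteq> q))" by auto
  then show ?case using kop.kop_x[OF kop_x.hyps(1) kop_x.IH[OF kop_x.prems]] by (simp only:)
next
  case (kop_d a p f)
  have "(((m \<le> a) \<noteq> p) \<noteq> q) = ((m \<le> a) \<noteq> (p \<noteq> q))" by auto
  then show ?case using kop.kop_d[OF kop_d.hyps(1) kop_d.IH[OF kop_d.prems]] by (simp only:)
qed (auto intro: kop.intros)

lemma kop_lin: "kop p f \<Longrightarrow> lin f"
  by (induction rule: kop.induct) (auto simp: lin_on_def lin_simps[OF lin_x] lin_simps[OF lin_d]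
      scale_right_distrib scale_left_commute add_ac)

lemma kop_VG: "kop p f \<Longrightarrow> v \<in> VG q \<Longrightarrow> f v \<in> VG (q \<noteq> p)"
proof (induction rule: kop.induct)
  case (kop_x a p f)
  have "(q \<noteq> ((m \<le> a) \<noteq> p)) = ((q \<noteq> p) \<noteq> (m \<le> a))" by auto
  then show ?case using x_VG[OF kop_x.hyps(1) kop_x.IH[OF kop_x.prems]] by (simp only:)
next
  case (kop_d a p f)
  have "(q \<noteq> ((m \<le> a) \<noteq> p)) = ((q \<noteq> p) \<noteq> (m \<le> a))" by auto
  then show ?case using d_VG[OF kop_d.hyps(1) kop_d.IH[OF kop_d.prems]] by (simp only:)
qed (auto intro: VG_subspace[THEN subspace_add] VG_subspace[THEN subspace_scale] VG_subspace[THEN subspace_0])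

lemma kop_stable:
  assumes "kop p f" "subspace U" "\<And>a u. a < m + n \<Longrightarrow> u \<in> U \<Longrightarrow> x a u \<in> U"
    and "\<And>a u. a < m + n \<Longrightarrow> u \<in> U \<Longrightarrow> d a u \<in> U" "v \<in> U"
  shows "f v \<in> U"
  using assms by (induction rule: kop.induct) (auto intro: subspace_add subspace_scale subspace_0)

lemma x_kop: "a < m + n \<Longrightarrow> kop (m \<le> a) (x a)" and d_kop: "a < m + n \<Longrightarrow> kop (m \<le> a) (d a)"
  using kop_x[OF _ kop_id, of a] kop_d[OF _ kop_id, of a] by auto

text \<open>The weight basis of a cyclic weight module over the Weyl superalgebra consists of the
  vectors obtained from the generator by \<open>word\<close>: positive exponents multiply by variables,
  negative ones differentiate.\<close>

definition step :: "nat \<Rightarrow> int \<Rightarrow> 'v \<Rightarrow> 'v" where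
  "step a k = (if 0 \<le> k then x a ^^ nat k else d a ^^ nat (- k))"

primrec word :: "(nat \<Rightarrow> int) \<Rightarrow> nat list \<Rightarrow> 'v \<Rightarrow> 'v" where
  "word \<gamma> [] v = v"
| "word \<gamma> (a # as) v = step a (\<gamma> a) (word \<gamma> as v)"

lemma funpow_kop: "kop p f \<Longrightarrow> \<exists>q. kop q (f ^^ i)"
proof (induction i)
  case 0
  then show ?case using kop_id by (auto simp: id_def)
next
  case (Suc i)
  then obtain q where "kop q (f ^^ i)" by blast
  then have "kop (p \<noteq> q) (\<lambda>v. f ((f ^^ i) v))" using Suc.prems by (rule kop_comp[rotated])
  then show ?case by (auto simp: comp_def)
qed

lemma step_kop: "a < m + n \<Longrightarrow> \<exists>q. kop q (step a k)"
  using funpow_kop[OF x_kop] funpow_kop[OF d_kop] by (simp add: step_def)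

lemma word_kop: "set as \<subseteq> {..<m + n} \<Longrightarrow> \<exists>q. kop q (word \<gamma> as)"
proof (induction as)
  case Nil
  then show ?case using kop_id by (auto simp: fun_eq_iff word_def)
next
  case (Cons a as)
  then obtain q p where "kop q (word \<gamma> as)" "kop p (step a (\<gamma> a))" using step_kop by fastforce
  then have "kop (p \<noteq> q) (\<lambda>v. step a (\<gamma> a) (word \<gamma> as v))" by (intro kop_comp)
  then show ?case by auto
qed

lemma step_lin: "a < m + n \<Longrightarrow> lin (step a k)"
  and word_lin: "set as \<subseteq> {..<m + n} \<Longrightarrow> lin (word \<gamma> as)"
  using step_kop word_kop kop_lin by blast+

lemma N_funpow:
  assumes "a < m + n" "b < m + n" "N a r = sc \<kappa> r"
  shows "N a ((x b ^^ i) r) = sc (\<kappa> + (if a = b then of_nat i else 0)) ((x b ^^ i) r)"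
    and "N a ((d b ^^ i) r) = sc (\<kappa> - (if a = b then of_nat i else 0)) ((d b ^^ i) r)"
proof -
  show "N a ((x b ^^ i) r) = sc (\<kappa> + (if a = b then of_nat i else 0)) ((x b ^^ i) r)"
    using assms
    by (induction i) (auto simp: N_x lin_simps[OF lin_x] scale_left_distrib algebra_simps)
  show "N a ((d b ^^ i) r) = sc (\<kappa> - (if a = b then of_nat i else 0)) ((d b ^^ i) r)"
    using assms
  proof (induction i)
    case (Suc i)
    then have "N a (d b ((d b ^^ i) r)) = d b (N a ((d b ^^ i) r)) - (if a = b then d b ((d b ^^ i) r) else 0)"
      by (intro N_d)
    then show ?case using Suc
      by (auto simp: lin_simps[OF lin_d] scale_left_distrib scale_left_diff_distrib algebra_simps)
  qed simp
qed

lemma N_step: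
  assumes "a < m + n" "b < m + n" "N a r = sc \<kappa> r"
  shows "N a (step b k r) = sc (\<kappa> + (if a = b then of_int k else 0)) (step b k r)"
  using N_funpow[OF assms] by (auto simp: step_def)

lemma N_word:
  assumes "a < m + n" "set as \<subseteq> {..<m + n}" "distinct as" "N a r = sc \<kappa> r"
  shows "N a (word \<gamma> as r) = sc (\<kappa> + (if a \<in> set as then of_int (\<gamma> a) else 0)) (word \<gamma> as r)"
  using assms(2,3)
proof (induction as)
  case Nil
  then show ?case using assms(4) by simp
next
  case (Cons b as)
  then show ?case
    using N_step[OF assms(1), of b "word \<gamma> as r" "\<kappa> + (if a \<in> set as then of_int (\<gamma> a) else 0)" "\<gamma> b"]
    by (auto split: if_splits)
qed

lemma x_d_funpow:
  assumes "a < m + n" "N a r = sc \<kappa> r"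
  shows "x a ((d a ^^ Suc i) r) = sc (\<kappa> - of_nat i) ((d a ^^ i) r)"
  using N_funpow(2)[OF assms(1,1,2), of i] by simp

lemma d_x_funpow:
  assumes "a < m + n" "N a r = sc \<kappa> r"
  shows "d a ((x a ^^ Suc i) r) = sc (sgn2 (m \<le> a) (m \<le> a) * (\<kappa> + of_nat i) + 1) ((x a ^^ i) r)"
  using N_funpow(1)[OF assms(1,1,2), of i] assms(1)
  by (simp add: d_x scale_left_distrib scale_right_distrib distrib_left)

lemma x_step:
  assumes "a < m + n" "N a r = sc \<kappa> r"
  shows "\<exists>c. x a (step a k r) = sc c (step a (k + 1) r)"
proof (cases "0 \<le> k")
  case True
  then have "x a (step a k r) = sc 1 (step a (k + 1) r)"
    by (simp add: step_def nat_add_distrib)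
  then show ?thesis by blast
next
  case False
  define i where "i = nat (- k - 1)"
  have k: "k = - int (Suc i)" using False by (simp add: i_def)
  have "step a (k + 1) r = (d a ^^ i) r" using k by (auto simp: step_def)
  then show ?thesis
    using x_d_funpow[OF assms, of i] k by (auto simp: step_def nat_add_distrib simp del: funpow.simps)
qed

lemma d_step:
  assumes "a < m + n" "N a r = sc \<kappa> r"
  shows "\<exists>c. d a (step a k r) = sc c (step a (k - 1) r)"
proof (cases "0 < k")
  case False
  then have "nat (1 - k) = Suc (nat (- k))" by simp
  then have "d a (step a k r) = sc 1 (step a (k - 1) r)"
    using False by (auto simp: step_def)
  then show ?thesis by blast
next
  case True
  define i where "i = nat (k - 1)"
  have k: "k = int (Suc i)" using True by (simp add: i_def)
  have "step a (k - 1) r = (x a ^^ i) r" "step a k r = (x a ^^ Suc i) r"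
    using k by (auto simp: step_def nat_add_distrib)
  then show ?thesis
    using d_x_funpow[OF assms, of i] by auto
qed

text \<open>The scalar is fixed before the vector \<open>r\<close>. It can therefore be carried
  through a whole word, and being killed by \<open>x a\<close> or \<open>d a\<close> is inherited by
  \<open>step b k r\<close>.\<close>

lemma step_commute:
  assumes "a < m + n" "b < m + n" "a \<noteq> b"
  shows "\<exists>s. \<forall>r. x a (step b k r) = sc s (step b k (x a r))"
    and "\<exists>s. \<forall>r. d a (step b k r) = sc s (step b k (d a r))"
proof -
  have gen: "\<exists>s. \<forall>r. f ((g ^^ i) r) = sc s ((g ^^ i) (f r))"
    if "\<And>r. f (g r) = sc s' (g (f r))" "lin g" for f g :: "'v \<Rightarrow> 'v" and i s'
  proof (induction i)
    case 0
    show ?case by (intro exI[of _ 1]) simp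
  next
    case (Suc i)
    then obtain s where "\<forall>r. f ((g ^^ i) r) = sc s ((g ^^ i) (f r))" by blast
    then have "\<forall>r. f ((g ^^ Suc i) r) = sc (s' * s) ((g ^^ Suc i) (f r))"
      using that by (simp add: lin_simps)
    then show ?case by blast
  qed
  have "d b (x a r) = sc (sgn2 (m \<le> b) (m \<le> a)) (x a (d b r))" for r
    using d_x[of b a r] assms by simp
  then have 1: "x a (d b r) = sc (sgn2 (m \<le> b) (m \<le> a)) (d b (x a r))" for r
    by (simp add: sgn2_square)
  have 2: "d a (x b r) = sc (sgn2 (m \<le> a) (m \<le> b)) (x b (d a r))" for r
    using d_x[of a b r] assms by simp
  have xd: "\<exists>s. \<forall>r. x a ((d b ^^ i) r) = sc s ((d b ^^ i) (x a r))"
    and dx: "\<exists>s. \<forall>r. d a ((x b ^^ i) r) = sc s ((x b ^^ i) (d a r))" for i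
    by (rule gen[of "x a" "d b", OF 1 lin_d[OF assms(2)]], rule gen[of "d a" "x b", OF 2 lin_x[OF assms(2)]])
  have xx: "\<exists>s. \<forall>r. x a ((x b ^^ i) r) = sc s ((x b ^^ i) (x a r))"
    and dd: "\<exists>s. \<forall>r. d a ((d b ^^ i) r) = sc s ((d b ^^ i) (d a r))" for i
    by (rule gen[of "x a" "x b", OF x_x[OF assms(1,2)] lin_x[OF assms(2)]], rule gen[of "d a" "d b", OF d_d[OF assms(1,2)] lin_d[OF assms(2)]])
  show "\<exists>s. \<forall>r. x a (step b k r) = sc s (step b k (x a r))"
    using xx[of "nat k"] xd[of "nat (- k)"] by (cases "0 \<le> k") (simp_all only: step_def if_True if_False)
  show "\<exists>s. \<forall>r. d a (step b k r) = sc s (step b k (d a r))"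
    using dx[of "nat k"] dd[of "nat (- k)"] by (cases "0 \<le> k") (simp_all only: step_def if_True if_False)
qed

lemma word_commute:
  assumes "a < m + n" "set as \<subseteq> {..<m + n}" "a \<notin> set as"
  shows "\<exists>s. \<forall>r. x a (word \<gamma> as r) = sc s (word \<gamma> as (x a r))"
    and "\<exists>s. \<forall>r. d a (word \<gamma> as r) = sc s (word \<gamma> as (d a r))"
proof -
  have gen: "\<exists>s. \<forall>r. f (word \<gamma> as r) = sc s (word \<gamma> as (f r))"
    if comm: "\<And>b. b < m + n \<Longrightarrow> b \<noteq> a \<Longrightarrow> \<exists>s. \<forall>r. f (step b (\<gamma> b) r) = sc s (step b (\<gamma> b) (f r))" for f
    using assms(2,3)
  proof (induction as)
    case Nil
    show ?case by (intro exI[of _ 1]) simp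
  next
    case (Cons b as)
    then have "\<exists>s. \<forall>r. f (word \<gamma> as r) = sc s (word \<gamma> as (f r))" by simp
    then obtain s where s: "\<forall>r. f (word \<gamma> as r) = sc s (word \<gamma> as (f r))" by blast
    have "b < m + n" "b \<noteq> a" using Cons.prems by auto
    then obtain s' where s': "\<forall>r. f (step b (\<gamma> b) r) = sc s' (step b (\<gamma> b) (f r))"
      using comm[of b] by blast
    then have "\<forall>r. f (word \<gamma> (b # as) r) = sc (s' * s) (word \<gamma> (b # as) (f r))"
      using s s' step_lin[OF \<open>b < m + n\<close>] by (simp add: lin_simps)
    then show ?case by blast
  qed
  show "\<exists>s. \<forall>r. x a (word \<gamma> as r) = sc s (word \<gamma> as (x a r))"
    "\<exists>s. \<forall>r. d a (word \<gamma> as r) = sc s (word \<gamma> as (d a r))"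
    using gen step_commute[OF assms(1)] by auto
qed

lemma word_cong: "(\<And>a. a \<in> set as \<Longrightarrow> \<gamma> a = \<gamma>' a) \<Longrightarrow> word \<gamma> as r = word \<gamma>' as r"
  by (induction as) auto

text \<open>The operator passes the other directions at the cost of a scalar and shifts the exponent
  in its own. So the words applied to a weight vector span a space stable under all
  \<open>x a\<close> and \<open>d a\<close>.\<close>

lemma x_d_word:
  assumes "a < m + n" "set as \<subseteq> {..<m + n}" "distinct as" "a \<in> set as" "N a r = sc \<kappa> r"
  shows "\<exists>c. x a (word \<gamma> as r) = sc c (word (\<gamma>(a := \<gamma> a + 1)) as r)"
    and "\<exists>c. d a (word \<gamma> as r) = sc c (word (\<gamma>(a := \<gamma> a - 1)) as r)"
proof -
  have gen: "\<exists>c. f (word \<gamma> as r) = sc c (word (\<gamma>(a := \<gamma> a + k)) as r)"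
    if comm: "\<And>b. b < m + n \<Longrightarrow> b \<noteq> a \<Longrightarrow> \<exists>s. \<forall>r. f (step b (\<gamma> b) r) = sc s (step b (\<gamma> b) (f r))"
      and self: "\<And>r. N a r = sc \<kappa> r \<Longrightarrow> \<exists>c. f (step a (\<gamma> a) r) = sc c (step a (\<gamma> a + k) r)" for f k
    using assms(2-4)
  proof (induction as)
    case (Cons b as)
    show ?case
    proof (cases "b = a")
      case True
      have "N a (word \<gamma> as r) = sc \<kappa> (word \<gamma> as r)"
        using N_word[of a as r \<kappa> \<gamma>] assms Cons.prems True by simp
      moreover have "word (\<gamma>(a := \<gamma> a + k)) as r = word \<gamma> as r"
        using Cons.prems True by (intro word_cong) auto
      ultimately show ?thesis using self[of "word \<gamma> as r"] unfolding True by (simp del: fun_upd_apply) (simp add: fun_upd_same)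
    next
      case False
      with Cons have "\<exists>c. f (word \<gamma> as r) = sc c (word (\<gamma>(a := \<gamma> a + k)) as r)"
        by (simp del: fun_upd_apply)
      then obtain c s where "f (word \<gamma> as r) = sc c (word (\<gamma>(a := \<gamma> a + k)) as r)"
        "\<forall>r. f (step b (\<gamma> b) r) = sc s (step b (\<gamma> b) (f r))"
        using comm[of b] False Cons.prems by auto
      then have "f (word \<gamma> (b # as) r) = sc (s * c) (word (\<gamma>(a := \<gamma> a + k)) (b # as) r)"
        using Cons.prems step_lin[of b] False by (simp add: lin_simps)
      then show ?thesis by blast
    qed
  qed simp
  show "\<exists>c. x a (word \<gamma> as r) = sc c (word (\<gamma>(a := \<gamma> a + 1)) as r)"
    by (rule gen) (use step_commute(1)[OF assms(1)] x_step[OF assms(1)] in blast)+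
  have "\<exists>c. d a (word \<gamma> as r) = sc c (word (\<gamma>(a := \<gamma> a + (- 1))) as r)"
    by (rule gen) (use step_commute(2)[OF assms(1)] d_step[OF assms(1)] in \<open>auto simp del: fun_upd_apply\<close>)
  then show "\<exists>c. d a (word \<gamma> as r) = sc c (word (\<gamma>(a := \<gamma> a - 1)) as r)"
    by simp
qed

text \<open>Irreducibility in the direction \<open>a\<close>: the powers of \<open>step a\<close> applied to such a vector can
  be undone whenever they do not vanish.\<close>

definition extremal :: "nat \<Rightarrow> complex \<Rightarrow> 'v \<Rightarrow> bool" where
  "extremal a \<kappa> r \<longleftrightarrow> d a r = 0 \<or> a < m \<and> (x a r = 0 \<or> \<kappa> \<notin> \<int>)"

text \<open>\<open>N a\<close> is \<open>d a\<close> followed by \<open>x a\<close>, and for even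
  \<open>a\<close> the opposite order is \<open>N a + 1\<close>. A nonzero extremal vector thus has
  weight 0, -1 or no integer, which keeps the factors in \<open>x_d_funpow\<close> and
  \<open>d_x_funpow\<close> nonzero as long as the powers are nonzero.\<close>

lemma extremal_weight:
  assumes "a < m + n" "N a r = sc \<kappa> r" "r \<noteq> 0"
  shows "d a r = 0 \<Longrightarrow> \<kappa> = 0" "a < m \<Longrightarrow> x a r = 0 \<Longrightarrow> \<kappa> = - 1"
proof -
  assume "d a r = 0"
  then show "\<kappa> = 0" using assms by (simp add: lin_zero[OF lin_x])
next
  assume "a < m" "x a r = 0"
  then have "sc (\<kappa> + 1) r = 0"
    using d_x[of a a r] assms by (simp add: scale_left_distrib lin_zero[OF lin_d])
  then show "\<kappa> = - 1" using assms(3) by (simp add: eq_neg_iff_add_eq_0)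
qed

text \<open>Applying \<open>d a\<close> lowers the power at the cost of the factor \<open>c\<close>.
  For even \<open>a\<close> it is \<open>\<kappa> + i + 1\<close>, which vanishes only at a negative
  integer \<open>\<kappa>\<close>; since \<open>x a r\<close> is nonzero, extremality would then
  give \<open>d a r = 0\<close> and \<open>\<kappa> = 0\<close>. For odd \<open>a\<close> only
  \<open>i = 0\<close> occurs, with \<open>\<kappa> = 0\<close> and \<open>c = 1\<close>.\<close>

lemma undo_x_power:
  assumes "a < m + n" "N a r = sc \<kappa> r" "extremal a \<kappa> r" "(x a ^^ i) r \<noteq> 0"
  shows "\<exists>p f. kop p f \<and> f ((x a ^^ i) r) = r"
  using assms(4)
proof (induction i)
  case 0
  show ?case using kop_id by auto
next
  case (Suc i)
  define c where "c = sgn2 (m \<le> a) (m \<le> a) * (\<kappa> + of_nat i) + 1"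
  have "(x a ^^ i) r \<noteq> 0" using Suc.prems lin_zero[OF lin_x[OF assms(1)]] by auto
  with Suc.IH obtain p f where f: "kop p f" "f ((x a ^^ i) r) = r" by blast
  have "r \<noteq> 0" using \<open>(x a ^^ i) r \<noteq> 0\<close> lin_zero[OF lin_funpow[OF lin_x[OF assms(1)]]] by auto
  note w = extremal_weight[OF assms(1,2) this]
  have xr: "x a r \<noteq> 0"
    using Suc.prems lin_zero[OF lin_funpow[OF lin_x[OF assms(1)]]] by (metis funpow_Suc_right comp_apply)
  have "c \<noteq> 0"
  proof (cases "a < m")
    case True
    have "\<kappa> + of_nat i + 1 \<noteq> 0"
    proof
      assume "\<kappa> + of_nat i + 1 = 0"
      then have *: "\<kappa> = - of_nat (Suc i)" by (simp only: of_nat_Suc) algebra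
      then have "\<kappa> \<in> \<int>" by simp
      then have "d a r = 0" using assms(3) xr by (auto simp: extremal_def)
      then have "of_nat (Suc i) = (0::complex)" using w(1) * by (metis add.inverse_inverse neg_0_equal_iff_equal)
      then show False by (simp only: of_nat_eq_0_iff)
    qed
    then show ?thesis using True by (simp add: c_def sgn2_def)
  next
    case False
    then have "i = 0"
      using Suc.prems odd_square_zero(1)[OF assms(1)] by (cases i) auto
    moreover have "\<kappa> = 0" using w(1) assms(3) False by (auto simp: extremal_def)
    ultimately show ?thesis by (simp add: c_def)
  qed
  have "kop (p \<noteq> (m \<le> a)) (\<lambda>v. sc (inverse c) (f (d a v)))"
    by (intro kop_scale kop_comp f d_kop assms)
  moreover have "sc (inverse c) (f (d a ((x a ^^ Suc i) r))) = r"
    unfolding d_x_funpow[OF assms(1,2)] c_def[symmetric] lin_scale[OF kop_lin[OF f(1)]] f(2)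
    using \<open>c \<noteq> 0\<close> by simp
  ultimately show ?case by blast
qed

text \<open>Here the factor is \<open>\<kappa> - i\<close>. It vanishes only at an integer
  \<open>\<kappa> \<ge> 0\<close>, whereas an extremal vector of integral weight with
  \<open>d a r\<close> nonzero has \<open>\<kappa> = -1\<close>.\<close>

lemma undo_d_power:
  assumes "a < m + n" "N a r = sc \<kappa> r" "extremal a \<kappa> r" "(d a ^^ i) r \<noteq> 0"
  shows "\<exists>p f. kop p f \<and> f ((d a ^^ i) r) = r"
  using assms(4)
proof (induction i)
  case 0
  show ?case using kop_id by auto
next
  case (Suc i)
  have "(d a ^^ i) r \<noteq> 0" using Suc.prems lin_zero[OF lin_d[OF assms(1)]] by auto
  with Suc.IH obtain p f where f: "kop p f" "f ((d a ^^ i) r) = r" by blast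
  have "r \<noteq> 0" using \<open>(d a ^^ i) r \<noteq> 0\<close> lin_zero[OF lin_funpow[OF lin_d[OF assms(1)]]] by auto
  note w = extremal_weight[OF assms(1,2) this]
  have dr: "d a r \<noteq> 0"
    using Suc.prems lin_zero[OF lin_funpow[OF lin_d[OF assms(1)]]] by (metis funpow_Suc_right comp_apply)
  have c: "\<kappa> - of_nat i \<noteq> 0"
  proof
    assume "\<kappa> - of_nat i = 0"
    then have *: "\<kappa> = of_nat i" by simp
    then have "\<kappa> \<in> \<int>" by simp
    then have "\<kappa> = - 1" using assms(3) dr w(2) by (auto simp: extremal_def)
    then have "of_nat (Suc i) = (0::complex)" using * by simp
    then show False by (simp only: of_nat_eq_0_iff)
  qed
  have "kop (p \<noteq> (m \<le> a)) (\<lambda>v. sc (inverse (\<kappa> - of_nat i)) (f (x a v)))"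
    by (intro kop_scale kop_comp f x_kop assms)
  moreover have "sc (inverse (\<kappa> - of_nat i)) (f (x a ((d a ^^ Suc i) r))) = r"
    unfolding x_d_funpow[OF assms(1,2)] lin_scale[OF kop_lin[OF f(1)]] f(2)
    using c by simp
  ultimately show ?case by blast
qed

text \<open>The outermost direction is undone first. This is possible because the rest of the word,
  which uses other directions only, keeps both the weight and the extremality in direction
  \<open>a\<close>.\<close>

lemma undo_word:
  assumes "set as \<subseteq> {..<m + n}" "distinct as" "word \<gamma> as r \<noteq> 0"
    and "\<And>a. a < m + n \<Longrightarrow> N a r = sc (\<kappa> a) r" "\<And>a. a < m + n \<Longrightarrow> extremal a (\<kappa> a) r"
  shows "\<exists>p f. kop p f \<and> f (word \<gamma> as r) = r"
  using assms(1-3)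
proof (induction as)
  case Nil
  show ?case using kop_id by auto
next
  case (Cons a as)
  have a: "a < m + n" "a \<notin> set as" "set as \<subseteq> {..<m + n}" using Cons.prems by auto
  have "word \<gamma> as r \<noteq> 0" using Cons.prems lin_zero[OF step_lin[OF a(1)]] by auto
  with Cons obtain p f where f: "kop p f" "f (word \<gamma> as r) = r" by auto
  have "N a (word \<gamma> as r) = sc (\<kappa> a) (word \<gamma> as r)"
    using N_word[OF a(1,3) _ assms(4)] a Cons.prems by simp
  moreover have "extremal a (\<kappa> a) (word \<gamma> as r)"
    using assms(5)[OF a(1)] word_commute[OF a(1,3,2), of \<gamma>] lin_zero[OF word_lin[OF a(3)]]
    unfolding extremal_def by (metis scale_zero_right)
  ultimately have "\<exists>q g. kop q g \<and> g (step a (\<gamma> a) (word \<gamma> as r)) = word \<gamma> as r"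
    using undo_x_power[OF a(1), of "word \<gamma> as r" "\<kappa> a" "nat (\<gamma> a)"]
      undo_d_power[OF a(1), of "word \<gamma> as r" "\<kappa> a" "nat (- \<gamma> a)"] Cons.prems(3)
    by (cases "0 \<le> \<gamma> a") (simp_all add: step_def)
  then obtain q g where "kop q g" "g (step a (\<gamma> a) (word \<gamma> as r)) = word \<gamma> as r" by blast
  then have "kop (p \<noteq> q) (\<lambda>v. f (g v)) \<and> f (g (word \<gamma> (a # as) r)) = r"
    using f kop_comp by simp
  then show ?case by blast
qed

section \<open>Existence of vectors extremal in every direction\<close>

text \<open>Suppose there is none. Then no power of \<open>d a\<close> kills \<open>v\<close>, since
  the last nonzero one would be extremal; so \<open>a\<close> is even, no power of
  \<open>x a\<close> kills \<open>v\<close> either, and the weight is an integer. Going down from a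
  weight at least 0 one meets weight 0, where \<open>d a\<close> gives a nonzero vector killed by
  \<open>x a\<close>; going up from a negative weight one meets -1, where \<open>x a\<close> gives
  one killed by \<open>d a\<close>. Both are extremal.\<close>

lemma step_extremal_exists:
  assumes "a < m + n" "N a v = sc \<kappa> v" "v \<noteq> 0"
  shows "\<exists>k. step a k v \<noteq> 0 \<and> extremal a (\<kappa> + of_int k) (step a k v)"
proof (rule ccontr)
  assume "\<not> ?thesis"
  then have no: "\<not> extremal a (\<kappa> + of_int k) (step a k v)" if "step a k v \<noteq> 0" for k
    using that by blast
  have st: "step a (int i) v = (x a ^^ i) v" "step a (- int i) v = (d a ^^ i) v" for i
    by (auto simp: step_def)
  have dpow: "(d a ^^ i) v \<noteq> 0" for i
  proof (induction i)
    case (Suc i)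
    then show ?case using no[of "- int i"] unfolding st by (auto simp: extremal_def)
  qed (use assms in simp)
  have even: "a < m"
    using dpow[of 2] odd_square_zero(2)[OF assms(1)] by (force simp: numeral_2_eq_2)
  have xpow: "(x a ^^ i) v \<noteq> 0" for i
  proof (induction i)
    case (Suc i)
    then show ?case using no[of "int i"] even unfolding st by (auto simp: extremal_def)
  qed (use assms in simp)
  have "\<kappa> \<in> \<int>" using no[of 0] assms(3) even by (auto simp: step_def extremal_def)
  then obtain z where z: "\<kappa> = of_int z" by (auto elim: Ints_cases)
  show False
  proof (cases "0 \<le> z")
    case True
    then have "x a ((d a ^^ Suc (nat z)) v) = 0"
      using x_d_funpow[OF assms(1,2), of "nat z"] z by simp
    then show False
      using no[of "- int (Suc (nat z))"] dpow[of "Suc (nat z)"] even unfolding st extremal_def by blast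
  next
    case False
    define i where "i = nat (- z - 1)"
    have "z = - int i - 1" using False by (simp add: i_def)
    then have "\<kappa> + of_nat i + 1 = 0" using z by simp
    then have "d a ((x a ^^ Suc i) v) = 0"
      using d_x_funpow[OF assms(1,2), of i] even by (simp add: sgn2_def)
    then show False
      using no[of "int (Suc i)"] xpow[of "Suc i"] unfolding st extremal_def by blast
  qed
qed

text \<open>Since the \<open>N a\<close> are even, a nonzero homogeneous component of
  \<open>v\<close> is an eigenvector with the same weights. The directions are then treated one at a
  time: a step in direction \<open>j\<close> changes only the weight at \<open>j\<close> and
  preserves extremality in the others.\<close>

lemma extremal_vector_exists:
  assumes "v \<noteq> 0" "\<And>a. a < m + n \<Longrightarrow> \<exists>z. N a v = sc z v"
  shows "\<exists>w \<kappa> p. w \<noteq> 0 \<and> w \<in> VG p \<and> (\<forall>a<m + n. N a w = sc (\<kappa> a) w \<and> extremal a (\<kappa> a) w)"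
proof -
  obtain \<kappa>0 where \<kappa>0: "\<And>a. a < m + n \<Longrightarrow> N a v = sc (\<kappa>0 a) v" using assms(2) by metis
  obtain u0 u1 where u: "u0 \<in> VG False" "u1 \<in> VG True" "v = u0 + u1"
    using homogeneous_decomposition[OF graded] by blast
  have wt: "N a u0 = sc (\<kappa>0 a) u0" "N a u1 = sc (\<kappa>0 a) u1" if "a < m + n" for a
  proof -
    have *: "N a u0 - sc (\<kappa>0 a) u0 \<in> VG False" "N a u1 - sc (\<kappa>0 a) u1 \<in> VG (\<not> False)"
      by (auto intro: subspace_diff[OF VG_subspace N_VG subspace_scale[OF VG_subspace]] u that)
    have "(N a u0 - sc (\<kappa>0 a) u0) + (N a u1 - sc (\<kappa>0 a) u1) = 0"
      using \<kappa>0[OF that] unfolding u(3) lin_add[OF lin_N[OF that]] by (simp add: scale_right_distrib algebra_simps)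
    then show "N a u0 = sc (\<kappa>0 a) u0" "N a u1 = sc (\<kappa>0 a) u1"
      using homogeneous_sum_eq_0[OF graded *] by auto
  qed
  have "u0 \<noteq> 0 \<or> u1 \<noteq> 0" using assms(1) u(3) by auto
  then obtain u p where u: "u \<noteq> 0" "u \<in> VG p" "\<And>a. a < m + n \<Longrightarrow> N a u = sc (\<kappa>0 a) u"
    using u(1,2) wt by blast
  have "\<exists>w \<kappa> p. w \<noteq> 0 \<and> w \<in> VG p \<and> (\<forall>a<m + n. N a w = sc (\<kappa> a) w) \<and> (\<forall>a<j. extremal a (\<kappa> a) w)"
    if "j \<le> m + n" for j
    using that
  proof (induction j)
    case 0
    then show ?case using u by blast
  next
    case (Suc j)
    then obtain w \<kappa> p where w: "w \<noteq> 0" "w \<in> VG p" "\<And>a. a < m + n \<Longrightarrow> N a w = sc (\<kappa> a) w"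
      "\<And>a. a < j \<Longrightarrow> extremal a (\<kappa> a) w" by auto
    have j: "j < m + n" using Suc.prems by simp
    from step_extremal_exists[OF j w(3)[OF j] w(1)] obtain k where
      k: "step j k w \<noteq> 0" "extremal j (\<kappa> j + of_int k) (step j k w)" by blast
    define \<kappa>' where "\<kappa>' = \<kappa>(j := \<kappa> j + of_int k)"
    have "\<exists>p. step j k w \<in> VG p" using step_kop[OF j] kop_VG w(2) by blast
    moreover have "N a (step j k w) = sc (\<kappa>' a) (step j k w)" if "a < m + n" for a
      using N_step[OF that j w(3)[OF that], of k] by (auto simp: \<kappa>'_def)
    moreover have "extremal a (\<kappa>' a) (step j k w)" if "a < Suc j" for a
    proof (cases "a = j")
      case False
      then have a: "a < m + n" "a < j" using that j by auto
      show ?thesis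
        using w(4)[OF a(2)] step_commute[OF a(1) j False, of k] lin_zero[OF step_lin[OF j]] False
        unfolding extremal_def \<kappa>'_def by (metis fun_upd_other scale_zero_right)
    qed (use k in \<open>simp add: \<kappa>'_def\<close>)
    ultimately show ?case using k(1) by blast
  qed
  from this[of "m + n"] show ?thesis by blast
qed

lemma monoP_kop:
  assumes "valid_mono m n \<alpha> I"
  shows "\<exists>p. kop p (monoP m x \<alpha> I)"
proof -
  have fold: "\<exists>p. kop p (foldr (\<lambda>k f. h k \<circ> f) ks g)"
    if "\<And>k. k \<in> set ks \<Longrightarrow> \<exists>p. kop p (h k)" "\<exists>p. kop p g" for h :: "nat \<Rightarrow> 'v \<Rightarrow> 'v" and ks g
    using that
  proof (induction ks)
    case (Cons k ks)
    then obtain p q where "kop p (h k)" "kop q (foldr (\<lambda>k f. h k \<circ> f) ks g)" by fastforce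
    from kop_comp[OF this] show ?case by (auto simp: comp_def)
  qed simp
  have "finite I" "I \<subseteq> {..<n}" using assms by (auto simp: valid_mono_def finite_subset)
  then have "\<exists>p. kop p (x (m + i))" if "i \<in> I" for i
    using that x_kop[of "m + i"] by auto
  then have "\<exists>p. kop p (foldr (\<lambda>i f. x (m + i) \<circ> f) (sorted_list_of_set I) id)"
    using kop_id \<open>finite I\<close> by (intro fold) (auto simp: id_def)
  then show ?thesis
    unfolding monoP_def using funpow_kop[OF x_kop] by (rule fold[rotated]) auto
qed

end

section \<open>Commuting actions of the Weyl superalgebra and \<open>gl(m,n)\<close>\<close>

locale weyl_gl_bimodule = weyl_module sc m n VG x d
  for sc :: "complex \<Rightarrow> 'v::ab_group_add \<Rightarrow> 'v" and m n VG x d +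
  fixes E :: "nat \<Rightarrow> nat \<Rightarrow> 'v \<Rightarrow> 'v"
  assumes E_hom: "a < m + n \<Longrightarrow> b < m + n \<Longrightarrow> hom_op sc UNIV VG (pE m a b) (E a b)"
    and E_x: "a < m + n \<Longrightarrow> b < m + n \<Longrightarrow> c < m + n \<Longrightarrow>
      E a b (x c v) = sc (sgn2 (pE m a b) (m \<le> c)) (x c (E a b v))"
    and E_d: "a < m + n \<Longrightarrow> b < m + n \<Longrightarrow> c < m + n \<Longrightarrow>
      E a b (d c v) = sc (sgn2 (pE m a b) (m \<le> c)) (d c (E a b v))"
    and E_E: "a < m + n \<Longrightarrow> b < m + n \<Longrightarrow> c < m + n \<Longrightarrow> e < m + n \<Longrightarrow>
      E a b (E c e v) - sc (sgn2 (pE m a b) (pE m c e)) (E c e (E a b v))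
        = (if b = c then E a e v else 0)
          - (if e = a then sc (sgn2 (pE m a b) (pE m c e)) (E c b v) else 0)"
    and simple: "simple_graded sc UNIV VG (K_ops m n x d \<union> gl_ops m n E)"
    and weight: "is_weight sc UNIV (m + n) (\<lambda>a v. x a (d a v) + E a a v)"
begin

lemma lin_E: "a < m + n \<Longrightarrow> b < m + n \<Longrightarrow> lin (E a b)"
  using E_hom by (auto simp: hom_op_def)

lemma E_VG: "a < m + n \<Longrightarrow> b < m + n \<Longrightarrow> v \<in> VG q \<Longrightarrow> E a b v \<in> VG (q \<noteq> pE m a b)"
  using E_hom by (auto simp: hom_op_def image_subset_iff)

lemma kop_E:
  assumes "kop p f" "a < m + n" "b < m + n"
  shows "E a b (f v) = sc (sgn2 (pE m a b) p) (f (E a b v))"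
  using assms(1)
proof (induction rule: kop.induct)
  case (kop_x c p f)
  then show ?case
    using assms by (simp add: E_x lin_simps[OF lin_x] sgn2_xor del: not_iff)
next
  case (kop_d c p f)
  then show ?case
    using assms by (simp add: E_d lin_simps[OF lin_d] sgn2_xor del: not_iff)
qed (use assms in \<open>simp_all add: lin_simps[OF lin_E] scale_right_distrib mult.commute\<close>)

end

locale weyl_gl_bimodule_extremal = weyl_gl_bimodule sc m n VG x d E
  for sc :: "complex \<Rightarrow> 'v::ab_group_add \<Rightarrow> 'v" and m n VG x d E +
  fixes v0 :: 'v and \<kappa> :: "nat \<Rightarrow> complex" and p0 :: bool
  assumes v0: "v0 \<noteq> 0" "v0 \<in> VG p0"
    and v0_weight: "a < m + n \<Longrightarrow> N a v0 = sc (\<kappa> a) v0"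
    and v0_extremal: "a < m + n \<Longrightarrow> extremal a (\<kappa> a) v0"
begin

section \<open>The Weyl module P, the space M and their pairing\<close>

text \<open>Parities are counted from \<open>v0\<close>, which is even in P whatever its parity
  \<open>p0\<close>. As \<open>MG\<close> inherits its parity from V, sending
  \<open>f v0 \<otimes> w\<close> to \<open>f w\<close> is then even.\<close>

definition PG :: "bool \<Rightarrow> 'v set" where
  "PG p = {f v0 | f. kop p f}"

definition Pc :: "'v set" where
  "Pc = {f v0 + g v0 | f g. kop False f \<and> kop True g}"

text \<open>\<open>Mc\<close> realises \<open>Hom\<close> from the Weyl module \<open>Pc\<close> to the whole space: such a homomorphism is
  determined by the image of \<open>v0\<close>, which may be any vector annihilated by the annihilator of \<open>v0\<close>.\<close>

definition Mc :: "'v set" where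
  "Mc = {w. \<forall>p f. kop p f \<and> f v0 = 0 \<longrightarrow> f w = 0}"

definition MG :: "bool \<Rightarrow> 'v set" where
  "MG q = Mc \<inter> VG q"

text \<open>Evaluation of a homomorphism: if \<open>v0\<close> goes to \<open>w\<close>, then
  \<open>f v0\<close> goes to \<open>f w\<close>. For \<open>w\<close> in \<open>Mc\<close> the
  choice of \<open>f\<close> and \<open>g\<close> is immaterial by \<open>bt_eq\<close>.\<close>

definition bt :: "'v \<Rightarrow> 'v \<Rightarrow> 'v" where
  "bt u w = (let (f, g) = (SOME (f, g). kop False f \<and> kop True g \<and> u = f v0 + g v0) in f w + g w)"

text \<open>For two representations of the same element, the even and the odd differences take
  values at \<open>v0\<close> in opposite parity spaces. Each of them therefore kills
  \<open>v0\<close>, and hence \<open>w\<close>.\<close>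

lemma bt_eq:
  assumes "kop False f" "kop True g" "w \<in> Mc"
  shows "bt (f v0 + g v0) w = f w + g w"
proof -
  let ?P = "\<lambda>(f', g'). kop False f' \<and> kop True g' \<and> f v0 + g v0 = f' v0 + g' v0"
  have "\<exists>z. ?P z" using assms by auto
  then have "?P (SOME z. ?P z)" by (rule someI_ex)
  moreover obtain f' g' where fg: "(SOME z. ?P z) = (f', g')" by (cases "SOME z. ?P z")
  ultimately have *: "kop False f'" "kop True g'" "f v0 + g v0 = f' v0 + g' v0" by auto
  have k: "kop False (\<lambda>v. f v - f' v)" "kop True (\<lambda>v. g v - g' v)"
    using assms * kop_diff by auto
  have "(f v0 - f' v0) + (g v0 - g' v0) = 0" using *(3) by (simp add: algebra_simps)
  moreover have "f v0 - f' v0 \<in> VG p0" "g v0 - g' v0 \<in> VG (\<not> p0)"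
    using kop_VG[OF k(1) v0(2)] kop_VG[OF k(2) v0(2)] by auto
  ultimately have "f v0 - f' v0 = 0" "g v0 - g' v0 = 0"
    using homogeneous_sum_eq_0[OF graded] by blast+
  then have "f w - f' w = 0" "g w - g' w = 0"
    using assms(3) k unfolding Mc_def by blast+
  then show ?thesis by (simp add: bt_def fg)
qed

lemma bt_kop: "kop p f \<Longrightarrow> w \<in> Mc \<Longrightarrow> bt (f v0) w = f w"
  using bt_eq[of f "\<lambda>_. 0"] bt_eq[of "\<lambda>_. 0" f] kop_zero by (cases p) auto

lemma PG_I: "kop p f \<Longrightarrow> f v0 \<in> PG p"
  by (auto simp: PG_def)

lemma Pc_I: "kop False f \<Longrightarrow> kop True g \<Longrightarrow> f v0 + g v0 \<in> Pc"
  by (auto simp: Pc_def)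

lemma PG_VG: "u \<in> PG p \<Longrightarrow> u \<in> VG (p0 \<noteq> p)"
  using kop_VG[OF _ v0(2)] by (auto simp: PG_def simp del: not_iff)

lemma PG_subspace: "subspace (PG p)"
  unfolding subspace_def
proof (intro conjI ballI allI)
  show "0 \<in> PG p" using PG_I[OF kop_zero] .
next
  fix u u' assume "u \<in> PG p" "u' \<in> PG p"
  then show "u + u' \<in> PG p" using PG_I[OF kop_add] by (auto simp: PG_def)
next
  fix c u assume "u \<in> PG p"
  then show "sc c u \<in> PG p" using PG_I[OF kop_scale] by (auto simp: PG_def)
qed

lemma Pc_subspace: "subspace Pc"
proof -
  have "Pc = {u + u' | u u'. u \<in> PG False \<and> u' \<in> PG True}" by (auto simp: Pc_def PG_def)
  then show ?thesis using subspace_sums[OF PG_subspace PG_subspace] by simp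
qed

lemma PG_Pc: "PG p \<subseteq> Pc"
proof
  fix u assume "u \<in> PG p"
  then obtain f where f: "kop p f" "u = f v0" by (auto simp: PG_def)
  show "u \<in> Pc"
  proof (cases "p = True")
    case True
    with f show ?thesis using Pc_I[OF kop_zero, of f] by simp
  next
    case False
    with f show ?thesis using Pc_I[OF _ kop_zero, of f] by simp
  qed
qed

lemma Pc_decomposition:
  assumes "u \<in> Pc"
  obtains u0 u1 where "u0 \<in> PG False" "u1 \<in> PG True" "u = u0 + u1"
  using assms by (auto simp: Pc_def PG_def)

lemma Pc_graded: "graded_space sc Pc PG"
proof -
  have "PG False \<inter> PG True \<subseteq> VG p0 \<inter> VG (\<not> p0)" using PG_VG by fastforce
  also have "\<dots> = {0}" using graded by (cases p0) (auto simp: graded_space_def)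
  finally have "PG False \<inter> PG True = {0}" using PG_subspace[THEN subspace_0] by auto
  then show ?thesis
    unfolding graded_space_def using Pc_subspace PG_subspace PG_Pc Pc_decomposition by metis
qed

lemma PG_kop: "kop q f \<Longrightarrow> u \<in> PG p \<Longrightarrow> f u \<in> PG (p \<noteq> q)"
proof -
  assume f: "kop q f" "u \<in> PG p"
  then obtain g where g: "kop p g" "u = g v0" by (auto simp: PG_def)
  then have "kop (q \<noteq> p) (\<lambda>v. f (g v))" using f kop_comp by blast
  moreover have "(p \<noteq> q) = (q \<noteq> p)" by auto
  ultimately show "f u \<in> PG (p \<noteq> q)" unfolding g(2) using PG_I by (simp only:)
qed

lemma Pc_kop: "kop q f \<Longrightarrow> u \<in> Pc \<Longrightarrow> f u \<in> Pc"
proof -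
  assume f: "kop q f" "u \<in> Pc"
  then obtain u0 u1 where u: "u0 \<in> PG False" "u1 \<in> PG True" "u = u0 + u1" by (elim Pc_decomposition)
  then have "f u0 \<in> Pc" "f u1 \<in> Pc" using PG_kop[OF f(1)] PG_Pc by blast+
  then show "f u \<in> Pc" using u(3) lin_add[OF kop_lin[OF f(1)]] subspace_add[OF Pc_subspace] by simp
qed

lemma kop_hom: "kop q f \<Longrightarrow> hom_op sc Pc PG q f"
  unfolding hom_op_def using PG_kop[of q f] Pc_kop[of q f] kop_lin[of q f]
  by (auto simp: lin_on_def image_subset_iff simp del: not_iff)

lemma Pc_module: "K_module m n sc Pc PG x d"
  unfolding K_module_def
proof (intro conjI allI impI ballI)
  fix a assume "a < m + n"
  then show "hom_op sc Pc PG (m \<le> a) (x a)" "hom_op sc Pc PG (m \<le> a) (d a)"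
    using kop_hom x_kop d_kop by auto
next
  fix a b v assume *: "a < m + n" "b < m + n"
  show "x a (x b v) - sc (sgn2 (m \<le> a) (m \<le> b)) (x b (x a v)) = 0"
    "d a (d b v) - sc (sgn2 (m \<le> a) (m \<le> b)) (d b (d a v)) = 0"
    "d a (x b v) - sc (sgn2 (m \<le> a) (m \<le> b)) (x b (d a v)) = (if a = b then v else 0)"
    using x_x[OF *] d_d[OF *] d_x[OF *] by simp_all
qed (rule Pc_graded)

lemma Mc_kop_zero: "w \<in> Mc \<Longrightarrow> kop p f \<Longrightarrow> f v0 = 0 \<Longrightarrow> f w = 0"
  by (auto simp: Mc_def)

lemma Mc_subspace: "subspace Mc"
proof -
  have "subspace {w. f w = 0}" if "kop p f" for p f
    using kop_lin[OF that] by (auto simp: subspace_def lin_simps)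
  then have "subspace (\<Inter>S \<in> {{w. f w = 0} | p f. kop p f \<and> f v0 = 0}. S)"
    by (intro subspace_Int) blast
  moreover have "Mc = (\<Inter>S \<in> {{w. f w = 0} | p f. kop p f \<and> f v0 = 0}. S)"
    by (auto simp: Mc_def)
  ultimately show ?thesis by simp
qed

lemma v0_Mc: "v0 \<in> Mc"
  by (simp add: Mc_def)

text \<open>\<open>N a - \<kappa> a\<close> annihilates \<open>v0\<close>. Consequently the weight
  of a word applied to \<open>w\<close> depends on the exponents alone, which lets weights separate
  the words.\<close>

lemma Mc_weight:
  assumes "w \<in> Mc" "a < m + n"
  shows "N a w = sc (\<kappa> a) w"
proof -
  have "kop ((m \<le> a) \<noteq> (m \<le> a)) (N a)" using assms(2) by (intro kop_comp x_kop d_kop)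
  then have "kop False (\<lambda>v. N a v - sc (\<kappa> a) v)" using kop_diff[OF _ kop_scale[OF kop_id]] by simp
  from Mc_kop_zero[OF assms(1) this] show ?thesis using v0_weight[OF assms(2)] by simp
qed

text \<open>The kernel of an operator that supercommutes with \<open>E a b\<close> is stable under
  \<open>E a b\<close>.\<close>

lemma Mc_E:
  assumes "w \<in> Mc" "a < m + n" "b < m + n"
  shows "E a b w \<in> Mc"
  unfolding Mc_def
proof (intro CollectI allI impI)
  fix p f assume f: "kop p f \<and> f v0 = 0"
  then have "sc (sgn2 (pE m a b) p) (f (E a b w)) = 0"
    using kop_E[of p f a b w] Mc_kop_zero[OF assms(1)] assms lin_zero[OF lin_E] by metis
  then show "f (E a b w) = 0" by (auto simp: sgn2_def split: if_splits)
qed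

text \<open>The annihilating operators are taken homogeneous, so they kill the two parity components
  separately.\<close>

lemma Mc_components:
  assumes "w0 \<in> VG False" "w1 \<in> VG True" "w0 + w1 \<in> Mc"
  shows "w0 \<in> Mc" "w1 \<in> Mc"
proof -
  have *: "f w0 = 0 \<and> f w1 = 0" if f: "kop p f" "f v0 = 0" for p f
  proof -
    have "f w0 + f w1 = 0"
      using Mc_kop_zero[OF assms(3) f] lin_add[OF kop_lin[OF f(1)]] by simp
    moreover have "f w0 \<in> VG p" "f w1 \<in> VG (\<not> p)"
      using kop_VG[OF f(1) assms(1)] kop_VG[OF f(1) assms(2)] by auto
    ultimately show ?thesis using homogeneous_sum_eq_0[OF graded] by blast
  qed
  then show "w0 \<in> Mc" "w1 \<in> Mc" by (auto simp: Mc_def)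
qed

lemma Mc_decomposition:
  assumes "w \<in> Mc"
  obtains w0 w1 where "w0 \<in> MG False" "w1 \<in> MG True" "w = w0 + w1"
proof -
  obtain w0 w1 where w: "w0 \<in> VG False" "w1 \<in> VG True" "w = w0 + w1"
    using homogeneous_decomposition[OF graded] by blast
  with Mc_components[of w0 w1] assms show ?thesis by (intro that[of w0 w1]) (auto simp: MG_def)
qed

lemma Mc_module: "gl_module m n sc Mc MG E"
  unfolding gl_module_def
proof (intro conjI allI impI ballI)
  have "MG False \<inter> MG True = {0}"
    using graded subspace_0[OF Mc_subspace] by (auto simp: MG_def graded_space_def)
  then show "graded_space sc Mc MG"
    unfolding graded_space_def
    using Mc_subspace VG_subspace subspace_inter[OF Mc_subspace VG_subspace] Mc_decomposition
    by (metis MG_def Int_lower1)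
next
  fix a b assume *: "a < m + n" "b < m + n"
  then show "hom_op sc Mc MG (pE m a b) (E a b)"
    unfolding hom_op_def MG_def using lin_E[OF *] Mc_E[OF _ *] E_VG[OF *]
    by (auto simp: lin_on_def image_subset_iff simp del: not_iff)
qed (use E_E in simp)

section \<open>Subspaces generated by words, and comparison of weights\<close>

abbreviation Y :: "(nat \<Rightarrow> int) \<Rightarrow> 'v \<Rightarrow> 'v" where "Y \<gamma> \<equiv> word \<gamma> [0..<m + n]"

text \<open>Vanishing from \<open>m + n\<close> on makes an exponent recoverable from the weight
  that it produces.\<close>

definition exponents :: "(nat \<Rightarrow> int) set" where
  "exponents = {\<gamma>. \<forall>a\<ge>m + n. \<gamma> a = 0}"

text \<open>If \<open>W\<close> consists of vectors of weight \<open>\<kappa>\<close>, this is the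
  Weyl submodule generated by \<open>W\<close>: by \<open>gen_x_d\<close> further products of the
  operators add nothing to the words.\<close>

definition gen :: "'v set \<Rightarrow> 'v set" where
  "gen W = span (\<Union>\<gamma>\<in>exponents. Y \<gamma> ` W)"

lemma Y_kop: "\<exists>p. kop p (Y \<gamma>)" and Y_lin: "lin (Y \<gamma>)"
  using word_kop[of "[0..<m + n]"] word_lin[of "[0..<m + n]"] by (auto simp: atLeast0LessThan)

lemma Y_zero: "Y (\<lambda>_. 0) w = w"
proof -
  have "word (\<lambda>_. 0) as w = w" for as by (induction as) (simp_all add: step_def)
  then show ?thesis .
qed

lemma Y_weight:
  assumes "a < m + n" "N a w = sc (\<kappa> a) w"
  shows "N a (Y \<gamma> w) = sc (\<kappa> a + of_int (\<gamma> a)) (Y \<gamma> w)"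
  using N_word[OF assms(1) _ _ assms(2), of "[0..<m + n]" \<gamma>] assms(1) by (simp add: atLeast0LessThan)

lemma gen_superset: "W \<subseteq> gen W"
proof
  fix w assume "w \<in> W"
  then have "Y (\<lambda>_. 0) w \<in> Y (\<lambda>_. 0) ` W" by (rule imageI)
  moreover have "(\<lambda>_. 0) \<in> exponents" by (simp add: exponents_def)
  ultimately have "Y (\<lambda>_. 0) w \<in> gen W"
    unfolding gen_def by (intro span_base) (rule UN_I[where a = "\<lambda>_. 0"])
  then show "w \<in> gen W" by (simp only: Y_zero)
qed

lemma gen_x_d:
  assumes "\<And>w a. w \<in> W \<Longrightarrow> a < m + n \<Longrightarrow> N a w = sc (\<kappa> a) w" "a < m + n" "v \<in> gen W"
  shows "x a v \<in> gen W" "d a v \<in> gen W"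
proof -
  have word: "\<exists>c. x a (Y \<gamma> w) = sc c (Y (\<gamma>(a := \<gamma> a + 1)) w)"
      "\<exists>c. d a (Y \<gamma> w) = sc c (Y (\<gamma>(a := \<gamma> a - 1)) w)" if "w \<in> W" for \<gamma> w
    using x_d_word[OF assms(2) _ _ _ assms(1)[OF that assms(2)], of "[0..<m + n]" \<gamma>] assms(2)
    by (simp_all del: fun_upd_apply add: atLeast0LessThan)
  have *: "sc c (Y (\<gamma>(a := \<gamma> a + k)) w) \<in> gen W" if "w \<in> W" "\<gamma> \<in> exponents" for c k \<gamma> w
  proof -
    have "\<gamma>(a := \<gamma> a + k) \<in> exponents" using that assms(2) by (auto simp: exponents_def)
    then show ?thesis unfolding gen_def using that(1) by (intro span_scale span_base) blast
  qed
  show "x a v \<in> gen W"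
    using assms(3) unfolding gen_def
  proof (rule lin_span_image[OF lin_x[OF assms(2)]])
    fix b assume "b \<in> (\<Union>\<gamma>\<in>exponents. Y \<gamma> ` W)"
    then obtain \<gamma> w where b: "\<gamma> \<in> exponents" "w \<in> W" "b = Y \<gamma> w" by blast
    then show "x a b \<in> span (\<Union>\<gamma>\<in>exponents. Y \<gamma> ` W)"
      using word(1)[of w \<gamma>] *[of w \<gamma> _ 1] unfolding gen_def by metis
  qed simp
  show "d a v \<in> gen W"
    using assms(3) unfolding gen_def
  proof (rule lin_span_image[OF lin_d[OF assms(2)]])
    fix b assume "b \<in> (\<Union>\<gamma>\<in>exponents. Y \<gamma> ` W)"
    then obtain \<gamma> w where b: "\<gamma> \<in> exponents" "w \<in> W" "b = Y \<gamma> w" by blast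
    then show "d a b \<in> span (\<Union>\<gamma>\<in>exponents. Y \<gamma> ` W)"
      using word(2)[of w \<gamma>] *[of w \<gamma> _ "-1"] unfolding gen_def by (metis diff_conv_add_uminus)
  qed simp
qed

lemma gen_decomposition:
  assumes "subspace W" "v \<in> gen W"
  obtains J w where "finite J" "J \<subseteq> exponents" "\<And>\<gamma>. w \<gamma> \<in> W" "v = (\<Sum>\<gamma>\<in>J. Y \<gamma> (w \<gamma>))"
proof -
  have "subspace (Y \<gamma> ` W)" for \<gamma>
    unfolding subspace_def
  proof (intro conjI ballI allI)
    show "0 \<in> Y \<gamma> ` W" using lin_zero[OF Y_lin] subspace_0[OF assms(1)] by (metis image_eqI)
  next
    fix u u' assume "u \<in> Y \<gamma> ` W" "u' \<in> Y \<gamma> ` W"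
    then show "u + u' \<in> Y \<gamma> ` W"
      using subspace_add[OF assms(1)] lin_add[OF Y_lin, symmetric] by fastforce
  next
    fix c u assume "u \<in> Y \<gamma> ` W"
    then show "sc c u \<in> Y \<gamma> ` W"
      using subspace_scale[OF assms(1)] lin_scale[OF Y_lin, symmetric] by fastforce
  qed
  from span_UN_subspaces[OF this assms(2)[unfolded gen_def]] obtain J u where
    J: "finite J" "J \<subseteq> exponents" "\<And>\<gamma>. u \<gamma> \<in> Y \<gamma> ` W" "v = (\<Sum>\<gamma>\<in>J. u \<gamma>)" by blast
  have "\<exists>w. \<forall>\<gamma>. w \<gamma> \<in> W \<and> u \<gamma> = Y \<gamma> (w \<gamma>)"
    using J(3) by (intro choice) (simp add: image_iff Bex_def)
  then obtain w where "\<And>\<gamma>. w \<gamma> \<in> W" "\<And>\<gamma>. u \<gamma> = Y \<gamma> (w \<gamma>)" by blast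
  with J that[of J w] show ?thesis by simp
qed

text \<open>The vectors \<open>Y \<gamma> (w \<gamma>)\<close> have pairwise different weights
  \<open>\<kappa> + \<gamma>\<close>. The case \<open>U = {0}\<close> says that in a vanishing sum
  every term vanishes.\<close>

lemma exponents_components:
  assumes "finite J" "J \<subseteq> exponents" "\<And>\<gamma> a. \<gamma> \<in> J \<Longrightarrow> a < m + n \<Longrightarrow> N a (w \<gamma>) = sc (\<kappa> a) (w \<gamma>)"
    and "subspace U" "\<And>a u. a < m + n \<Longrightarrow> u \<in> U \<Longrightarrow> N a u \<in> U"
    and "(\<Sum>\<gamma>\<in>J. Y \<gamma> (w \<gamma>)) \<in> U" "\<gamma> \<in> J"
  shows "Y \<gamma> (w \<gamma>) \<in> U"
proof (rule weight_components_mem[where h = N and k = "m + n" and J = J and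
      u = "\<lambda>\<gamma>. Y \<gamma> (w \<gamma>)" and wt = "\<lambda>\<gamma> a. \<kappa> a + of_int (\<gamma> a)"])
  fix \<gamma> \<gamma>' assume *: "\<gamma> \<in> J" "\<gamma>' \<in> J" "\<gamma> \<noteq> \<gamma>'"
  then obtain a where a: "\<gamma> a \<noteq> \<gamma>' a" by blast
  have "a < m + n"
  proof (rule ccontr)
    assume "\<not> a < m + n"
    moreover have "\<gamma> \<in> exponents" "\<gamma>' \<in> exponents" using * assms(2) by auto
    ultimately show False using a by (simp add: exponents_def)
  qed
  then show "\<exists>a<m + n. \<kappa> a + of_int (\<gamma> a) \<noteq> \<kappa> a + of_int (\<gamma>' a)" using a by auto
qed (use assms lin_N Y_weight in auto)

text \<open>The \<open>E a b\<close> pass through words up to sign, so \<open>gen W\<close> is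
  stable under both actions and simplicity of V applies. For \<open>W = Mc\<close> this makes the
  pairing surjective; for a submodule of \<open>Mc\<close> it leads to simplicity of
  \<open>Mc\<close>.\<close>

lemma gen_eq_UNIV:
  assumes "subspace W" "W \<subseteq> Mc" "W \<noteq> {0}"
    and "\<And>a b w. a < m + n \<Longrightarrow> b < m + n \<Longrightarrow> w \<in> W \<Longrightarrow> E a b w \<in> W"
    and "\<And>w. w \<in> W \<Longrightarrow> \<exists>w0\<in>W \<inter> VG False. \<exists>w1\<in>W \<inter> VG True. w = w0 + w1"
  shows "gen W = UNIV"
proof -
  have sub: "subspace (gen W)" by (simp add: gen_def)
  have wt: "N a w = sc (\<kappa> a) w" if "w \<in> W" "a < m + n" for w a
    using Mc_weight that assms(2) by blast
  have base: "Y \<gamma> w \<in> gen W" if "\<gamma> \<in> exponents" "w \<in> W" for \<gamma> w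
    unfolding gen_def using that by (intro span_base) blast
  have E_st: "E a b v \<in> gen W" if "a < m + n" "b < m + n" "v \<in> gen W" for a b v
    using that(3) unfolding gen_def
  proof (rule lin_span_image[OF lin_E[OF that(1,2)]])
    fix u assume "u \<in> (\<Union>\<gamma>\<in>exponents. Y \<gamma> ` W)"
    then obtain \<gamma> w where u: "\<gamma> \<in> exponents" "w \<in> W" "u = Y \<gamma> w" by blast
    obtain p where "kop p (Y \<gamma>)" using Y_kop by blast
    then have "E a b u = sc (sgn2 (pE m a b) p) (Y \<gamma> (E a b w))"
      using kop_E that u(3) by simp
    then show "E a b u \<in> span (\<Union>\<gamma>\<in>exponents. Y \<gamma> ` W)"
      using subspace_scale[OF sub base[OF u(1) assms(4)[OF that(1,2) u(2)]]] unfolding gen_def by simp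
  qed simp
  have gr: "\<exists>v0\<in>gen W \<inter> VG False. \<exists>v1\<in>gen W \<inter> VG True. v = v0 + v1" if "v \<in> gen W" for v
    using that unfolding gen_def
  proof (induction rule: span_induct)
    let ?S = "\<lambda>p. span (\<Union>\<gamma>\<in>exponents. Y \<gamma> ` W) \<inter> VG p"
    have eq: "{v. \<exists>v0\<in>?S False. \<exists>v1\<in>?S True. v = v0 + v1} = {u + u' | u u'. u \<in> ?S False \<and> u' \<in> ?S True}"
      by blast
    show "subspace {v. \<exists>v0\<in>?S False. \<exists>v1\<in>?S True. v = v0 + v1}"
      unfolding eq by (intro subspace_sums subspace_inter VG_subspace) simp_all
  next
    fix u assume "u \<in> (\<Union>\<gamma>\<in>exponents. Y \<gamma> ` W)"
    then obtain \<gamma> w where u: "\<gamma> \<in> exponents" "w \<in> W" "u = Y \<gamma> w" by blast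
    obtain w0 w1 where w: "w0 \<in> W \<inter> VG False" "w1 \<in> W \<inter> VG True" "w = w0 + w1"
      using assms(5)[OF u(2)] by blast
    obtain p where p: "kop p (Y \<gamma>)" using Y_kop by blast
    have "Y \<gamma> w0 \<in> gen W \<inter> VG p" "Y \<gamma> w1 \<in> gen W \<inter> VG (\<not> p)"
      using base[OF u(1)] w kop_VG[OF p, of w0 False] kop_VG[OF p, of w1 True] by auto
    moreover have "u = Y \<gamma> w0 + Y \<gamma> w1" "u = Y \<gamma> w1 + Y \<gamma> w0"
      using u(3) w(3) lin_add[OF Y_lin] by (simp_all add: add.commute)
    ultimately have "\<exists>v0\<in>gen W \<inter> VG False. \<exists>v1\<in>gen W \<inter> VG True. u = v0 + v1"
      by (cases p) (metis (full_types))+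
    then show "\<exists>v0\<in>span (\<Union>\<gamma>\<in>exponents. Y \<gamma> ` W) \<inter> VG False.
        \<exists>v1\<in>span (\<Union>\<gamma>\<in>exponents. Y \<gamma> ` W) \<inter> VG True. u = v0 + v1"
      unfolding gen_def .
  qed
  have "\<forall>f\<in>K_ops m n x d \<union> gl_ops m n E. f ` gen W \<subseteq> gen W"
    using gen_x_d[OF wt] E_st by (auto simp: K_ops_def gl_ops_def)
  then have "gen W = {0} \<or> gen W = UNIV"
    using simple sub gr unfolding simple_graded_def by simp
  moreover have "gen W \<noteq> {0}"
    using assms(3) gen_superset[of W] subspace_0[OF assms(1)] by auto
  ultimately show ?thesis by blast
qed

lemma gen_Mc: "gen Mc = UNIV"
proof (rule gen_eq_UNIV)
  show "\<exists>w0\<in>Mc \<inter> VG False. \<exists>w1\<in>Mc \<inter> VG True. w = w0 + w1" if "w \<in> Mc" for w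
    using Mc_decomposition[OF that] unfolding MG_def by metis
qed (use Mc_subspace v0 v0_Mc Mc_E in auto)

lemma Pc_subset_gen: "Pc \<subseteq> gen (span {v0})"
proof
  fix u assume "u \<in> Pc"
  then obtain f g where u: "kop False f" "kop True g" "u = f v0 + g v0" by (auto simp: Pc_def)
  have sub: "subspace (gen (span {v0}))" by (simp add: gen_def)
  have wt: "N a w = sc (\<kappa> a) w" if "w \<in> span {v0}" "a < m + n" for w a
    using that Mc_weight span_minimal[of "{v0}" Mc] v0_Mc Mc_subspace by blast
  have "v0 \<in> gen (span {v0})" using gen_superset span_superset by blast
  then have "f v0 \<in> gen (span {v0})" "g v0 \<in> gen (span {v0})"
    using kop_stable[OF u(1) sub] kop_stable[OF u(2) sub] gen_x_d[OF wt] by blast+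
  then show "u \<in> gen (span {v0})" unfolding u(3) using subspace_add[OF sub] by blast
qed

lemma Pc_expansion:
  assumes "u \<in> Pc"
  obtains J c where "finite J" "J \<subseteq> exponents" "u = (\<Sum>\<gamma>\<in>J. sc (c \<gamma>) (Y \<gamma> v0))"
proof -
  have "u \<in> gen (span {v0})" using assms Pc_subset_gen by blast
  from gen_decomposition[OF subspace_span this] obtain J w where
    J: "finite J" "J \<subseteq> exponents" "\<And>\<gamma>. w \<gamma> \<in> span {v0}" "u = (\<Sum>\<gamma>\<in>J. Y \<gamma> (w \<gamma>))" by blast
  have "\<exists>c. \<forall>\<gamma>. w \<gamma> = sc (c \<gamma>) v0"
    using J(3) by (intro choice) (simp add: span_singleton image_iff)
  then obtain c where "\<And>\<gamma>. w \<gamma> = sc (c \<gamma>) v0" by blast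
  with J that[of J c] show ?thesis by (simp add: lin_scale[OF Y_lin])
qed

lemma Y_Pc: "Y \<gamma> v0 \<in> Pc"
proof -
  obtain p where "kop p (Y \<gamma>)" using Y_kop by blast
  then have "Y \<gamma> v0 \<in> PG p" by (auto simp: PG_def)
  then show ?thesis using PG_Pc by blast
qed

text \<open>What undoes \<open>Y \<gamma>\<close> on \<open>v0\<close> undoes it on all of
  \<open>Mc\<close>, because the difference from the identity kills \<open>v0\<close>.\<close>

lemma Y_undo:
  assumes "Y \<gamma> v0 \<noteq> 0"
  obtains p f where "kop p f" "f (Y \<gamma> v0) = v0" "\<And>w. w \<in> Mc \<Longrightarrow> f (Y \<gamma> w) = w"
proof -
  obtain p f where f: "kop p f" "f (Y \<gamma> v0) = v0"
    using undo_word[of "[0..<m + n]" \<gamma> v0 \<kappa>] assms v0_weight v0_extremal by (auto simp: atLeast0LessThan)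
  obtain q where q: "kop q (Y \<gamma>)" using Y_kop by blast
  have fY: "kop (p \<noteq> q) (\<lambda>v. f (Y \<gamma> v))" using kop_comp[OF f(1) q] .
  \<comment> \<open>\<open>f \<circ> Y \<gamma>\<close> fixes the nonzero homogeneous vector
    \<open>v0\<close> and so must be even. This makes its difference from the identity a homogeneous
    operator, as the definition of \<open>Mc\<close> demands.\<close>
  have "p = q"
  proof (rule ccontr)
    assume "p \<noteq> q"
    then have "v0 \<in> VG (\<not> p0)" using kop_VG[OF fY v0(2)] f(2) by auto
    then have "v0 \<in> VG False \<inter> VG True" using v0(2) by (cases p0) auto
    then show False using graded v0(1) by (auto simp: graded_space_def)
  qed
  then have "kop False (\<lambda>v. f (Y \<gamma> v) - v)" using kop_diff[OF _ kop_id] fY by simp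
  then have "f (Y \<gamma> w) - w = 0" if "w \<in> Mc" for w
    using Mc_kop_zero[OF that, of False "\<lambda>v. f (Y \<gamma> v) - v"] f(2) by simp
  with f that show ?thesis by auto
qed

section \<open>Simplicity and weights of P and M\<close>

text \<open>A nonzero submodule contains a nonzero weight component of one of its elements, hence
  some nonzero \<open>Y \<gamma> v0\<close>, from which \<open>v0\<close> is recovered.\<close>

lemma Pc_simple: "simple_graded sc Pc PG (K_ops m n x d)"
  unfolding simple_graded_def
proof (intro conjI allI impI)
  show "\<exists>v\<in>Pc. v \<noteq> 0" using Y_Pc[of "\<lambda>_. 0"] v0(1) by (auto simp: Y_zero)
next
  fix U assume U: "subspace U \<and> U \<subseteq> Pc \<and>
      (\<forall>v\<in>U. \<exists>v0\<in>U \<inter> PG False. \<exists>v1\<in>U \<inter> PG True. v = v0 + v1) \<and> (\<forall>f\<in>K_ops m n x d. f ` U \<subseteq> U)"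
  then have img: "\<forall>f\<in>K_ops m n x d. f ` U \<subseteq> U" by blast
  have st: "x a u \<in> U" "d a u \<in> U" if "a < m + n" "u \<in> U" for a u
    using img that by (auto simp: K_ops_def image_subset_iff)
  have sub: "subspace U" using U by blast
  have kst: "f u \<in> U" if "kop p f" "u \<in> U" for p f u
    using kop_stable[OF that(1) sub _ _ that(2)] st by blast
  show "U = {0} \<or> U = Pc"
  proof (cases "U = {0}")
    case False
    then obtain u where u: "u \<in> U" "u \<noteq> 0" using subspace_0[OF sub] by blast
    have "u \<in> Pc" using U u(1) by blast
    then obtain J c where J: "finite J" "J \<subseteq> exponents" "u = (\<Sum>\<gamma>\<in>J. sc (c \<gamma>) (Y \<gamma> v0))"
      by (rule Pc_expansion)
    have "\<not> (\<forall>\<gamma>\<in>J. sc (c \<gamma>) (Y \<gamma> v0) = 0)"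
    proof
      assume "\<forall>\<gamma>\<in>J. sc (c \<gamma>) (Y \<gamma> v0) = 0"
      then have "u = 0" unfolding J(3) by (rule sum.neutral)
      with u(2) show False by simp
    qed
    then obtain \<gamma> where \<gamma>: "\<gamma> \<in> J" "sc (c \<gamma>) (Y \<gamma> v0) \<noteq> 0" by blast
    have "Y \<gamma> (sc (c \<gamma>) v0) \<in> U"
      using exponents_components[OF J(1,2), of "\<lambda>\<gamma>. sc (c \<gamma>) v0" U \<gamma>] v0_weight st sub u(1) J(3) \<gamma>(1)
      by (simp add: lin_scale[OF lin_N] lin_scale[OF Y_lin] scale_left_commute)
    then have "sc (inverse (c \<gamma>)) (Y \<gamma> (sc (c \<gamma>) v0)) \<in> U" by (rule subspace_scale[OF sub])
    then have "Y \<gamma> v0 \<in> U" using \<gamma>(2) by (simp add: lin_scale[OF Y_lin])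
    moreover obtain p f where "kop p f" "f (Y \<gamma> v0) = v0" using Y_undo \<gamma>(2) by (metis scale_zero_right)
    ultimately have "v0 \<in> U" using kst by metis
    then have "Pc \<subseteq> U" using kst subspace_add[OF sub] by (auto simp: Pc_def)
    then show ?thesis using U by blast
  qed simp
qed

lemma Pc_weight: "is_weight sc Pc (m + n) (K_cartan x d)"
  unfolding is_weight_def
proof
  fix u assume "u \<in> Pc"
  then obtain J c where J: "u = (\<Sum>\<gamma>\<in>J. sc (c \<gamma>) (Y \<gamma> v0))" by (rule Pc_expansion)
  have "Y \<gamma> v0 \<in> wspace sc Pc (m + n) (K_cartan x d) (\<lambda>a. \<kappa> a + of_int (\<gamma> a))" for \<gamma>
    using Y_Pc Y_weight v0_weight by (simp add: wspace_def K_cartan_def)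
  then show "u \<in> span (\<Union>wt. wspace sc Pc (m + n) (K_cartan x d) wt)"
    unfolding J by (intro span_sum span_scale span_base) blast
qed

text \<open>A nonzero submodule \<open>U\<close> generates V, so \<open>w\<close> in
  \<open>Mc\<close> is a sum of words applied to elements of \<open>U\<close>. Only the zero
  exponent carries the weight of \<open>w\<close>, and its word is the identity, so \<open>w\<close>
  lies in \<open>U\<close>.\<close>

lemma Mc_simple: "simple_graded sc Mc MG (gl_ops m n E)"
  unfolding simple_graded_def
proof (intro conjI allI impI)
  show "\<exists>v\<in>Mc. v \<noteq> 0" using v0_Mc v0(1) by blast
next
  fix U assume U: "subspace U \<and> U \<subseteq> Mc \<and>
      (\<forall>v\<in>U. \<exists>v0\<in>U \<inter> MG False. \<exists>v1\<in>U \<inter> MG True. v = v0 + v1) \<and> (\<forall>f\<in>gl_ops m n E. f ` U \<subseteq> U)"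
  show "U = {0} \<or> U = Mc"
  proof (cases "U = {0}")
    case False
    have "gen U = UNIV"
    proof (rule gen_eq_UNIV)
      show "E a b w \<in> U" if "a < m + n" "b < m + n" "w \<in> U" for a b w
      proof -
        have "E a b \<in> gl_ops m n E" using that by (auto simp: gl_ops_def)
        then show ?thesis using U that(3) by blast
      qed
      show "\<exists>w0\<in>U \<inter> VG False. \<exists>w1\<in>U \<inter> VG True. w = w0 + w1" if "w \<in> U" for w
        using that U unfolding MG_def by blast
    qed (use U False in auto)
    have "w \<in> U" if w: "w \<in> Mc" for w
    proof -
      have "subspace U" using U by blast
      from gen_decomposition[OF this, of w] \<open>gen U = UNIV\<close> obtain J u where
        J: "finite J" "J \<subseteq> exponents" "\<And>\<gamma>. u \<gamma> \<in> U" "w = (\<Sum>\<gamma>\<in>J. Y \<gamma> (u \<gamma>))" by auto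
      \<comment> \<open>\<open>w\<close> is moved to the other side as a term with exponent 0, which
        \<open>J\<close> may lack.\<close>
      define J' where "J' = insert (\<lambda>_. 0) J"
      define u' where "u' \<gamma> = (if \<gamma> \<in> J then u \<gamma> else 0) - (if \<gamma> = (\<lambda>_. 0) then w else 0)" for \<gamma>
      have "(\<Sum>\<gamma>\<in>J'. Y \<gamma> (u' \<gamma>)) = (\<Sum>\<gamma>\<in>J'. if \<gamma> \<in> J then Y \<gamma> (u \<gamma>) else 0)
          - (\<Sum>\<gamma>\<in>J'. if \<gamma> = (\<lambda>_. 0) then w else 0)"
        unfolding sum_subtractf[symmetric] u'_def lin_diff[OF Y_lin]
        by (intro sum.cong) (auto simp: lin_zero[OF Y_lin] Y_zero)
      also have "(\<Sum>\<gamma>\<in>J'. if \<gamma> \<in> J then Y \<gamma> (u \<gamma>) else 0) = w"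
        unfolding J(4) J'_def using J(1) by (intro sum.mono_neutral_cong_right) auto
      also have "(\<Sum>\<gamma>\<in>J'. if \<gamma> = (\<lambda>_. 0) then w else 0) = w"
        using J(1) by (simp add: J'_def)
      finally have "(\<Sum>\<gamma>\<in>J'. Y \<gamma> (u' \<gamma>)) \<in> {0}" by simp
      moreover have "u' \<gamma> \<in> Mc" for \<gamma>
        using J(3) U w subspace_diff[OF Mc_subspace] subspace_0[OF Mc_subspace] subspace_neg[OF Mc_subspace]
        unfolding u'_def by (auto intro!: subspace_diff[OF Mc_subspace])
      moreover have "finite J'" "J' \<subseteq> exponents" using J by (auto simp: J'_def exponents_def)
      ultimately have "Y (\<lambda>_. 0) (u' (\<lambda>_. 0)) \<in> {0}"
        using exponents_components[of J' u' "{0}" "\<lambda>_. 0"] Mc_weight lin_zero[OF lin_N]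
        by (simp add: subspace_single_0 J'_def)
      then have "u' (\<lambda>_. 0) = 0" by (simp add: Y_zero)
      then have "w = (if (\<lambda>_. 0) \<in> J then u (\<lambda>_. 0) else 0)" by (simp add: u'_def)
      then show "w \<in> U" using J(3) subspace_0[OF \<open>subspace U\<close>] by (metis (full_types))
    qed
    then show ?thesis using U by blast
  qed simp
qed

text \<open>On \<open>Mc\<close> the operators \<open>N a\<close> are the scalars
  \<open>\<kappa> a\<close>, so weight vectors for \<open>N a + E a a\<close> are weight vectors for
  \<open>E a a\<close>, with weights shifted by \<open>\<kappa>\<close>.\<close>

lemma Mc_is_weight: "is_weight sc Mc (m + n) (\<lambda>a. E a a)"
proof -
  let ?h = "\<lambda>a v. N a v + E a a v"
  have lin: "lin (?h a)" if "a < m + n" for a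
    using lin_N[OF that] lin_E[OF that that] by (simp add: lin_on_def algebra_simps scale_right_distrib)
  have "is_weight sc Mc (m + n) ?h"
  proof (rule is_weight_stable_subspace[OF weight lin Mc_subspace])
    fix a u assume *: "a < m + n" "u \<in> Mc"
    show "?h a u \<in> Mc"
      unfolding Mc_weight[OF *(2,1)]
      by (intro subspace_add[OF Mc_subspace] subspace_scale[OF Mc_subspace] Mc_E *)
  qed
  moreover have "wspace sc Mc (m + n) ?h wt \<subseteq> (\<Union>wt. wspace sc Mc (m + n) (\<lambda>a. E a a) wt)" for wt
  proof
    fix v assume v: "v \<in> wspace sc Mc (m + n) ?h wt"
    have "E a a v = sc (wt a - \<kappa> a) v" if "a < m + n" for a
    proof -
      have "N a v + E a a v = sc (wt a) v" "N a v = sc (\<kappa> a) v"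
        using v that Mc_weight by (auto simp: wspace_def)
      then show ?thesis by (simp add: scale_left_diff_distrib algebra_simps)
    qed
    then have "v \<in> wspace sc Mc (m + n) (\<lambda>a. E a a) (\<lambda>a. wt a - \<kappa> a)"
      using v by (simp add: wspace_def)
    then show "v \<in> (\<Union>wt. wspace sc Mc (m + n) (\<lambda>a. E a a) wt)" by blast
  qed
  then have "(\<Union>wt. wspace sc Mc (m + n) ?h wt) \<subseteq> (\<Union>wt. wspace sc Mc (m + n) (\<lambda>a. E a a) wt)"
    by (rule UN_least)
  from span_mono[OF this] show ?thesis
    using \<open>is_weight sc Mc (m + n) ?h\<close> unfolding is_weight_def by (rule order_trans[rotated])
qed

section \<open>The pairing is a tensor product\<close>

lemma bt_lin_right: "u \<in> Pc \<Longrightarrow> lin_on sc Mc (bt u)"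
proof -
  assume "u \<in> Pc"
  then obtain f g where u: "kop False f" "kop True g" "u = f v0 + g v0" by (auto simp: Pc_def)
  show ?thesis
    unfolding lin_on_def u(3)
    using bt_eq[OF u(1,2)] subspace_add[OF Mc_subspace] subspace_scale[OF Mc_subspace]
      kop_lin[OF u(1)] kop_lin[OF u(2)]
    by (simp add: lin_simps scale_right_distrib algebra_simps)
qed

lemma bt_lin_left:
  assumes "w \<in> Mc"
  shows "lin_on sc Pc (\<lambda>u. bt u w)"
  unfolding lin_on_def
proof (intro conjI ballI allI)
  fix u u' assume "u \<in> Pc" "u' \<in> Pc"
  then obtain f g f' g' where u: "kop False f" "kop True g" "u = f v0 + g v0"
    "kop False f'" "kop True g'" "u' = f' v0 + g' v0" by (auto simp: Pc_def)
  have "u + u' = (\<lambda>v. f v + f' v) v0 + (\<lambda>v. g v + g' v) v0" using u by (simp add: algebra_simps)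
  then have "bt (u + u') w = (\<lambda>v. f v + f' v) w + (\<lambda>v. g v + g' v) w"
    using bt_eq[OF kop_add[OF u(1,4)] kop_add[OF u(2,5)] assms] by simp
  then show "bt (u + u') w = bt u w + bt u' w"
    using bt_eq[OF u(1,2) assms] bt_eq[OF u(4,5) assms] u(3,6) by (simp add: algebra_simps)
next
  fix c u assume "u \<in> Pc"
  then obtain f g where u: "kop False f" "kop True g" "u = f v0 + g v0" by (auto simp: Pc_def)
  have "sc c u = (\<lambda>v. sc c (f v)) v0 + (\<lambda>v. sc c (g v)) v0" using u by (simp add: scale_right_distrib)
  then have "bt (sc c u) w = (\<lambda>v. sc c (f v)) w + (\<lambda>v. sc c (g v)) w"
    using bt_eq[OF kop_scale[OF u(1)] kop_scale[OF u(2)] assms] by simp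
  then show "bt (sc c u) w = sc c (bt u w)"
    using bt_eq[OF u(1,2) assms] u(3) by (simp add: scale_right_distrib)
qed

lemma bt_Y: "w \<in> Mc \<Longrightarrow> bt (Y \<gamma> v0) w = Y \<gamma> w"
  using Y_kop[of \<gamma>] bt_kop by blast

lemma bt_expansion:
  assumes "w \<in> Mc" "finite J"
  shows "bt (\<Sum>\<gamma>\<in>J. sc (c \<gamma>) (Y \<gamma> v0)) w = (\<Sum>\<gamma>\<in>J. sc (c \<gamma>) (Y \<gamma> w))"
proof -
  note lin = bt_lin_left[OF assms(1), unfolded lin_on_def]
  have Yc: "sc c (Y \<gamma> v0) \<in> Pc" for c \<gamma> using subspace_scale[OF Pc_subspace Y_Pc] .
  have Pc: "(\<Sum>\<gamma>\<in>J. sc (c \<gamma>) (Y \<gamma> v0)) \<in> Pc" for J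
    by (intro subspace_sum[OF Pc_subspace] Yc)
  show ?thesis
    using assms(2)
  proof (induction J rule: finite_induct)
    case empty
    have "v0 \<in> Pc" using Y_Pc[of "\<lambda>_. 0"] by (simp only: Y_zero)
    then have "bt (sc 0 v0) w = sc 0 (bt v0 w)" using lin by blast
    then show ?case by simp
  next
    case (insert \<gamma> J)
    then show ?case using lin Pc Yc Y_Pc bt_Y[OF assms(1)] by simp
  qed
qed

text \<open>Expand each \<open>u\<close> in words applied to \<open>v0\<close> and collect the
  coefficient vectors \<open>w \<gamma>\<close> in \<open>Mc\<close>. Comparison of weights gives
  \<open>Y \<gamma> (w \<gamma>) = 0\<close>, and \<open>Y_undo\<close> then gives
  \<open>w \<gamma> = 0\<close> whenever \<open>Y \<gamma> v0\<close> is nonzero. Applying a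
  functional that does not vanish at \<open>g u\<close> yields a nontrivial relation between the
  elements of \<open>U\<close>.\<close>

lemma bt_injective:
  assumes "finite U" "U \<subseteq> Pc" "\<not> dependent U" "g ` U \<subseteq> Mc" "(\<Sum>u\<in>U. bt u (g u)) = 0" "u \<in> U"
  shows "g u = 0"
proof (rule ccontr)
  assume "g u \<noteq> 0"
  obtain \<phi> :: "'v \<Rightarrow> complex" where \<phi>: "\<And>u v. \<phi> (u + v) = \<phi> u + \<phi> v"
      "\<And>c v. \<phi> (sc c v) = c * \<phi> v" "\<phi> (g u) \<noteq> 0"
    using exists_linear_functional[OF \<open>g u \<noteq> 0\<close>] by blast
  have \<phi>0: "\<phi> 0 = 0" using \<phi>(2)[of 0 0] by simp
  have \<phi>sum: "\<phi> (\<Sum>i\<in>I. h i) = (\<Sum>i\<in>I. \<phi> (h i))" for I :: "'v set" and h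
    by (induction I rule: infinite_finite_induct) (simp_all add: \<phi>0 \<phi>(1))
  have "\<forall>u\<in>U. \<exists>J c. finite J \<and> J \<subseteq> exponents \<and> u = (\<Sum>\<gamma>\<in>J. sc (c \<gamma>) (Y \<gamma> v0))"
  proof
    fix u assume "u \<in> U"
    then have "u \<in> Pc" using assms(2) by blast
    then obtain J c where "finite J" "J \<subseteq> exponents" "u = (\<Sum>\<gamma>\<in>J. sc (c \<gamma>) (Y \<gamma> v0))"
      by (rule Pc_expansion)
    then show "\<exists>J c. finite J \<and> J \<subseteq> exponents \<and> u = (\<Sum>\<gamma>\<in>J. sc (c \<gamma>) (Y \<gamma> v0))" by blast
  qed
  then obtain Ju cu where Ju: "\<And>u. u \<in> U \<Longrightarrow> finite (Ju u) \<and> Ju u \<subseteq> exponents \<and>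
      u = (\<Sum>\<gamma>\<in>Ju u. sc (cu u \<gamma>) (Y \<gamma> v0))" by metis
  define J where "J = (\<Union>u\<in>U. Ju u)"
  \<comment> \<open>Coefficients are extended by 0 to an index set common to all of
    \<open>U\<close>.\<close>
  define c where "c u \<gamma> = (if \<gamma> \<in> Ju u then cu u \<gamma> else 0)" for u \<gamma>
  have J: "finite J" "J \<subseteq> exponents" using assms(1) Ju by (auto simp: J_def)
  have u: "u = (\<Sum>\<gamma>\<in>J. sc (c u \<gamma>) (Y \<gamma> v0))" if "u \<in> U" for u
  proof -
    have "(\<Sum>\<gamma>\<in>Ju u. sc (cu u \<gamma>) (Y \<gamma> v0)) = (\<Sum>\<gamma>\<in>J. sc (c u \<gamma>) (Y \<gamma> v0))"
      using J(1) that by (intro sum.mono_neutral_cong_left) (auto simp: J_def c_def)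
    then show ?thesis using Ju[OF that] by metis
  qed
  have gM: "g u \<in> Mc" if "u \<in> U" for u using that assms(4) by blast
  define w where "w \<gamma> = (\<Sum>u\<in>U. sc (c u \<gamma>) (g u))" for \<gamma>
  have wM: "w \<gamma> \<in> Mc" for \<gamma>
    unfolding w_def by (intro subspace_sum[OF Mc_subspace] subspace_scale[OF Mc_subspace] gM)
  have "(\<Sum>\<gamma>\<in>J. Y \<gamma> (w \<gamma>)) = (\<Sum>u\<in>U. \<Sum>\<gamma>\<in>J. sc (c u \<gamma>) (Y \<gamma> (g u)))"
    unfolding w_def by (subst sum.swap) (simp add: lin_sum[OF Y_lin] lin_scale[OF Y_lin])
  also have "\<dots> = (\<Sum>u\<in>U. bt u (g u))"
  proof (rule sum.cong)
    fix u assume "u \<in> U"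
    then show "(\<Sum>\<gamma>\<in>J. sc (c u \<gamma>) (Y \<gamma> (g u))) = bt u (g u)"
      using bt_expansion[OF gM[OF \<open>u \<in> U\<close>] J(1), of "c u"] u[OF \<open>u \<in> U\<close>] by simp
  qed simp
  finally have "(\<Sum>\<gamma>\<in>J. Y \<gamma> (w \<gamma>)) \<in> {0}" using assms(5) by simp
  then have Y0: "Y \<gamma> (w \<gamma>) = 0" if "\<gamma> \<in> J" for \<gamma>
    using exponents_components[OF J, of w "{0}" \<gamma>] that Mc_weight[OF wM] lin_zero[OF lin_N]
    by (simp add: subspace_single_0)
  \<comment> \<open>If \<open>Y \<gamma> v0 = 0\<close>, nothing is known about
    \<open>w \<gamma>\<close>, but then the product vanishes anyway.\<close>
  have zero: "sc (\<phi> (w \<gamma>)) (Y \<gamma> v0) = 0" if "\<gamma> \<in> J" for \<gamma>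
  proof (cases "Y \<gamma> v0 = 0")
    case False
    then obtain p f where f: "kop p f" "\<And>w. w \<in> Mc \<Longrightarrow> f (Y \<gamma> w) = w" using Y_undo by metis
    then have "w \<gamma> = 0" using Y0[OF that] wM lin_zero[OF kop_lin[OF f(1)]] by metis
    then show ?thesis by (simp add: \<phi>0)
  qed simp
  have "(\<Sum>u\<in>U. sc (\<phi> (g u)) u) = (\<Sum>u\<in>U. \<Sum>\<gamma>\<in>J. sc (\<phi> (g u) * c u \<gamma>) (Y \<gamma> v0))"
  proof (rule sum.cong)
    fix u assume "u \<in> U"
    then have "sc (\<phi> (g u)) u = sc (\<phi> (g u)) (\<Sum>\<gamma>\<in>J. sc (c u \<gamma>) (Y \<gamma> v0))" using u by simp
    then show "sc (\<phi> (g u)) u = (\<Sum>\<gamma>\<in>J. sc (\<phi> (g u) * c u \<gamma>) (Y \<gamma> v0))"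
      by (simp add: scale_sum_right)
  qed simp
  also have "\<dots> = (\<Sum>\<gamma>\<in>J. sc (\<phi> (w \<gamma>)) (Y \<gamma> v0))"
    by (subst sum.swap) (simp add: w_def \<phi>sum \<phi>(2) scale_sum_left[symmetric] mult.commute)
  also have "\<dots> = 0" by (intro sum.neutral ballI zero)
  finally have "\<phi> (g u) = 0"
    using independentD[OF assms(3) assms(1) order_refl, of "\<lambda>u. \<phi> (g u)" u] assms(6) by simp
  then show False using \<phi>(3) by simp
qed

text \<open>Spanning is \<open>gen_Mc\<close>: the vectors \<open>Y \<gamma> w\<close> that span V
  are values of the pairing at \<open>Y \<gamma> v0\<close> and \<open>w\<close>.\<close>

lemma bt_tensor: "is_tensor sc Pc Mc bt"
  unfolding is_tensor_def
proof (intro conjI ballI allI impI)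
  have "(\<Union>\<gamma>\<in>exponents. Y \<gamma> ` Mc) \<subseteq> (\<lambda>(u, v). bt u v) ` (Pc \<times> Mc)"
  proof clarify
    fix \<gamma> w assume "w \<in> Mc"
    then have "Y \<gamma> w = (\<lambda>(u, v). bt u v) (Y \<gamma> v0, w)" "(Y \<gamma> v0, w) \<in> Pc \<times> Mc"
      using bt_Y Y_Pc by auto
    then show "Y \<gamma> w \<in> (\<lambda>(u, v). bt u v) ` (Pc \<times> Mc)" by (rule image_eqI)
  qed
  from span_mono[OF this] show "span ((\<lambda>(u, v). bt u v) ` (Pc \<times> Mc)) = UNIV"
    using gen_Mc unfolding gen_def by auto
qed (use bt_lin_left bt_lin_right bt_injective in auto)

lemma bt_kop_left:
  assumes "kop q h" "u \<in> Pc" "w \<in> Mc"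
  shows "bt (h u) w = h (bt u w)"
proof -
  obtain f g where u: "kop False f" "kop True g" "u = f v0 + g v0" using assms(2) by (auto simp: Pc_def)
  have *: "bt (h (f v0)) w = h (f w)" "bt (h (g v0)) w = h (g w)"
    using bt_kop[OF kop_comp[OF assms(1) u(1)] assms(3)] bt_kop[OF kop_comp[OF assms(1) u(2)] assms(3)]
    by simp_all
  have "h (f v0) \<in> Pc" "h (g v0) \<in> Pc"
    using Pc_kop[OF assms(1)] PG_Pc PG_I[OF u(1)] PG_I[OF u(2)] by blast+
  then have "bt (h (f v0) + h (g v0)) w = h (f w) + h (g w)"
    using bt_lin_left[OF assms(3)] * by (simp add: lin_on_def)
  then show ?thesis
    using bt_eq[OF u(1,2) assms(3)] lin_add[OF kop_lin[OF assms(1)]] u(3) by simp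
qed

lemma bt_VG: "u \<in> PG p \<Longrightarrow> w \<in> MG q \<Longrightarrow> bt u w \<in> VG (p \<noteq> q)"
proof -
  assume *: "u \<in> PG p" "w \<in> MG q"
  then obtain f where f: "kop p f" "u = f v0" by (auto simp: PG_def)
  have "w \<in> Mc" "w \<in> VG q" using * by (auto simp: MG_def)
  moreover have "(p \<noteq> q) = (q \<noteq> p)" by auto
  ultimately show ?thesis using bt_kop[OF f(1)] kop_VG[OF f(1)] f(2) by (simp only:)
qed

text \<open>The sign comes from moving \<open>E a b\<close> past the operator that produces
  \<open>u\<close> from \<open>v0\<close>; it is the sign rule for operators on a tensor
  product.\<close>

lemma E_bt:
  assumes "u \<in> PG p" "w \<in> Mc" "a < m + n" "b < m + n"
  shows "E a b (bt u w) = sc (sgn2 (pE m a b) p) (bt u (E a b w))"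
proof -
  obtain f where f: "kop p f" "u = f v0" using assms(1) by (auto simp: PG_def)
  then show ?thesis
    using bt_kop[OF f(1)] assms(2) Mc_E[OF assms(2-4)] kop_E[OF f(1) assms(3,4)] by simp
qed

end

section \<open>\<open>AW\<close>-modules\<close>

text \<open>Together with \<open>var_odd\<close> this writes the variable with index
  \<open>b < m + n\<close>, even or odd, as a monomial, so that most identities below are stated
  once for both kinds.\<close>

definition var_exp :: "nat \<Rightarrow> nat \<Rightarrow> nat \<Rightarrow> nat" where
  "var_exp m b = (if b < m then (\<lambda>_. 0)(b := 1) else (\<lambda>_. 0))"

definition var_odd :: "nat \<Rightarrow> nat \<Rightarrow> nat set" where
  "var_odd m b = (if b < m then {} else {b - m})"

text \<open>The eigenvalue of \<open>x\<^sub>b\<partial>\<^sub>b\<close> on the monomial.\<close>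

definition var_degree :: "nat \<Rightarrow> nat \<Rightarrow> (nat \<Rightarrow> nat) \<Rightarrow> nat set \<Rightarrow> nat" where
  "var_degree m b \<alpha> I = (if b < m then \<alpha> b else if b - m \<in> I then 1 else 0)"

definition total_degree :: "nat \<Rightarrow> nat \<Rightarrow> (nat \<Rightarrow> nat) \<Rightarrow> nat set \<Rightarrow> nat" where
  "total_degree m n \<alpha> I = (\<Sum>b<m + n. var_degree m b \<alpha> I)"

text \<open>The sign with which the derivative in direction \<open>k\<close> enters the action on \<open>F(P, M)\<close>.\<close>

definition F_sign :: "nat \<Rightarrow> nat \<Rightarrow> nat set \<Rightarrow> complex" where
  "F_sign m k I = (if k < m then 1 else (- 1) ^ (card I + 1))"

lemma F_sign_var: "F_sign m k (var_odd m k) = 1"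
  by (simp add: F_sign_def var_odd_def)

lemma valid_mono_finite: "valid_mono m n \<alpha> I \<Longrightarrow> finite I"
  by (auto simp: valid_mono_def finite_subset)

lemma valid_mono_one [simp]: "valid_mono m n (\<lambda>_. 0) {}"
  by (simp add: valid_mono_def)

lemma valid_mono_var: "b < m + n \<Longrightarrow> valid_mono m n (var_exp m b) (var_odd m b)"
  by (auto simp: valid_mono_def var_exp_def var_odd_def)

lemma valid_mono_der: "valid_mono m n \<alpha> I \<Longrightarrow> valid_mono m n (der_exp m b \<alpha>) (der_odd m b I)"
  by (auto simp: valid_mono_def der_exp_def der_odd_def)

lemma inv_count_empty [simp]: "inv_count {} J = 0" "inv_count I {} = 0"
  by (simp_all add: inv_count_def)

lemma mul_coeff_empty [simp]: "mul_coeff {} J = 1" "mul_coeff I {} = 1"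
  by (simp_all add: mul_coeff_def)

lemma inv_count_single: "inv_count {j} J = card {l \<in> J. l < j}" "inv_count I {j} = card {l \<in> I. j < l}"
proof -
  have "{(i, l). i \<in> {j} \<and> l \<in> J \<and> l < i} = Pair j ` {l \<in> J. l < j}" by auto
  then show "inv_count {j} J = card {l \<in> J. l < j}"
    by (simp add: inv_count_def card_image inj_on_def)
  have "{(i, l). i \<in> I \<and> l \<in> {j} \<and> l < i} = (\<lambda>i. (i, j)) ` {l \<in> I. j < l}" by auto
  then show "inv_count I {j} = card {l \<in> I. j < l}"
    by (simp add: inv_count_def card_image inj_on_def)
qed

lemma card_split_at:
  assumes "finite I" "(j::nat) \<notin> I"
  shows "card I = card {l \<in> I. l < j} + card {l \<in> I. j < l}"
proof -
  have "l < j \<or> j < l" if "l \<in> I" for l using that assms(2) by (metis linorder_neqE_nat)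
  then have "I = {l \<in> I. l < j} \<union> {l \<in> I. j < l}" by blast
  moreover have "card ({l \<in> I. l < j} \<union> {l \<in> I. j < l}) = card {l \<in> I. l < j} + card {l \<in> I. j < l}"
    using assms(1) by (intro card_Un_disjoint) auto
  ultimately show ?thesis by simp
qed

text \<open>For an odd variable \<open>j\<close> outside \<open>I\<close>, one order has the larger
  elements of \<open>I\<close> as inversions and the other order the smaller ones; together they are
  all of \<open>I\<close>.\<close>

lemma mul_coeff_var_swap:
  assumes "finite I"
  shows "mul_coeff I (var_odd m b) = sgn2 (pA I) (m \<le> b) * mul_coeff (var_odd m b) I"
proof (cases "b < m \<or> b - m \<in> I")
  case True
  then show ?thesis by (auto simp: var_odd_def mul_coeff_def)
next
  case False
  let ?j = "b - m"
  have "(- 1) ^ card {l \<in> I. ?j < l} = (- 1) ^ card I * (- 1 :: complex) ^ card {l \<in> I. l < ?j}"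
    using card_split_at[OF assms, of ?j] False
    by (simp add: power_add mult.commute mult.left_commute power2_eq_square[symmetric] flip: power_mult_distrib)
  moreover have "(- 1 :: complex) ^ card I = sgn2 (pA I) (m \<le> b)"
    using False by (auto simp: sgn2_def pA_def)
  ultimately show ?thesis
    using False by (auto simp: var_odd_def mul_coeff_def inv_count_single)
qed

lemma pA_var: "pA (var_odd m b) = (m \<le> b)"
  by (auto simp: pA_def var_odd_def)

lemma pD_empty: "pD m {} a = (m \<le> a)"
  by (simp add: pD_def)

lemma pD_var: "pD m (var_odd m k) a = pE m k a"
  by (auto simp: pD_def pE_def var_odd_def)

lemma pD_xor: "pD m I a = (pA I \<noteq> (m \<le> a))"
  by (simp add: pD_def pA_def)

lemma der_coeff_one [simp]: "der_coeff m a (\<lambda>_. 0) {} = 0"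
  by (simp add: der_coeff_def)

lemma der_coeff_var: "der_coeff m a (var_exp m b) (var_odd m b) = (if a = b then 1 else 0)"
proof -
  have *: "{l. l = b - m \<and> l < b - m} = {}" by auto
  show ?thesis by (auto simp: der_coeff_def var_exp_def var_odd_def *)
qed

lemma der_var: "der_exp m b (var_exp m b) = (\<lambda>_. 0)" "der_odd m b (var_odd m b) = {}"
  by (auto simp: der_exp_def var_exp_def der_odd_def var_odd_def)

lemma var_degree_var: "var_degree m a (var_exp m b) (var_odd m b) = (if a = b then 1 else 0)"
  by (auto simp: var_degree_def var_exp_def var_odd_def)

text \<open>Euler's rule in one variable: the sign from taking an odd variable out of the product is
  undone by putting it back.\<close>

lemma var_mul_der_coeff:
  "der_coeff m b \<alpha> I * mul_coeff (var_odd m b) (der_odd m b I) = of_nat (var_degree m b \<alpha> I)"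
proof (cases "b < m")
  case True
  then show ?thesis by (simp add: der_coeff_def var_odd_def var_degree_def)
next
  case False
  have "{l \<in> I - {b - m}. l < b - m} = {l \<in> I. l < b - m}" by auto
  then show ?thesis
    using False
    by (auto simp: der_coeff_def var_odd_def var_degree_def der_odd_def mul_coeff_def inv_count_single
        simp flip: power_mult_distrib)
qed

lemma var_mul_der:
  assumes "var_degree m b \<alpha> I \<noteq> 0"
  shows "(\<lambda>k. var_exp m b k + der_exp m b \<alpha> k) = \<alpha>" "var_odd m b \<union> der_odd m b I = I"
  using assms
  by (auto simp: var_degree_def var_exp_def var_odd_def der_exp_def der_odd_def fun_eq_iff split: if_splits)

lemma der_exp_commute: "der_exp m k (der_exp m b \<alpha>) = der_exp m b (der_exp m k \<alpha>)"
  by (auto simp: der_exp_def)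

lemma der_odd_commute: "der_odd m k (der_odd m b I) = der_odd m b (der_odd m k I)"
  by (auto simp: der_odd_def)

text \<open>Two different odd derivatives anticommute, and removing one more odd variable flips
  \<open>F_sign\<close> in an odd direction; the two signs cancel. This is what the sign in the
  definition of \<open>F(P, M)\<close> achieves, and it permits the interchange of derivatives in
  \<open>L_expansion\<close>.\<close>

lemma der_coeff_swap:
  assumes "finite I"
  shows "F_sign m k (der_odd m b I) * (der_coeff m k (der_exp m b \<alpha>) (der_odd m b I) * der_coeff m b \<alpha> I)
    = F_sign m k I * (der_coeff m b (der_exp m k \<alpha>) (der_odd m k I) * der_coeff m k \<alpha> I)"
proof (cases "m \<le> b \<and> m \<le> k \<and> b \<noteq> k \<and> b - m \<in> I \<and> k - m \<in> I")
  case False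
  then show ?thesis
    by (auto simp: F_sign_def der_coeff_def der_exp_def der_odd_def)
next
  case True
  define i j where "i = b - m" and "j = k - m"
  have ij: "i \<noteq> j" "i \<in> I" "j \<in> I" using True by (auto simp: i_def j_def)
  have c: "(- 1) ^ (card (I - {i}) + 1) = - ((- 1 :: complex) ^ (card I + 1))"
    using card_Suc_Diff1[OF assms ij(2)] by (metis add.commute minus_minus mult_minus1 plus_1_eq_Suc power_Suc)
  have less: "(- 1) ^ card {l \<in> I - {p}. l < q} * (- 1) ^ card {l \<in> I. l < p}
      = - ((- 1 :: complex) ^ card {l \<in> I - {q}. l < p} * (- 1) ^ card {l \<in> I. l < q})"
    if "p < q" "p \<in> I" for p q
  proof -
    have "{l \<in> I - {q}. l < p} = {l \<in> I. l < p}" using that by auto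
    moreover have eq: "{l \<in> I. l < q} - {p} = {l \<in> I - {p}. l < q}" by auto
    have "card {l \<in> I. l < q} = Suc (card ({l \<in> I. l < q} - {p}))"
      using that assms by (intro card_Suc_Diff1[symmetric]) auto
    then have "card {l \<in> I. l < q} = Suc (card {l \<in> I - {p}. l < q})" by (simp only: eq)
    ultimately show ?thesis by simp
  qed
  have "(- 1) ^ card {l \<in> I - {i}. l < j} * (- 1) ^ card {l \<in> I. l < i}
      = - ((- 1 :: complex) ^ card {l \<in> I - {j}. l < i} * (- 1) ^ card {l \<in> I. l < j})"
  proof (cases "i < j")
    case True
    then show ?thesis using less ij by blast
  next
    case False
    then have "j < i" using ij(1) by simp
    from less[OF this ij(3)] show ?thesis by simp
  qed
  then show ?thesis
    using True ij c unfolding F_sign_def der_coeff_def der_exp_def der_odd_def i_def[symmetric] j_def[symmetric]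
    by simp
qed

lemma der_coeff_nonzero: "der_coeff m b \<alpha> I \<noteq> 0 \<longleftrightarrow> var_degree m b \<alpha> I \<noteq> 0"
  by (auto simp: der_coeff_def var_degree_def)

lemma total_degree_der:
  assumes "b < m + n" "der_coeff m b \<alpha> I \<noteq> 0"
  shows "total_degree m n \<alpha> I = Suc (total_degree m n (der_exp m b \<alpha>) (der_odd m b I))"
proof -
  have nz: "var_degree m b \<alpha> I \<noteq> 0" using assms(2) der_coeff_nonzero by blast
  have "var_degree m c \<alpha> I = var_degree m c (der_exp m b \<alpha>) (der_odd m b I) + (if c = b then 1 else 0)" for c
  proof (cases "c < m \<or> b < m")
    case True
    then show ?thesis using nz by (auto simp: var_degree_def der_exp_def der_odd_def)
  next
    case False
    then have "c - m = b - m \<longleftrightarrow> c = b" by auto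
    then show ?thesis using nz False by (simp add: var_degree_def der_exp_def der_odd_def split: if_splits)
  qed
  then have "total_degree m n \<alpha> I
      = (\<Sum>c<m + n. var_degree m c (der_exp m b \<alpha>) (der_odd m b I) + (if c = b then 1 else 0))"
    by (simp add: total_degree_def)
  then show ?thesis using assms(1) by (simp add: total_degree_def sum.distrib)
qed

lemma total_degree_eq_0:
  assumes "valid_mono m n \<alpha> I" "total_degree m n \<alpha> I = 0"
  shows "\<alpha> = (\<lambda>_. 0)" "I = {}"
proof -
  have z: "var_degree m b \<alpha> I = 0" if "b < m + n" for b
    using assms(2) that by (simp add: total_degree_def)
  have "\<alpha> b = 0" for b
    using z[of b] assms(1) by (cases "b < m") (auto simp: valid_mono_def var_degree_def)
  then show "\<alpha> = (\<lambda>_. 0)" by auto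
  have "j \<notin> I" for j
  proof
    assume "j \<in> I"
    then have "j < n" using assms(1) by (auto simp: valid_mono_def)
    then show False using z[of "m + j"] \<open>j \<in> I\<close> by (auto simp: var_degree_def)
  qed
  then show "I = {}" by blast
qed

lemma total_degree_eq_1:
  assumes "valid_mono m n \<alpha> I" "total_degree m n \<alpha> I = 1"
  obtains k where "k < m + n" "\<alpha> = var_exp m k" "I = var_odd m k"
proof -
  have "\<exists>k<m + n. var_degree m k \<alpha> I \<noteq> 0"
    using assms(2) unfolding total_degree_def by (metis lessThan_iff sum.neutral zero_neq_one)
  then obtain k where k: "k < m + n" "var_degree m k \<alpha> I \<noteq> 0" by blast
  then have "total_degree m n (der_exp m k \<alpha>) (der_odd m k I) = 0"
    using total_degree_der[of k m n \<alpha> I] assms(2) der_coeff_nonzero by auto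
  then have "der_exp m k \<alpha> = (\<lambda>_. 0)" "der_odd m k I = {}"
    using total_degree_eq_0[OF valid_mono_der[OF assms(1)]] by blast+
  then show ?thesis using var_mul_der[OF k(2)] that[OF k(1)] by simp
qed

section \<open>The Weyl action on an AW-module and its Euler operator\<close>

locale aw_module = cspace sc for sc :: "complex \<Rightarrow> 'v::ab_group_add \<Rightarrow> 'v" +
  fixes m n :: nat and VG :: "bool \<Rightarrow> 'v set"
    and rA :: "(nat \<Rightarrow> nat) \<Rightarrow> nat set \<Rightarrow> 'v \<Rightarrow> 'v" and rW :: "(nat \<Rightarrow> nat) \<Rightarrow> nat set \<Rightarrow> nat \<Rightarrow> 'v \<Rightarrow> 'v"
  assumes AW: "AW_module m n sc VG rA rW"
begin

definition X :: "nat \<Rightarrow> 'v \<Rightarrow> 'v" where "X a = rA (var_exp m a) (var_odd m a)"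

definition D :: "nat \<Rightarrow> 'v \<Rightarrow> 'v" where "D a = rW (\<lambda>_. 0) {} a"

abbreviation H :: "nat \<Rightarrow> 'v \<Rightarrow> 'v" where "H \<equiv> AW_cartan m rW"

lemma AW_graded: "graded_space sc UNIV VG"
  and rA_hom: "valid_mono m n \<alpha> I \<Longrightarrow> hom_op sc UNIV VG (pA I) (rA \<alpha> I)"
  and rW_hom: "valid_mono m n \<alpha> I \<Longrightarrow> a < m + n \<Longrightarrow> hom_op sc UNIV VG (pD m I a) (rW \<alpha> I a)"
  and rA_one: "rA (\<lambda>_. 0) {} v = v"
  and rA_rA: "valid_mono m n \<alpha> I \<Longrightarrow> valid_mono m n \<beta> J \<Longrightarrow>
    rA \<alpha> I (rA \<beta> J v) = sc (mul_coeff I J) (rA (\<lambda>k. \<alpha> k + \<beta> k) (I \<union> J) v)"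
  using AW unfolding AW_module_def by simp_all

lemma rW_rA:
  assumes "valid_mono m n \<alpha> I" "a < m + n" "valid_mono m n \<beta> J"
  shows "rW \<alpha> I a (rA \<beta> J v) = sc (sgn2 (pD m I a) (pA J)) (rA \<beta> J (rW \<alpha> I a v))
      + sc (app_coeff m I a \<beta> J) (rA (app_exp m \<alpha> a \<beta>) (app_odd m I a J) v)"
proof -
  have "rW \<alpha> I a (rA \<beta> J v) - sc (sgn2 (pD m I a) (pA J)) (rA \<beta> J (rW \<alpha> I a v))
      = sc (app_coeff m I a \<beta> J) (rA (app_exp m \<alpha> a \<beta>) (app_odd m I a J) v)"
    using AW assms unfolding AW_module_def by blast
  then show ?thesis by (simp add: diff_eq_eq add.commute)
qed

lemma rW_rW:
  assumes "valid_mono m n \<alpha> I" "a < m + n" "valid_mono m n \<beta> J" "b < m + n"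
  shows "rW \<alpha> I a (rW \<beta> J b v) = sc (sgn2 (pD m I a) (pD m J b)) (rW \<beta> J b (rW \<alpha> I a v))
      + (sc (app_coeff m I a \<beta> J) (rW (app_exp m \<alpha> a \<beta>) (app_odd m I a J) b v)
      - sc (sgn2 (pD m I a) (pD m J b) * app_coeff m J b \<alpha> I)
          (rW (app_exp m \<beta> b \<alpha>) (app_odd m J b I) a v))" (is "?l = ?s + ?r")
proof -
  have "?l - ?s = ?r"
    using AW assms unfolding AW_module_def by blast
  then show ?thesis by (metis diff_add_cancel add.commute)
qed

lemma lin_rA: "valid_mono m n \<alpha> I \<Longrightarrow> lin (rA \<alpha> I)"
  and lin_rW: "valid_mono m n \<alpha> I \<Longrightarrow> a < m + n \<Longrightarrow> lin (rW \<alpha> I a)"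
  using rA_hom rW_hom by (auto simp: hom_op_def)

lemma lin_X: "a < m + n \<Longrightarrow> lin (X a)" and lin_D: "a < m + n \<Longrightarrow> lin (D a)"
  unfolding X_def D_def by (intro lin_rA lin_rW valid_mono_var valid_mono_one, assumption)+

lemma H_def: "H b = rW (var_exp m b) (var_odd m b) b"
  by (simp add: AW_cartan_def var_exp_def var_odd_def)

lemma lin_H: "b < m + n \<Longrightarrow> lin (H b)"
  unfolding H_def by (intro lin_rW valid_mono_var)

lemma D_rA:
  assumes "valid_mono m n \<alpha> I" "b < m + n"
  shows "D b (rA \<alpha> I v) = sc (sgn2 (m \<le> b) (pA I)) (rA \<alpha> I (D b v))
    + sc (der_coeff m b \<alpha> I) (rA (der_exp m b \<alpha>) (der_odd m b I) v)"
  using rW_rA[of "\<lambda>_. 0" "{}" b \<alpha> I v] assms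
  by (simp add: D_def pD_empty app_coeff_def app_exp_def app_odd_def)

lemma D_rW:
  assumes "valid_mono m n \<alpha> I" "a < m + n" "b < m + n"
  shows "D b (rW \<alpha> I a v) = sc (sgn2 (m \<le> b) (pD m I a)) (rW \<alpha> I a (D b v))
    + sc (der_coeff m b \<alpha> I) (rW (der_exp m b \<alpha>) (der_odd m b I) a v)"
  using rW_rW[of "\<lambda>_. 0" "{}" b \<alpha> I a v] assms
  by (simp add: D_def pD_empty app_coeff_def app_exp_def app_odd_def)

lemma rW_X:
  assumes "valid_mono m n \<alpha> I" "a < m + n" "b < m + n"
  shows "rW \<alpha> I a (X b v) = sc (sgn2 (pD m I a) (m \<le> b)) (X b (rW \<alpha> I a v))
    + (if a = b then rA \<alpha> I v else 0)"
  using rW_rA[OF assms(1,2) valid_mono_var[OF assms(3)], of v]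
  by (simp add: X_def pA_var app_coeff_def der_coeff_var app_exp_def app_odd_def der_var)

lemma rA_X:
  assumes "valid_mono m n \<alpha> I" "b < m + n"
  shows "rA \<alpha> I (X b v) = sc (sgn2 (pA I) (m \<le> b)) (X b (rA \<alpha> I v))"
  using rA_rA[OF assms(1) valid_mono_var[OF assms(2)], of v]
    rA_rA[OF valid_mono_var[OF assms(2)] assms(1), of v]
    mul_coeff_var_swap[OF valid_mono_finite[OF assms(1)], of m b]
  by (simp add: X_def Un_commute add.commute)

lemma X_rA_der:
  assumes "valid_mono m n \<alpha> I" "b < m + n"
  shows "sc (der_coeff m b \<alpha> I) (X b (rA (der_exp m b \<alpha>) (der_odd m b I) v))
    = sc (of_nat (var_degree m b \<alpha> I)) (rA \<alpha> I v)"
proof -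
  have "sc (der_coeff m b \<alpha> I) (X b (rA (der_exp m b \<alpha>) (der_odd m b I) v))
    = sc (of_nat (var_degree m b \<alpha> I))
       (rA (\<lambda>k. var_exp m b k + der_exp m b \<alpha> k) (var_odd m b \<union> der_odd m b I) v)"
    unfolding X_def rA_rA[OF valid_mono_var[OF assms(2)] valid_mono_der[OF assms(1)]]
    by (simp add: var_mul_der_coeff)
  then show ?thesis using var_mul_der[of m b \<alpha> I] by (cases "var_degree m b \<alpha> I = 0") simp_all
qed

sublocale weyl: weyl_module sc m n VG X D
proof
  fix a b v assume *: "a < m + n" "b < m + n"
  show "X a (X b v) = sc (sgn2 (m \<le> a) (m \<le> b)) (X b (X a v))"
    using rA_X[OF valid_mono_var[OF *(1)] *(2)] by (simp add: X_def[of a] pA_var)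
  show "D a (D b v) = sc (sgn2 (m \<le> a) (m \<le> b)) (D b (D a v))"
    using D_rW[of "\<lambda>_. 0" "{}" b a v] * by (simp add: D_def[of b] pD_empty)
  show "D a (X b v) = sc (sgn2 (m \<le> a) (m \<le> b)) (X b (D a v)) + (if a = b then v else 0)"
    using rW_X[of "\<lambda>_. 0" "{}" a b v] * by (simp add: D_def pD_empty rA_one)
next
  fix a assume "a < m + n"
  then show "hom_op sc UNIV VG (m \<le> a) (X a)" "hom_op sc UNIV VG (m \<le> a) (D a)"
    using rA_hom[OF valid_mono_var] rW_hom[of "\<lambda>_. 0" "{}" a] by (auto simp: X_def D_def pA_var pD_empty)
qed (rule AW_graded)

abbreviation N :: "nat \<Rightarrow> 'v \<Rightarrow> 'v" where "N a v \<equiv> X a (D a v)"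

lemma N_rA:
  assumes "valid_mono m n \<alpha> I" "b < m + n"
  shows "N b (rA \<alpha> I v) = rA \<alpha> I (N b v) + sc (of_nat (var_degree m b \<alpha> I)) (rA \<alpha> I v)"
proof -
  have "N b (rA \<alpha> I v) = sc (sgn2 (pA I) (m \<le> b)) (X b (rA \<alpha> I (D b v)))
      + sc (der_coeff m b \<alpha> I) (X b (rA (der_exp m b \<alpha>) (der_odd m b I) v))"
    using D_rA[OF assms] by (simp add: lin_simps[OF lin_X[OF assms(2)]] sgn2_commute)
  then show ?thesis using rA_X[OF assms] X_rA_der[OF assms] by simp
qed

lemma H_rA:
  assumes "valid_mono m n \<alpha> I" "b < m + n"
  shows "H b (rA \<alpha> I v) = rA \<alpha> I (H b v) + sc (of_nat (var_degree m b \<alpha> I)) (rA \<alpha> I v)"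
proof -
  have "app_coeff m (var_odd m b) b \<alpha> I = of_nat (var_degree m b \<alpha> I)"
    by (simp add: app_coeff_def var_mul_der_coeff)
  then have "H b (rA \<alpha> I v) = rA \<alpha> I (H b v) + sc (of_nat (var_degree m b \<alpha> I))
      (rA (\<lambda>k. var_exp m b k + der_exp m b \<alpha> k) (var_odd m b \<union> der_odd m b I) v)"
    unfolding H_def using rW_rA[OF valid_mono_var[OF assms(2)] assms(2,1), of v]
    by (simp add: pD_var pE_def app_exp_def app_odd_def)
  then show ?thesis using var_mul_der[of m b \<alpha> I] by (cases "var_degree m b \<alpha> I = 0") simp_all
qed

lemma H_rW:
  assumes "valid_mono m n \<alpha> I" "a < m + n" "b < m + n"
  shows "H b (rW \<alpha> I a v) = rW \<alpha> I a (H b v)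
    + sc (of_nat (var_degree m b \<alpha> I) - (if a = b then 1 else 0)) (rW \<alpha> I a v)"
proof -
  have "app_coeff m (var_odd m b) b \<alpha> I = of_nat (var_degree m b \<alpha> I)"
    by (simp add: app_coeff_def var_mul_der_coeff)
  then have "H b (rW \<alpha> I a v) = rW \<alpha> I a (H b v) + (sc (of_nat (var_degree m b \<alpha> I))
      (rW (\<lambda>k. var_exp m b k + der_exp m b \<alpha> k) (var_odd m b \<union> der_odd m b I) a v)
      - (if a = b then rW \<alpha> I a v else 0))"
    unfolding H_def using rW_rW[OF valid_mono_var[OF assms(3)] assms(3,1,2), of v]
    by (simp add: pD_var pE_def app_exp_def app_odd_def app_coeff_def[of m I] der_coeff_var der_var)
  then show ?thesis
    using var_mul_der[of m b \<alpha> I]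
    by (cases "var_degree m b \<alpha> I = 0") (auto simp: scale_left_diff_distrib)
qed

lemma H_D: "a < m + n \<Longrightarrow> b < m + n \<Longrightarrow> H b (D a v) = D a (H b v) - (if a = b then D a v else 0)"
  using H_rW[of "\<lambda>_. 0" "{}" a b v] by (simp add: D_def var_degree_def)

lemma H_X: "a < m + n \<Longrightarrow> b < m + n \<Longrightarrow> H b (X a v) = X a (H b v) + (if a = b then X a v else 0)"
  using H_rA[OF valid_mono_var, of a b v] by (auto simp: X_def var_degree_var)

lemma H_N: "a < m + n \<Longrightarrow> b < m + n \<Longrightarrow> H b (N a v) = N a (H b v)"
  by (simp add: H_X H_D lin_simps[OF lin_X])

text \<open>\<open>L \<alpha> I a\<close> measures the failure of \<open>t\<^sup>\<alpha> \<xi>\<^sub>I \<partial>\<^sub>a\<close> to act as multiplication after derivation.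
  Unlike \<open>rW\<close>, it supercommutes with all variables.\<close>

definition L :: "(nat \<Rightarrow> nat) \<Rightarrow> nat set \<Rightarrow> nat \<Rightarrow> 'v \<Rightarrow> 'v" where
  "L \<alpha> I a v = rW \<alpha> I a v - rA \<alpha> I (D a v)"

lemma L_hom:
  assumes "valid_mono m n \<alpha> I" "a < m + n"
  shows "hom_op sc UNIV VG (pD m I a) (L \<alpha> I a)"
proof -
  have "lin (L \<alpha> I a)"
    using lin_rW[OF assms] lin_comp[OF lin_rA[OF assms(1)] lin_D[OF assms(2)]]
    by (simp add: lin_on_def L_def algebra_simps scale_right_diff_distrib)
  moreover have "L \<alpha> I a v \<in> VG (q \<noteq> pD m I a)" if "v \<in> VG q" for v q
  proof -
    have "rA \<alpha> I (D a v) \<in> VG ((q \<noteq> (m \<le> a)) \<noteq> pA I)"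
      using rA_hom[OF assms(1)] weyl.d_VG[OF assms(2) that] by (auto simp: hom_op_def image_subset_iff)
    moreover have "((q \<noteq> (m \<le> a)) \<noteq> pA I) = (q \<noteq> pD m I a)" by (auto simp: pD_xor)
    moreover have "rW \<alpha> I a v \<in> VG (q \<noteq> pD m I a)"
      using rW_hom[OF assms] that by (auto simp: hom_op_def image_subset_iff)
    ultimately show ?thesis unfolding L_def using subspace_diff[OF weyl.VG_subspace] by (simp only:)
  qed
  ultimately show ?thesis by (auto simp: hom_op_def)
qed

lemma lin_L: "valid_mono m n \<alpha> I \<Longrightarrow> a < m + n \<Longrightarrow> lin (L \<alpha> I a)"
  using L_hom by (auto simp: hom_op_def)

lemma L_one: "L (\<lambda>_. 0) {} a v = 0"
  by (simp add: L_def D_def rA_one)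

text \<open>For \<open>a = b\<close> both \<open>rW\<close> and multiplication after derivation
  contribute \<open>rA \<alpha> I v\<close>, and these terms cancel in the difference.\<close>

lemma L_X:
  assumes "valid_mono m n \<alpha> I" "a < m + n" "b < m + n"
  shows "L \<alpha> I a (X b v) = sc (sgn2 (pD m I a) (m \<le> b)) (X b (L \<alpha> I a v))"
proof -
  have "rA \<alpha> I (D a (X b v)) = sc (sgn2 (m \<le> a) (m \<le> b) * sgn2 (pA I) (m \<le> b)) (X b (rA \<alpha> I (D a v)))
      + (if a = b then rA \<alpha> I v else 0)"
    using assms by (simp add: weyl.d_x lin_simps[OF lin_rA[OF assms(1)]] rA_X)
  moreover have "sgn2 (m \<le> a) (m \<le> b) * sgn2 (pA I) (m \<le> b) = sgn2 (pD m I a) (m \<le> b)"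
    by (auto simp: sgn2_def pD_xor)
  ultimately show ?thesis
    unfolding L_def rW_X[OF assms] lin_diff[OF lin_X[OF assms(3)]]
    by (simp add: scale_right_diff_distrib)
qed

text \<open>Besides the sign rule, the coefficient is differentiated. For a variable this extra term
  is a multiple of \<open>L\<close> of the constant 1, that is 0, which is why the
  \<open>E k a\<close> supercommute with \<open>D b\<close>.\<close>

lemma D_L:
  assumes "valid_mono m n \<alpha> I" "a < m + n" "b < m + n"
  shows "D b (L \<alpha> I a v) = sc (sgn2 (m \<le> b) (pD m I a)) (L \<alpha> I a (D b v))
    + sc (der_coeff m b \<alpha> I) (L (der_exp m b \<alpha>) (der_odd m b I) a v)"
proof -
  have "D b (rA \<alpha> I (D a v)) = sc (sgn2 (m \<le> b) (pA I) * sgn2 (m \<le> b) (m \<le> a)) (rA \<alpha> I (D a (D b v)))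
      + sc (der_coeff m b \<alpha> I) (rA (der_exp m b \<alpha>) (der_odd m b I) (D a v))"
    using D_rA[OF assms(1,3)] weyl.d_d[OF assms(3,2)] by (simp add: lin_simps[OF lin_rA[OF assms(1)]])
  moreover have "sgn2 (m \<le> b) (pA I) * sgn2 (m \<le> b) (m \<le> a) = sgn2 (m \<le> b) (pD m I a)"
    by (auto simp: sgn2_def pD_xor)
  ultimately show ?thesis
    unfolding L_def lin_diff[OF lin_D[OF assms(3)]] D_rW[OF assms]
    by (simp add: scale_right_diff_distrib)
qed

lemma N_L:
  assumes "valid_mono m n \<alpha> I" "a < m + n" "b < m + n"
  shows "N b (L \<alpha> I a v) = L \<alpha> I a (N b v)
    + sc (der_coeff m b \<alpha> I) (X b (L (der_exp m b \<alpha>) (der_odd m b I) a v))"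
  using assms by (simp add: D_L L_X lin_simps[OF lin_X] sgn2_commute)

lemma H_L:
  assumes "valid_mono m n \<alpha> I" "a < m + n" "b < m + n"
  shows "H b (L \<alpha> I a v) = L \<alpha> I a (H b v)
    + sc (of_nat (var_degree m b \<alpha> I) - (if a = b then 1 else 0)) (L \<alpha> I a v)"
proof -
  have "H b (rA \<alpha> I (D a v)) = rA \<alpha> I (D a (H b v))
      + sc (of_nat (var_degree m b \<alpha> I) - (if a = b then 1 else 0)) (rA \<alpha> I (D a v))"
    using assms by (simp add: H_rA H_D lin_simps[OF lin_rA[OF assms(1)]] scale_left_diff_distrib algebra_simps)
  then show ?thesis
    unfolding L_def lin_diff[OF lin_H[OF assms(3)]] H_rW[OF assms]
    by (simp add: scale_right_diff_distrib algebra_simps)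
qed

text \<open>\<open>Eu\<close> is the part of the Euler field that commutes with the Weyl algebra; it grades the
  action of the remaining operators by their degree minus one.\<close>

definition Eu :: "'v \<Rightarrow> 'v" where
  "Eu v = (\<Sum>b<m + n. H b v - N b v)"

lemma lin_Eu: "lin Eu"
proof (rule linI)
  have H: "lin (\<lambda>v. H b v - N b v)" if "b < m + n" for b
    using lin_H[OF that] weyl.lin_N[OF that] by (simp add: lin_on_def algebra_simps scale_right_diff_distrib)
  show "Eu (u + v) = Eu u + Eu v" for u v
    unfolding Eu_def sum.distrib[symmetric] by (intro sum.cong refl) (use lin_add[OF H] in auto)
  show "Eu (sc c v) = sc c (Eu v)" for c v
    unfolding Eu_def scale_sum_right by (intro sum.cong refl) (use lin_scale[OF H] in auto)
qed

lemma Eu_VG: "v \<in> VG q \<Longrightarrow> Eu v \<in> VG q"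
  unfolding Eu_def
proof (intro subspace_sum[OF weyl.VG_subspace] subspace_diff[OF weyl.VG_subspace])
  fix b assume "v \<in> VG q" "b \<in> {..<m + n}"
  then show "H b v \<in> VG q" "N b v \<in> VG q"
    using rW_hom[OF valid_mono_var, of b b] weyl.N_VG[of b v q]
    by (auto simp: H_def pD_var pE_def hom_op_def image_subset_iff)
qed

text \<open>In each direction \<open>H b\<close> and \<open>N b\<close> have the same commutator
  with \<open>rA\<close>, namely the degree of the monomial in that variable.\<close>

lemma Eu_rA: "valid_mono m n \<alpha> I \<Longrightarrow> Eu (rA \<alpha> I v) = rA \<alpha> I (Eu v)"
  by (simp add: Eu_def H_rA N_rA lin_sum[OF lin_rA] lin_diff[OF lin_rA])

lemma Eu_X: "a < m + n \<Longrightarrow> Eu (X a v) = X a (Eu v)"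
  by (simp add: X_def Eu_rA valid_mono_var)

lemma Eu_D: "a < m + n \<Longrightarrow> Eu (D a v) = D a (Eu v)"
  by (auto simp: Eu_def H_D weyl.N_d lin_sum[OF lin_D] lin_diff[OF lin_D] intro!: sum.cong)

text \<open>The factor \<open>deg - 1\<close> is the Euler weight of
  \<open>t^\<alpha> \<xi>_I \<partial>_a\<close> and comes from the \<open>H b\<close>; the sum
  comes from the \<open>N b\<close>, whose commutators with \<open>L\<close> differentiate the
  coefficient.\<close>

lemma Eu_L:
  assumes "valid_mono m n \<alpha> I" "a < m + n"
  shows "Eu (L \<alpha> I a v) = L \<alpha> I a (Eu v) + sc (of_nat (total_degree m n \<alpha> I) - 1) (L \<alpha> I a v)
    - (\<Sum>b<m + n. sc (der_coeff m b \<alpha> I) (X b (L (der_exp m b \<alpha>) (der_odd m b I) a v)))"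
proof -
  have "Eu (L \<alpha> I a v) = (\<Sum>b<m + n. L \<alpha> I a (H b v - N b v)
      + sc (of_nat (var_degree m b \<alpha> I) - (if a = b then 1 else 0)) (L \<alpha> I a v)
      - sc (der_coeff m b \<alpha> I) (X b (L (der_exp m b \<alpha>) (der_odd m b I) a v)))"
    unfolding Eu_def using assms
    by (intro sum.cong) (simp_all add: H_L N_L lin_diff[OF lin_L[OF assms]] algebra_simps)
  also have "\<dots> = L \<alpha> I a (Eu v)
      + sc (\<Sum>b<m + n. of_nat (var_degree m b \<alpha> I) - (if a = b then 1 else 0)) (L \<alpha> I a v)
      - (\<Sum>b<m + n. sc (der_coeff m b \<alpha> I) (X b (L (der_exp m b \<alpha>) (der_odd m b I) a v)))"
    unfolding scale_sum_left Eu_def lin_sum[OF lin_L[OF assms]] by (simp only: sum_subtractf sum.distrib)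
  also have "(\<Sum>b<m + n. of_nat (var_degree m b \<alpha> I) - (if a = b then 1 else 0)) =
      (of_nat (total_degree m n \<alpha> I) - 1 :: complex)"
    using assms(2) by (simp add: sum_subtractf total_degree_def)
  finally show ?thesis .
qed

section \<open>Eigenspaces of the Euler operator\<close>

definition eig :: "complex \<Rightarrow> 'v set" where
  "eig e = {w. Eu w = sc e w}"

definition eig_sum :: "complex \<Rightarrow> nat set \<Rightarrow> 'v set" where
  "eig_sum e K = span (\<Union>k\<in>K. eig (e + of_nat k))"

lemma eig_subspace: "subspace (eig e)"
  using lin_Eu by (auto simp: eig_def subspace_def lin_simps scale_right_distrib scale_left_commute)

lemma eig_sum_subspace: "subspace (eig_sum e K)"
  by (simp add: eig_sum_def)

lemma eig_subset_eig_sum: "k \<in> K \<Longrightarrow> w \<in> eig (e + of_nat k) \<Longrightarrow> w \<in> eig_sum e K"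
  unfolding eig_sum_def by (intro span_base) blast

lemma eig_sum_stable:
  assumes "lin f" "\<And>v. Eu (f v) = f (Eu v)" "v \<in> eig_sum e K"
  shows "f v \<in> eig_sum e K"
  using assms(3) unfolding eig_sum_def
proof (rule lin_span_image[OF assms(1)])
  fix b assume "b \<in> (\<Union>k\<in>K. eig (e + of_nat k))"
  then have "f b \<in> (\<Union>k\<in>K. eig (e + of_nat k))"
    by (auto simp: eig_def assms(2) lin_scale[OF assms(1)])
  then show "f b \<in> span (\<Union>k\<in>K. eig (e + of_nat k))" by (rule span_base)
qed simp

text \<open>On eigenvalues \<open>e + j\<close> with \<open>j < k\<close> the operator
  \<open>Eu - (e + k)\<close> is inverted by division by \<open>j - k\<close>. Subtracting the
  preimage found in this way leaves an eigenvector for \<open>e + k\<close>.\<close>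

lemma eig_sum_solve:
  assumes "Eu u - sc (e + of_nat k) u \<in> eig_sum e {..<k}"
  shows "u \<in> eig_sum e {..<Suc k}"
proof -
  from span_UN_subspaces[OF eig_subspace assms[unfolded eig_sum_def]] obtain J r where
    J: "finite J" "J \<subseteq> {..<k}" "\<And>j. r j \<in> eig (e + of_nat j)"
      "Eu u - sc (e + of_nat k) u = (\<Sum>j\<in>J. r j)" by blast
  define s where "s = (\<Sum>j\<in>J. sc (inverse (of_nat j - of_nat k)) (r j))"
  have "Eu s - sc (e + of_nat k) s = (\<Sum>j\<in>J. r j)"
    unfolding s_def lin_sum[OF lin_Eu] scale_sum_right sum_subtractf[symmetric]
  proof (rule sum.cong)
    fix j assume "j \<in> J"
    then have "j \<noteq> k" using J(2) by auto
    then have nz: "of_nat j - of_nat k \<noteq> (0 :: complex)" by simp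
    have "Eu (sc (inverse (of_nat j - of_nat k)) (r j))
        - sc (e + of_nat k) (sc (inverse (of_nat j - of_nat k)) (r j))
      = sc ((of_nat j - of_nat k) * inverse (of_nat j - of_nat k)) (r j)"
      using J(3)[of j] unfolding eig_def
      by (simp add: lin_scale[OF lin_Eu] scale_left_diff_distrib[symmetric]) (simp add: algebra_simps)
    then show "Eu (sc (inverse (of_nat j - of_nat k)) (r j))
        - sc (e + of_nat k) (sc (inverse (of_nat j - of_nat k)) (r j)) = r j"
      using nz by simp
  qed simp
  then have "Eu (u - s) = sc (e + of_nat k) (u - s)"
    using J(4) by (simp add: lin_diff[OF lin_Eu] scale_right_diff_distrib algebra_simps)
  then have "u - s \<in> eig_sum e {..<Suc k}"
    using eig_subset_eig_sum[of k "{..<Suc k}"] by (simp add: eig_def)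
  moreover have "r j \<in> eig_sum e {..<Suc k}" if "j \<in> J" for j
    using eig_subset_eig_sum[of j "{..<Suc k}" "r j" e] J that by auto
  then have "s \<in> eig_sum e {..<Suc k}"
    unfolding s_def by (intro subspace_sum subspace_scale eig_sum_subspace)
  ultimately have "(u - s) + s \<in> eig_sum e {..<Suc k}" using subspace_add[OF eig_sum_subspace] by blast
  then show ?thesis by simp
qed

text \<open>In degree 0 the operator vanishes. In degree \<open>k + 1\<close> the recursion
  \<open>Eu_L\<close> sends \<open>L \<alpha> I a w\<close> under \<open>Eu - (e + k)\<close> into
  the eigenspaces with indices below \<open>k\<close>, and \<open>eig_sum_solve\<close> adds the
  index \<open>k\<close>.\<close>

lemma L_eig:
  assumes "a < m + n" "w \<in> eig e" "valid_mono m n \<alpha> I"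
  shows "L \<alpha> I a w \<in> eig_sum e {..<total_degree m n \<alpha> I}"
  using assms(3)
proof (induction "total_degree m n \<alpha> I" arbitrary: \<alpha> I)
  case 0
  then have "\<alpha> = (\<lambda>_. 0)" "I = {}" using total_degree_eq_0 by metis+
  then show ?case using L_one subspace_0[OF eig_sum_subspace] by simp
next
  case (Suc k)
  have "sc (der_coeff m b \<alpha> I) (X b (L (der_exp m b \<alpha>) (der_odd m b I) a w)) \<in> eig_sum e {..<k}"
    if b: "b < m + n" for b
  proof (cases "der_coeff m b \<alpha> I = 0")
    case True
    then show ?thesis using subspace_0[OF eig_sum_subspace] by simp
  next
    case False
    then have "k = total_degree m n (der_exp m b \<alpha>) (der_odd m b I)"
      using total_degree_der[OF b] Suc.hyps(2) by (metis nat.inject)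
    from Suc.hyps(1)[OF this valid_mono_der[OF Suc.prems]]
    have "L (der_exp m b \<alpha>) (der_odd m b I) a w \<in> eig_sum e {..<k}" using \<open>k = _\<close> by simp
    then show ?thesis
      by (intro subspace_scale eig_sum_subspace eig_sum_stable[OF lin_X[OF b] Eu_X[OF b]])
  qed
  then have "(\<Sum>b<m + n. sc (der_coeff m b \<alpha> I) (X b (L (der_exp m b \<alpha>) (der_odd m b I) a w))) \<in> eig_sum e {..<k}"
    by (intro subspace_sum eig_sum_subspace) simp
  then have "- (\<Sum>b<m + n. sc (der_coeff m b \<alpha> I) (X b (L (der_exp m b \<alpha>) (der_odd m b I) a w))) \<in> eig_sum e {..<k}"
    by (rule subspace_neg[OF eig_sum_subspace])
  moreover have "Eu (L \<alpha> I a w) - sc (e + of_nat k) (L \<alpha> I a w) =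
      - (\<Sum>b<m + n. sc (der_coeff m b \<alpha> I) (X b (L (der_exp m b \<alpha>) (der_odd m b I) a w)))"
    using Eu_L[OF Suc.prems assms(1), of w] assms(2) Suc.hyps(2)[symmetric]
    by (simp add: eig_def lin_scale[OF lin_L[OF Suc.prems assms(1)]] scale_left_distrib)
  ultimately show ?case using eig_sum_solve Suc.hyps(2) by metis
qed

text \<open>Multiplication after derivation keeps eigenvalues and \<open>L\<close> keeps or raises
  them, so the index set has to be closed upwards.\<close>

lemma eig_sum_rW:
  assumes "valid_mono m n \<alpha> I" "a < m + n" "v \<in> eig_sum e {i..}"
  shows "rW \<alpha> I a v \<in> eig_sum e {i..}"
proof -
  have "L \<alpha> I a v \<in> eig_sum e {i..}"
    using assms(3) unfolding eig_sum_def[of e "{i..}"]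
  proof (rule lin_span_image[OF lin_L[OF assms(1,2)]])
    fix b assume "b \<in> (\<Union>k\<in>{i..}. eig (e + of_nat k))"
    then obtain k where k: "i \<le> k" "b \<in> eig (e + of_nat k)" by auto
    have "eig_sum (e + of_nat k) {..<total_degree m n \<alpha> I} \<subseteq> span (\<Union>k\<in>{i..}. eig (e + of_nat k))"
      unfolding eig_sum_def
    proof (intro span_mono subsetI)
      fix u assume "u \<in> (\<Union>j\<in>{..<total_degree m n \<alpha> I}. eig (e + of_nat k + of_nat j))"
      then obtain j where "u \<in> eig (e + of_nat (k + j))" by (auto simp: add.assoc)
      then show "u \<in> (\<Union>k\<in>{i..}. eig (e + of_nat k))" using k(1) by (intro UN_I[of "k + j"]) auto
    qed
    then show "L \<alpha> I a b \<in> span (\<Union>k\<in>{i..}. eig (e + of_nat k))"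
      using L_eig[OF assms(2) k(2) assms(1)] by blast
  qed simp
  moreover have "rA \<alpha> I (D a v) \<in> eig_sum e {i..}"
    using eig_sum_stable[OF lin_rA Eu_rA] eig_sum_stable[OF lin_D Eu_D] assms by blast
  ultimately have "L \<alpha> I a v + rA \<alpha> I (D a v) \<in> eig_sum e {i..}"
    using subspace_add[OF eig_sum_subspace] by blast
  then show ?thesis by (simp add: L_def)
qed

lemma eig_sum_graded:
  assumes "v \<in> eig_sum e K"
  shows "\<exists>v0\<in>eig_sum e K \<inter> VG False. \<exists>v1\<in>eig_sum e K \<inter> VG True. v = v0 + v1"
  using assms unfolding eig_sum_def
proof (induction rule: span_induct)
  let ?S = "\<lambda>p. span (\<Union>k\<in>K. eig (e + of_nat k)) \<inter> VG p"
  have eq: "{v. \<exists>v0\<in>?S False. \<exists>v1\<in>?S True. v = v0 + v1} = {u + u' | u u'. u \<in> ?S False \<and> u' \<in> ?S True}"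
    by blast
  show "subspace {v. \<exists>v0\<in>?S False. \<exists>v1\<in>?S True. v = v0 + v1}"
    unfolding eq by (intro subspace_sums subspace_inter weyl.VG_subspace) simp_all
next
  fix u assume "u \<in> (\<Union>k\<in>K. eig (e + of_nat k))"
  then obtain k where k: "k \<in> K" "u \<in> eig (e + of_nat k)" by blast
  obtain u0 u1 where u: "u0 \<in> VG False" "u1 \<in> VG True" "u = u0 + u1"
    using homogeneous_decomposition[OF AW_graded] by blast
  let ?z = "e + of_nat k"
  have *: "Eu u0 - sc ?z u0 \<in> VG False" "Eu u1 - sc ?z u1 \<in> VG (\<not> False)"
    using u by (auto intro: subspace_diff[OF weyl.VG_subspace Eu_VG subspace_scale[OF weyl.VG_subspace]])
  have "(Eu u0 - sc ?z u0) + (Eu u1 - sc ?z u1) = 0"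
    using k(2) unfolding eig_def u(3) by (simp add: lin_add[OF lin_Eu] scale_right_distrib algebra_simps)
  then have "u0 \<in> eig ?z" "u1 \<in> eig ?z"
    using homogeneous_sum_eq_0[OF AW_graded *] by (auto simp: eig_def)
  then have "u0 \<in> eig_sum e K" "u1 \<in> eig_sum e K" using eig_subset_eig_sum k(1) by blast+
  with u show "\<exists>v0\<in>span (\<Union>k\<in>K. eig (e + of_nat k)) \<inter> VG False.
      \<exists>v1\<in>span (\<Union>k\<in>K. eig (e + of_nat k)) \<inter> VG True. u = v0 + v1"
    unfolding eig_sum_def[symmetric] by blast
qed

text \<open>If \<open>e + i\<close> were an eigenvalue for some \<open>i \<ge> 1\<close>, the
  eigenspaces from \<open>e + i\<close> upwards would span a nonzero submodule, hence everything
  including \<open>v\<close>, against the independence of eigenspaces. So among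
  \<open>e, e + 1, \<dots>\<close> only \<open>e\<close> occurs, and its eigenspace is a nonzero
  submodule.\<close>

lemma Eu_scalar:
  assumes "simple_graded sc UNIV VG (AW_ops m n rA rW)" "v \<noteq> 0" "v \<in> eig e"
  shows "Eu w = sc e w"
proof -
  have UNIV: "eig_sum e {i..} = UNIV" if nonzero: "eig (e + of_nat i) \<noteq> {0}" for i
  proof -
    have "eig_sum e {i..} = {0} \<or> eig_sum e {i..} = UNIV"
    proof (rule simple_gradedD[OF assms(1) eig_sum_subspace subset_UNIV])
      show "f ` eig_sum e {i..} \<subseteq> eig_sum e {i..}" if "f \<in> AW_ops m n rA rW" for f
      proof
        fix y assume "y \<in> f ` eig_sum e {i..}"
        then obtain u where u: "u \<in> eig_sum e {i..}" "y = f u" by blast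
        from \<open>f \<in> AW_ops m n rA rW\<close> consider
          \<alpha> I where "f = rA \<alpha> I" "valid_mono m n \<alpha> I"
          | \<alpha> I a where "f = rW \<alpha> I a" "valid_mono m n \<alpha> I" "a < m + n"
          unfolding AW_ops_def by blast
        then show "y \<in> eig_sum e {i..}"
        proof cases
          case 1
          show ?thesis unfolding u(2) 1(1) by (rule eig_sum_stable[OF lin_rA[OF 1(2)] Eu_rA[OF 1(2)] u(1)])
        next
          case 2
          show ?thesis unfolding u(2) 2(1) by (rule eig_sum_rW[OF 2(2,3) u(1)])
        qed
      qed
    qed (rule eig_sum_graded)
    moreover obtain u where "u \<in> eig (e + of_nat i)" "u \<noteq> 0"
      using nonzero subspace_0[OF eig_subspace[of "e + of_nat i"]] by blast
    then have "u \<in> eig_sum e {i..}" "u \<noteq> 0" using eig_subset_eig_sum[of i "{i..}"] by auto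
    ultimately show ?thesis by blast
  qed
  have zero: "eig (e + of_nat i) = {0}" if "1 \<le> i" for i
  proof (rule ccontr)
    assume "eig (e + of_nat i) \<noteq> {0}"
    then have "v \<in> eig_sum e {i..}" using UNIV by blast
    from span_UN_subspaces[OF eig_subspace this[unfolded eig_sum_def]] obtain J r where
      J: "finite J" "J \<subseteq> {i..}" "\<And>j. r j \<in> eig (e + of_nat j)" "v = (\<Sum>j\<in>J. r j)" by blast
    \<comment> \<open>The eigenvector \<open>v\<close> is moved to the other side under the index 0,
      which is free because all of \<open>J\<close> is at least \<open>i\<close>.\<close>
    define u where "u j = (if j = 0 then - v else r j)" for j
    have "0 \<notin> J" using J(2) that by auto
    then have "(\<Sum>j\<in>J. u j) = v" unfolding J(4) u_def by (intro sum.cong) auto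
    then have "(\<Sum>j\<in>insert 0 J. u j) \<in> {0}"
      using J(1) \<open>0 \<notin> J\<close> by (simp add: u_def)
    moreover have "Eu (u j) = sc (e + of_nat j) (u j)" for j
      using J(3)[of j] assms(3) by (auto simp: u_def eig_def lin_minus[OF lin_Eu])
    ultimately have "u 0 \<in> {0}"
      using weight_components_mem[of "{0}" "Suc 0" "\<lambda>_. Eu" "insert 0 J" u "\<lambda>j _. e + of_nat j" 0] J(1)
        lin_zero[OF lin_Eu] lin_Eu by (auto simp: subspace_single_0)
    then show False using assms(2) by (simp add: u_def)
  qed
  have "eig e \<noteq> {0}" using assms(2,3) by auto
  then have "w \<in> eig_sum e {0..}" using UNIV[of 0] by simp
  moreover have "eig (e + of_nat k) \<subseteq> eig e" for k
  proof (cases k)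
    case (Suc i)
    then have "eig (e + of_nat k) = {0}" using zero[of k] by simp
    then show ?thesis using subspace_0[OF eig_subspace[of e]] by simp
  qed simp
  then have "span (\<Union>k\<in>{0..}. eig (e + of_nat k)) \<subseteq> eig e"
    by (intro span_minimal[OF _ eig_subspace] UN_least)
  ultimately have "w \<in> eig e" unfolding eig_sum_def by (rule subsetD[rotated])
  then show ?thesis by (simp add: eig_def)
qed

definition E :: "nat \<Rightarrow> nat \<Rightarrow> 'v \<Rightarrow> 'v" where
  "E k a = L (var_exp m k) (var_odd m k) a"

text \<open>When \<open>Eu\<close> is a scalar, its commutator with \<open>L \<alpha> I a\<close> vanishes, and this
  expresses \<open>L \<alpha> I a\<close> through terms of lower degree as soon as the degree exceeds one.\<close>

lemma L_expansion:
  assumes scalar: "\<And>w. Eu w = sc e w" and a: "a < m + n" and "valid_mono m n \<alpha> I"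
  shows "L \<alpha> I a v = (\<Sum>k<m + n. sc (F_sign m k I * der_coeff m k \<alpha> I)
    (rA (der_exp m k \<alpha>) (der_odd m k I) (E k a v)))"
  using assms(3)
proof (induction "total_degree m n \<alpha> I" arbitrary: \<alpha> I rule: less_induct)
  case less
  note val = less.prems
  consider "total_degree m n \<alpha> I = 0" | "total_degree m n \<alpha> I = 1" | "2 \<le> total_degree m n \<alpha> I" by linarith
  then show ?case
  proof cases
    case 1
    then have "\<alpha> = (\<lambda>_. 0)" "I = {}" using total_degree_eq_0[OF val] by blast+
    then show ?thesis by (simp add: L_one)
  next
    case 2
    then obtain j where j: "j < m + n" "\<alpha> = var_exp m j" "I = var_odd m j" by (rule total_degree_eq_1[OF val])
    have "(\<Sum>k<m + n. sc (F_sign m k I * der_coeff m k \<alpha> I) (rA (der_exp m k \<alpha>) (der_odd m k I) (E k a v)))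
      = (\<Sum>k<m + n. if k = j then E j a v else 0)"
      unfolding j(2,3) by (intro sum.cong) (auto simp: der_coeff_var der_var rA_one F_sign_var)
    then show ?thesis using j by (simp add: E_def)
  next
    case 3
    define T where "T = total_degree m n \<alpha> I"
    let ?R = "\<lambda>k. rA (der_exp m k \<alpha>) (der_odd m k I) (E k a v)"
    \<comment> \<open>After insertion of the induction hypothesis for the derivative in direction
      \<open>b\<close>, the derivatives in directions \<open>b\<close> and \<open>k\<close> are
      interchanged. Then \<open>X b\<close> restores what the derivative in direction
      \<open>b\<close> removed, leaving a degree as the factor.\<close>
    have trm: "sc (der_coeff m b \<alpha> I) (X b (L (der_exp m b \<alpha>) (der_odd m b I) a v))
      = (\<Sum>k<m + n. sc (F_sign m k I * der_coeff m k \<alpha> I)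
          (sc (of_nat (var_degree m b (der_exp m k \<alpha>) (der_odd m k I))) (?R k)))"
      if b: "b < m + n" for b
    proof -
      let ?\<alpha> = "der_exp m b \<alpha>" and ?I = "der_odd m b I"
      have "sc (der_coeff m b \<alpha> I) (X b (L ?\<alpha> ?I a v)) = (\<Sum>k<m + n.
          sc (F_sign m k ?I * (der_coeff m k ?\<alpha> ?I * der_coeff m b \<alpha> I))
            (X b (rA (der_exp m k ?\<alpha>) (der_odd m k ?I) (E k a v))))"
      proof (cases "der_coeff m b \<alpha> I = 0")
        case False
        then have "total_degree m n ?\<alpha> ?I < total_degree m n \<alpha> I" using total_degree_der[OF b] by simp
        from less.hyps[OF this valid_mono_der[OF val]] show ?thesis
          by (simp add: lin_sum[OF lin_X[OF b]] lin_scale[OF lin_X[OF b]] scale_sum_right mult_ac)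
      qed simp
      also have "\<dots> = (\<Sum>k<m + n. sc (F_sign m k I * der_coeff m k \<alpha> I)
          (sc (der_coeff m b (der_exp m k \<alpha>) (der_odd m k I))
            (X b (rA (der_exp m b (der_exp m k \<alpha>)) (der_odd m b (der_odd m k I)) (E k a v)))))"
        unfolding der_coeff_swap[OF valid_mono_finite[OF val]] der_exp_commute[of m _ b] der_odd_commute[of m _ b]
        by (simp add: mult_ac)
      also have "\<dots> = (\<Sum>k<m + n. sc (F_sign m k I * der_coeff m k \<alpha> I)
          (sc (of_nat (var_degree m b (der_exp m k \<alpha>) (der_odd m k I))) (?R k)))"
        by (simp only: X_rA_der[OF valid_mono_der[OF val] b])
      finally show ?thesis .
    qed
    have "sc (of_nat T - 1) (L \<alpha> I a v)
        = (\<Sum>b<m + n. sc (der_coeff m b \<alpha> I) (X b (L (der_exp m b \<alpha>) (der_odd m b I) a v)))"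
      using Eu_L[OF val a, of v] by (simp add: scalar lin_scale[OF lin_L[OF val a]] T_def)
    also have "\<dots> = (\<Sum>k<m + n. \<Sum>b<m + n. sc (F_sign m k I * der_coeff m k \<alpha> I)
          (sc (of_nat (var_degree m b (der_exp m k \<alpha>) (der_odd m k I))) (?R k)))"
      by (subst sum.swap) (simp add: trm)
    \<comment> \<open>If the derivative in direction \<open>k\<close> is nonzero, its degrees add up
      to \<open>T - 1\<close>. The same factor stands on the left and can be cancelled because
      \<open>T\<close> is at least 2.\<close>
    also have "\<dots> = (\<Sum>k<m + n. sc (of_nat T - 1) (sc (F_sign m k I * der_coeff m k \<alpha> I) (?R k)))"
    proof (rule sum.cong)
      fix k assume k: "k \<in> {..<m + n}"
      have "(\<Sum>b<m + n. sc (F_sign m k I * der_coeff m k \<alpha> I)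
          (sc (of_nat (var_degree m b (der_exp m k \<alpha>) (der_odd m k I))) (?R k)))
        = sc (F_sign m k I * der_coeff m k \<alpha> I)
            (sc (of_nat (total_degree m n (der_exp m k \<alpha>) (der_odd m k I))) (?R k))"
        by (simp add: total_degree_def scale_sum_left scale_sum_right sum_distrib_left)
      also have "\<dots> = sc (of_nat T - 1) (sc (F_sign m k I * der_coeff m k \<alpha> I) (?R k))"
        using total_degree_der[of k m n \<alpha> I] k
        by (cases "der_coeff m k \<alpha> I = 0") (simp_all add: T_def mult_ac)
      finally show "(\<Sum>b<m + n. sc (F_sign m k I * der_coeff m k \<alpha> I)
          (sc (of_nat (var_degree m b (der_exp m k \<alpha>) (der_odd m k I))) (?R k)))
        = sc (of_nat T - 1) (sc (F_sign m k I * der_coeff m k \<alpha> I) (?R k))" .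
    qed simp
    also have "\<dots> = sc (of_nat T - 1) (\<Sum>k<m + n. sc (F_sign m k I * der_coeff m k \<alpha> I) (?R k))"
      by (simp add: scale_sum_right)
    finally have eq: "sc (of_nat T - 1) (L \<alpha> I a v) = \<dots>" .
    have "of_nat T - 1 \<noteq> (0 :: complex)" using 3 by (simp add: T_def)
    from scale_left_imp_eq[OF this eq] show ?thesis .
  qed
qed

text \<open>The odd variables are multiplied in increasing order: each one put in front is smaller
  than those already there, so there are no inversions and all coefficients are 1.\<close>

lemma rA_eq_monoP:
  assumes "valid_mono m n \<alpha> I"
  shows "rA \<alpha> I v = monoP m X \<alpha> I v"
proof -
  have val: "valid_mono m n \<beta> J" if "\<And>k. m \<le> k \<Longrightarrow> \<beta> k = 0" "J \<subseteq> {..<n}" for \<beta> J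
    using that by (auto simp: valid_mono_def)
  have odd: "foldr (\<lambda>i f. X (m + i) \<circ> f) is id v = rA (\<lambda>_. 0) (set is) v"
    if "sorted is" "distinct is" "set is \<subseteq> {..<n}" for "is"
    using that
  proof (induction "is")
    case Nil
    then show ?case by (simp add: rA_one)
  next
    case (Cons i js)
    have "{l \<in> set js. l < i} = {}" using Cons.prems(1) by auto
    then have "inv_count {i} (set js) = 0" by (simp only: inv_count_single card.empty)
    then have "mul_coeff {i} (set js) = 1" using Cons.prems(2) by (simp add: mul_coeff_def)
    moreover have "X (m + i) (rA (\<lambda>_. 0) (set js) v) = sc (mul_coeff {i} (set js)) (rA (\<lambda>_. 0) (insert i (set js)) v)"
      using rA_rA[OF valid_mono_var[of "m + i" m n] val[of "\<lambda>_. 0" "set js"]] Cons.prems(3)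
      by (simp add: X_def var_exp_def var_odd_def)
    ultimately show ?case using Cons by simp
  qed
  have pow: "(X k ^^ i) (rA \<beta> I v) = rA (\<beta>(k := \<beta> k + i)) I v"
    if "k < m" "\<And>k. m \<le> k \<Longrightarrow> \<beta> k = 0" for k i \<beta>
  proof (induction i)
    case (Suc i)
    have "X k (rA (\<beta>(k := \<beta> k + i)) I v)
        = rA (\<lambda>l. var_exp m k l + (\<beta>(k := \<beta> k + i)) l) I v"
      using rA_rA[OF valid_mono_var[of k m n] val[of "\<beta>(k := \<beta> k + i)" I]] that assms
      by (simp add: X_def var_odd_def valid_mono_def)
    also have "(\<lambda>l. var_exp m k l + (\<beta>(k := \<beta> k + i)) l) = \<beta>(k := \<beta> k + Suc i)"
      using that(1) by (auto simp: var_exp_def)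
    finally show ?case using Suc by simp
  qed simp
  have even: "foldr (\<lambda>k f. (X k ^^ \<alpha> k) \<circ> f) ks g v = rA (\<lambda>k. if k \<in> set ks then \<alpha> k else 0) I v"
    if "distinct ks" "set ks \<subseteq> {..<m}" "g v = rA (\<lambda>_. 0) I v" for ks g
    using that
  proof (induction ks)
    case (Cons k ks)
    let ?\<beta> = "\<lambda>l. if l \<in> set ks then \<alpha> l else 0"
    have "(X k ^^ \<alpha> k) (rA ?\<beta> I v) = rA (?\<beta>(k := ?\<beta> k + \<alpha> k)) I v"
      using Cons.prems by (intro pow) auto
    moreover have "?\<beta>(k := ?\<beta> k + \<alpha> k) = (\<lambda>l. if l \<in> set (k # ks) then \<alpha> l else 0)"
      using Cons.prems by auto
    ultimately show ?case using Cons by simp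
  qed simp
  have "finite I" "I \<subseteq> {..<n}" using assms valid_mono_finite by (auto simp: valid_mono_def)
  then have "foldr (\<lambda>i f. X (m + i) \<circ> f) (sorted_list_of_set I) id v = rA (\<lambda>_. 0) I v"
    using odd[of "sorted_list_of_set I"] by simp
  then have "monoP m X \<alpha> I v = rA (\<lambda>k. if k \<in> set [0..<m] then \<alpha> k else 0) I v"
    unfolding monoP_def by (intro even) auto
  also have "(\<lambda>k. if k \<in> set [0..<m] then \<alpha> k else 0) = \<alpha>"
    using assms by (auto simp: valid_mono_def)
  finally show ?thesis by simp
qed

lemma rA_kop: "valid_mono m n \<alpha> I \<Longrightarrow> \<exists>p. weyl.kop p (rA \<alpha> I)"
proof -
  assume "valid_mono m n \<alpha> I"
  moreover from this have "rA \<alpha> I = monoP m X \<alpha> I" using rA_eq_monoP by (intro ext)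
  ultimately show ?thesis using weyl.monoP_kop by simp
qed

text \<open>The \<open>N a\<close> commute with all \<open>H b\<close>, so they preserve the
  finite-dimensional weight space, and they commute with each other.\<close>

lemma weyl_eigenvector_exists:
  assumes "wspace sc UNIV (m + n) H wt \<noteq> {0}" "fin_dim sc (wspace sc UNIV (m + n) H wt)"
  obtains v z where "v \<noteq> 0" "\<And>a. a < m + n \<Longrightarrow> H a v = sc (wt a) v" "\<And>a. a < m + n \<Longrightarrow> N a v = sc (z a) v"
proof -
  let ?S = "wspace sc UNIV (m + n) H wt"
  have "\<exists>v\<in>?S. v \<noteq> 0 \<and> (\<forall>a<m + n. \<exists>z. N a v = sc z v)"
  proof (rule common_eigenvector_exists[OF weyl.lin_N _ assms(2,1)])
    show "subspace ?S"
      using lin_H unfolding wspace_def subspace_def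
      by (auto simp: lin_simps scale_right_distrib scale_left_commute)
  next
    fix a assume a: "a < m + n"
    show "N a ` ?S \<subseteq> ?S"
      using a by (auto simp: wspace_def H_N lin_scale[OF weyl.lin_N])
  next
    fix a b v assume "a < m + n" "b < m + n"
    then show "N a (N b v) = N b (N a v)"
      using weyl.N_x[of a b "D b v"] weyl.N_d[of a b v] by (simp add: lin_diff[OF lin_X] lin_zero[OF lin_X] split: if_splits)
  qed
  then obtain v where v: "v \<in> ?S" "v \<noteq> 0" "\<forall>a<m + n. \<exists>z. N a v = sc z v" by blast
  then obtain z where "\<And>a. a < m + n \<Longrightarrow> N a v = sc (z a) v" by metis
  with v that show ?thesis by (auto simp: wspace_def)
qed

end

section \<open>The action of gl(m,n) once the Euler operator is a scalar\<close>

locale simple_aw_module = aw_module sc m n VG rA rW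
  for sc :: "complex \<Rightarrow> 'v::ab_group_add \<Rightarrow> 'v" and m n VG rA rW +
  fixes e :: complex
  assumes simple: "simple_graded sc UNIV VG (AW_ops m n rA rW)"
    and weight: "is_weight sc UNIV (m + n) (AW_cartan m rW)"
    and scalar: "Eu w = sc e w"
begin

lemma rW_expansion:
  assumes "valid_mono m n \<alpha> I" "a < m + n"
  shows "rW \<alpha> I a v = rA \<alpha> I (D a v) + (\<Sum>k<m + n. sc (F_sign m k I * der_coeff m k \<alpha> I)
    (rA (der_exp m k \<alpha>) (der_odd m k I) (E k a v)))"
  using L_expansion[OF scalar assms(2,1), of v] by (simp add: L_def diff_eq_eq add.commute)

lemma E_X:
  assumes "a < m + n" "b < m + n" "c < m + n"
  shows "E a b (X c v) = sc (sgn2 (pE m a b) (m \<le> c)) (X c (E a b v))"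
  using L_X[OF valid_mono_var[OF assms(1)] assms(2,3)] by (simp add: E_def pD_var)

lemma E_D:
  assumes "a < m + n" "b < m + n" "c < m + n"
  shows "E a b (D c v) = sc (sgn2 (pE m a b) (m \<le> c)) (D c (E a b v))"
  using D_L[OF valid_mono_var[OF assms(1)] assms(2,3), of v]
  by (simp add: E_def pD_var der_coeff_var der_var L_one sgn2_square sgn2_commute[of _ "pE m a b"])

lemma lin_E: "a < m + n \<Longrightarrow> b < m + n \<Longrightarrow> lin (E a b)"
  using lin_L[OF valid_mono_var] by (simp add: E_def[abs_def])

text \<open>The operators \<open>x\<^sub>a \<partial>\<^sub>b\<close> and \<open>X a \<circ> D b\<close> both satisfy the relations of matrix units, and
  their difference \<open>E a b\<close> supercommutes with the latter, so it satisfies them as well.\<close>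

lemma E_E:
  assumes "a < m + n" "b < m + n" "c < m + n" "f < m + n"
  shows "E a b (E c f v) - sc (sgn2 (pE m a b) (pE m c f)) (E c f (E a b v))
    = (if b = c then E a f v else 0)
      - (if f = a then sc (sgn2 (pE m a b) (pE m c f)) (E c b v) else 0)"
proof -
  define R where "R a b = rW (var_exp m a) (var_odd m a) b" for a b
  let ?s = "sgn2 (pE m a b) (pE m c f)"
  have R: "R a b v = X a (D b v) + E a b v" for a b v
    by (simp add: R_def E_def L_def X_def)
  have RR: "R a b (R c f v) = sc ?s (R c f (R a b v))
      + ((if b = c then R a f v else 0) - (if f = a then sc ?s (R c b v) else 0))"
    using rW_rW[OF valid_mono_var[OF assms(1)] assms(2) valid_mono_var[OF assms(3)] assms(4), of v]
    by (simp add: R_def pD_var app_coeff_def der_coeff_var app_exp_def app_odd_def der_var)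
  have XE: "E a b (X c (D f v)) = sc ?s (X c (D f (E a b v)))"
    if "a < m + n" "b < m + n" "c < m + n" "f < m + n" "?s = sgn2 (pE m a b) (pE m c f)" for a b c f v
  proof -
    have "?s = sgn2 (pE m a b) (m \<le> c) * sgn2 (pE m a b) (m \<le> f)"
      unfolding that(5) by (auto simp: sgn2_def pE_def)
    then show ?thesis using that by (simp add: E_X E_D lin_simps[OF lin_X] lin_simps[OF lin_D])
  qed
  have XX: "X a (D b (X c (D f v))) = sc ?s (X c (D f (X a (D b v))))
      + ((if b = c then X a (D f v) else 0) - (if f = a then sc ?s (X c (D b v)) else 0))"
  proof -
    have "X a (D b (X c (D f v))) = sc (sgn2 (m \<le> b) (m \<le> c)) (X a (X c (D b (D f v))))
        + (if b = c then X a (D f v) else 0)"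
      using assms by (simp add: weyl.d_x lin_simps[OF lin_X])
    moreover have "X a (X c (D b (D f v)))
        = sc (sgn2 (m \<le> a) (m \<le> c) * sgn2 (m \<le> b) (m \<le> f)) (X c (X a (D f (D b v))))"
      using assms by (subst weyl.x_x, simp, simp, subst weyl.d_d) (simp_all add: lin_simps[OF lin_X])
    moreover have "X c (D f (X a (D b v))) = sc (sgn2 (m \<le> f) (m \<le> a)) (X c (X a (D f (D b v))))
        + (if f = a then X c (D b v) else 0)"
      using assms by (simp add: weyl.d_x lin_simps[OF lin_X])
    moreover have "sgn2 (m \<le> b) (m \<le> c) * (sgn2 (m \<le> a) (m \<le> c) * sgn2 (m \<le> b) (m \<le> f))
        = ?s * sgn2 (m \<le> f) (m \<le> a)"
      by (auto simp: sgn2_def pE_def)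
    ultimately show ?thesis by (simp add: scale_right_distrib)
  qed
  \<comment> \<open>Writing \<open>E\<close> as the difference of \<open>R\<close> and
    \<open>X \<circ> D\<close> leaves mixed terms in both products; \<open>c1\<close> and
    \<open>c2\<close> make them cancel in the supercommutator.\<close>
  have l: "E a b (E c f v) = R a b (R c f v) - X a (D b (X c (D f v)))
      - (E a b (X c (D f v)) + X a (D b (E c f v)))"
    using assms by (simp add: R lin_simps[OF lin_X] lin_simps[OF lin_D] lin_simps[OF lin_E])
  have r: "E c f (E a b v) = R c f (R a b v) - X c (D f (X a (D b v)))
      - (E c f (X a (D b v)) + X c (D f (E a b v)))"
    using assms by (simp add: R lin_simps[OF lin_X] lin_simps[OF lin_D] lin_simps[OF lin_E])
  have c1: "E a b (X c (D f v)) = sc ?s (X c (D f (E a b v)))"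
    using XE[OF assms] by simp
  have "E c f (X a (D b v)) = sc ?s (X a (D b (E c f v)))"
    using XE[OF assms(3,4,1,2)] by (simp add: sgn2_commute)
  then have c2: "sc ?s (E c f (X a (D b v))) = X a (D b (E c f v))" by (simp add: sgn2_square)
  show ?thesis
    unfolding l r scale_right_diff_distrib scale_right_distrib c1 c2 RR XX
    by (simp add: R scale_right_distrib)
qed

text \<open>Simplicity carries over because \<open>rA_kop\<close> and \<open>rW_expansion\<close>
  express \<open>rA\<close> and \<open>rW\<close> through the Weyl operators and the
  \<open>E k a\<close>. The weight condition is unchanged, since
  \<open>X a \<circ> D a + E a a\<close> is the Cartan operator \<open>H a\<close>.\<close>

sublocale gl: weyl_gl_bimodule sc m n VG X D E
proof
  fix a b assume *: "a < m + n" "b < m + n"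
  show "hom_op sc UNIV VG (pE m a b) (E a b)"
    using L_hom[OF valid_mono_var[OF *(1)] *(2)] by (simp add: E_def[abs_def] pD_var)
next
  show "simple_graded sc UNIV VG (K_ops m n X D \<union> gl_ops m n E)"
    unfolding simple_graded_def
  proof (intro conjI allI impI)
    show "\<exists>v\<in>UNIV. v \<noteq> (0 :: 'v)" using simple unfolding simple_graded_def by (rule conjunct1)
  next
    fix U assume U: "subspace U \<and> U \<subseteq> UNIV \<and>
        (\<forall>v\<in>U. \<exists>v0\<in>U \<inter> VG False. \<exists>v1\<in>U \<inter> VG True. v = v0 + v1) \<and>
        (\<forall>f\<in>K_ops m n X D \<union> gl_ops m n E. f ` U \<subseteq> U)"
    then have img: "\<And>f. f \<in> K_ops m n X D \<union> gl_ops m n E \<Longrightarrow> f ` U \<subseteq> U" and sub: "subspace U" by blast+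
    have XD: "X a u \<in> U" "D a u \<in> U" if "a < m + n" "u \<in> U" for a u
      using img[of "X a"] img[of "D a"] that by (auto simp: K_ops_def image_subset_iff)
    have E_st: "E a b u \<in> U" if "a < m + n" "b < m + n" "u \<in> U" for a b u
    proof -
      have "E a b \<in> gl_ops m n E" using that by (auto simp: gl_ops_def)
      then show ?thesis using img[of "E a b"] that(3) by blast
    qed
    have rA_st: "rA \<alpha> I u \<in> U" if "valid_mono m n \<alpha> I" "u \<in> U" for \<alpha> I u
      using rA_kop[OF that(1)] weyl.kop_stable[OF _ sub XD that(2)] by blast
    have rW_st: "rW \<alpha> I a u \<in> U" if "valid_mono m n \<alpha> I" "a < m + n" "u \<in> U" for \<alpha> I a u
      unfolding rW_expansion[OF that(1,2)] using that
      by (intro subspace_add subspace_sum subspace_scale sub rA_st XD E_st valid_mono_der) auto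
    show "U = {0} \<or> U = UNIV"
    proof (rule simple_gradedD[OF simple sub subset_UNIV])
      show "\<exists>v0\<in>U \<inter> VG False. \<exists>v1\<in>U \<inter> VG True. v = v0 + v1" if "v \<in> U" for v
        using U that by blast
      show "f ` U \<subseteq> U" if "f \<in> AW_ops m n rA rW" for f
        using that rA_st rW_st by (auto simp: AW_ops_def)
    qed
  qed
next
  have "H a v = X a (D a v) + E a a v" for a v
    by (simp add: H_def E_def L_def X_def)
  then have "(\<lambda>a v. X a (D a v) + E a a v) = H" by (intro ext) simp
  then show "is_weight sc UNIV (m + n) (\<lambda>a v. X a (D a v) + E a a v)" using weight by simp
qed (use E_X E_D E_E in auto)

end

section \<open>The isomorphism with F(P, M)\<close>

lemma sum_lessThan_add:
  fixes m n :: nat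
  shows "(\<Sum>k<m + n. f k) = (\<Sum>k<m. f k) + (\<Sum>k<n. f (m + k) :: 'a::comm_monoid_add)"
  by (induction n) (simp_all add: add.assoc)

theorem theorem3p9:
  fixes m n :: nat
    and sc :: "complex \<Rightarrow> 'v::ab_group_add \<Rightarrow> 'v"
    and VG :: "bool \<Rightarrow> 'v set"
    and rA :: "(nat \<Rightarrow> nat) \<Rightarrow> nat set \<Rightarrow> 'v \<Rightarrow> 'v"
    and rW :: "(nat \<Rightarrow> nat) \<Rightarrow> nat set \<Rightarrow> nat \<Rightarrow> 'v \<Rightarrow> 'v"
  assumes "(m, n) \<noteq> (0, 0)"
    and "AW_module m n sc VG rA rW"
    and "simple_graded sc UNIV VG (AW_ops m n rA rW)"
    and "is_weight sc UNIV (m + n) (AW_cartan m rW)"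
    and "\<exists>wt. wspace sc UNIV (m + n) (AW_cartan m rW) wt \<noteq> {0}
              \<and> fin_dim sc (wspace sc UNIV (m + n) (AW_cartan m rW) wt)"
  shows "\<exists>Pc PG x d Mc MG E \<beta>.
           K_module m n sc Pc PG x d \<and> simple_graded sc Pc PG (K_ops m n x d)
           \<and> is_weight sc Pc (m + n) (K_cartan x d)
           \<and> gl_module m n sc Mc MG E \<and> simple_graded sc Mc MG (gl_ops m n E)
           \<and> is_weight sc Mc (m + n) (\<lambda>a. E a a)
           \<and> F_iso m n sc VG rA rW Pc PG x d Mc MG E \<beta>"
proof -
  interpret vector_space sc using assms(2) by (simp add: AW_module_def)
  interpret aw: aw_module sc m n VG rA rW by unfold_locales (rule assms(2))
  obtain wt where "wspace sc UNIV (m + n) aw.H wt \<noteq> {0}" "fin_dim sc (wspace sc UNIV (m + n) aw.H wt)"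
    using assms(5) by blast
  from aw.weyl_eigenvector_exists[OF this] obtain v z where
    v: "v \<noteq> 0" "\<And>a. a < m + n \<Longrightarrow> aw.H a v = sc (wt a) v" "\<And>a. a < m + n \<Longrightarrow> aw.N a v = sc (z a) v"
    by blast
  \<comment> \<open>The difference \<open>H a - N a\<close> multiplies \<open>v\<close> by
    \<open>wt a - z a\<close>, and \<open>Eu\<close> is the sum of these differences.\<close>
  define e where "e = (\<Sum>a<m + n. wt a - z a)"
  have "v \<in> aw.eig e"
    using v by (simp add: aw.eig_def aw.Eu_def e_def scale_sum_left scale_left_diff_distrib)
  from aw.Eu_scalar[OF assms(3) v(1) this]
  interpret aw: simple_aw_module sc m n VG rA rW e by unfold_locales (use assms in auto)
  obtain v0 \<kappa> p0 where v0: "v0 \<noteq> 0" "v0 \<in> VG p0"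
    "\<And>a. a < m + n \<Longrightarrow> aw.N a v0 = sc (\<kappa> a) v0 \<and> aw.weyl.extremal a (\<kappa> a) v0"
    using aw.weyl.extremal_vector_exists[OF v(1)] v(3) by metis
  interpret t: weyl_gl_bimodule_extremal sc m n VG aw.X aw.D aw.E v0 \<kappa> p0
    by unfold_locales (use v0 in auto)
  have rA_bt: "rA \<alpha> I (t.bt u w) = t.bt (rA \<alpha> I u) w" if "valid_mono m n \<alpha> I" "u \<in> t.Pc" "w \<in> t.Mc" for \<alpha> I u w
    using aw.rA_kop[OF that(1)] t.bt_kop_left[OF _ that(2,3)] by metis
  have "F_iso m n sc VG rA rW t.Pc t.PG aw.X aw.D t.Mc t.MG aw.E t.bt"
    unfolding F_iso_def
  proof (intro conjI allI impI ballI)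
    show "is_tensor sc t.Pc t.Mc t.bt" by (rule t.bt_tensor)
  next
    fix p q u w assume "u \<in> t.PG p" "w \<in> t.MG q"
    then show "t.bt u w \<in> VG (p \<noteq> q)" by (rule t.bt_VG)
  next
    fix \<alpha> I u w assume *: "valid_mono m n \<alpha> I" "u \<in> t.Pc" "w \<in> t.Mc"
    then show "rA \<alpha> I (t.bt u w) = t.bt (monoP m aw.X \<alpha> I u) w"
      using rA_bt[OF *] aw.rA_eq_monoP[OF *(1)] by simp
  next
    fix \<alpha> I a p u w
    assume *: "valid_mono m n \<alpha> I \<and> a < m + n" and u: "u \<in> t.PG p" and w: "w \<in> t.Mc"
    then have val: "valid_mono m n \<alpha> I" and a: "a < m + n" and uP: "u \<in> t.Pc" using t.PG_Pc by auto
    have "aw.D a (t.bt u w) = t.bt (aw.D a u) w" "aw.D a u \<in> t.Pc"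
      using t.bt_kop_left[OF aw.weyl.d_kop[OF a] uP w] t.Pc_kop[OF aw.weyl.d_kop[OF a] uP] by simp_all
    then have 1: "rA \<alpha> I (aw.D a (t.bt u w)) = t.bt (monoP m aw.X \<alpha> I (aw.D a u)) w"
      using rA_bt[OF val _ w] aw.rA_eq_monoP[OF val] by simp
    have 2: "sc c (rA (der_exp m k \<alpha>) (der_odd m k I) (aw.E k a (t.bt u w)))
        = sc (c * sgn2 (pE m k a) p) (t.bt (monoP m aw.X (der_exp m k \<alpha>) (der_odd m k I) u) (aw.E k a w))"
      if k: "k < m + n" for c k
    proof -
      note vk = valid_mono_der[OF val, of k]
      have "t.bt (monoP m aw.X (der_exp m k \<alpha>) (der_odd m k I) u) (aw.E k a w)
          = rA (der_exp m k \<alpha>) (der_odd m k I) (t.bt u (aw.E k a w))"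
        using rA_bt[OF vk uP t.Mc_E[OF w k a]] aw.rA_eq_monoP[OF vk] by simp
      then show ?thesis
        using t.E_bt[OF u w k a] aw.lin_scale[OF aw.lin_rA[OF vk]] by simp
    qed
    have "rW \<alpha> I a (t.bt u w) = t.bt (monoP m aw.X \<alpha> I (aw.D a u)) w
        + (\<Sum>k<m + n. sc (F_sign m k I * der_coeff m k \<alpha> I * sgn2 (pE m k a) p)
            (t.bt (monoP m aw.X (der_exp m k \<alpha>) (der_odd m k I) u) (aw.E k a w)))"
      unfolding aw.rW_expansion[OF val a] 1 using 2 by (intro arg_cong2[where f = "(+)"] refl sum.cong) auto
    \<comment> \<open>Splitting the sum at \<open>m\<close> separates the even directions, where
      \<open>F_sign\<close> is 1, from the odd ones.\<close>
    then show "rW \<alpha> I a (t.bt u w) = t.bt (monoP m aw.X \<alpha> I (aw.D a u)) w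
          + (\<Sum>k<m. sc (of_nat (\<alpha> k) * sgn2 (pE m k a) p)
                       (t.bt (monoP m aw.X (\<alpha>(k := \<alpha> k - 1)) I u) (aw.E k a w)))
          + (\<Sum>k<n. sc ((- 1) ^ (card I + 1) * der_coeff m (m + k) \<alpha> I * sgn2 (pE m (m + k) a) p)
                       (t.bt (monoP m aw.X \<alpha> (der_odd m (m + k) I) u) (aw.E (m + k) a w)))"
      unfolding sum_lessThan_add
      by (simp add: F_sign_def der_exp_def der_odd_def der_coeff_def[of m k for k] add.assoc cong: sum.cong_simp)
  qed
  then show ?thesis
    using t.Pc_module t.Pc_simple t.Pc_weight t.Mc_module t.Mc_simple t.Mc_is_weight by blast
qed

end
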